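(* Let $(\mathfrak{g},\Omega,\vartheta)$ be a reductive lcs Lie algebra with $\vartheta\ne0$. Then either $\mathfrak{g}\cong\mathfrak{su}_2\oplus\mathbb{R}$ or $\mathfrak{g}\cong\mathfrak{sl}_2(\mathbb{R})\oplus\mathbb{R}$.
   Context: Lie algebras are real and finite-dimensional; $d$ is the Chevalley–Eilenberg differential. An lcs Lie algebra $(\mathfrak{g},\Omega,\vartheta)$ is a Lie algebra of dimension $2n\ge4$ with $\Omega\in\Lambda^2\mathfrak{g}^*$, $\vartheta\in\mathfrak{g}^*$, $\Omega^n\ne0$, $d\vartheta=0$, $d\Omega=\vartheta\wedge\Omega$. *)

theory Defs
  imports "HOL-Analysis.Analysis"
begin

section \<open>Lie algebras\<close>

text \<open>The underlying vector space is the whole type; finite dimension is an assumption.\<close>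

locale lie_algebra =
  fixes br :: "'a::real_vector \<Rightarrow> 'a \<Rightarrow> 'a"
  assumes finite_dim: "\<exists>B :: 'a set. finite B \<and> span B = UNIV"
    and bilinear_br: "bilinear br"
    and br_self: "br x x = 0"
    and jacobi: "br x (br y z) + br y (br z x) + br z (br x y) = 0"

text \<open>In the following, \<open>L\<close> is the carrier of a Lie algebra with bracket \<open>br\<close>
  (the whole type, or a subspace closed under \<open>br\<close>).\<close>

definition lie_ideal :: "('a::real_vector \<Rightarrow> 'a \<Rightarrow> 'a) \<Rightarrow> 'a set \<Rightarrow> 'a set \<Rightarrow> bool" where
  "lie_ideal br L I \<longleftrightarrow> subspace I \<and> I \<subseteq> L \<and> (\<forall>x\<in>L. \<forall>y\<in>I. br x y \<in> I)"

definition lie_derived :: "('a::real_vector \<Rightarrow> 'a \<Rightarrow> 'a) \<Rightarrow> 'a set \<Rightarrow> 'a set" where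
  "lie_derived br L = span {br x y |x y. x \<in> L \<and> y \<in> L}"

definition lie_solvable :: "('a::real_vector \<Rightarrow> 'a \<Rightarrow> 'a) \<Rightarrow> 'a set \<Rightarrow> bool" where
  "lie_solvable br L \<longleftrightarrow> (\<exists>k. (lie_derived br ^^ k) L = {0})"

definition lie_semisimple :: "('a::real_vector \<Rightarrow> 'a \<Rightarrow> 'a) \<Rightarrow> 'a set \<Rightarrow> bool" where
  "lie_semisimple br L \<longleftrightarrow> (\<forall>I. lie_ideal br L I \<and> lie_solvable br I \<longrightarrow> I = {0})"

definition lie_abelian :: "('a::real_vector \<Rightarrow> 'a \<Rightarrow> 'a) \<Rightarrow> 'a set \<Rightarrow> bool" where
  "lie_abelian br L \<longleftrightarrow> (\<forall>x\<in>L. \<forall>y\<in>L. br x y = 0)"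

text \<open>Reductive means: direct sum of a semisimple and an abelian Lie algebra. Either summand may
  be zero.\<close>

definition lie_reductive :: "('a::real_vector \<Rightarrow> 'a \<Rightarrow> 'a) \<Rightarrow> 'a set \<Rightarrow> bool" where
  "lie_reductive br L \<longleftrightarrow>
     (\<exists>S A. lie_ideal br L S \<and> lie_ideal br L A \<and>
            S \<inter> A = {0} \<and> {s + a |s a. s \<in> S \<and> a \<in> A} = L \<and>
            lie_semisimple br S \<and> lie_abelian br A)"

definition lie_isomorphic ::
  "('a::real_vector \<Rightarrow> 'a \<Rightarrow> 'a) \<Rightarrow> 'a set \<Rightarrow> ('b::real_vector \<Rightarrow> 'b \<Rightarrow> 'b) \<Rightarrow> 'b set \<Rightarrow> bool" where
  "lie_isomorphic br L br' L' \<longleftrightarrow>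
     (\<exists>f. linear f \<and> bij_betw f L L' \<and> (\<forall>x\<in>L. \<forall>y\<in>L. f (br x y) = br' (f x) (f y)))"

text \<open>Bracket of the direct sum; the carrier is the Cartesian product of the carriers.\<close>

definition sum_bracket ::
  "('a \<Rightarrow> 'a \<Rightarrow> 'a) \<Rightarrow> ('b \<Rightarrow> 'b \<Rightarrow> 'b) \<Rightarrow> 'a \<times> 'b \<Rightarrow> 'a \<times> 'b \<Rightarrow> 'a \<times> 'b" where
  "sum_bracket br br' p q = (br (fst p) (fst q), br' (snd p) (snd q))"

definition abelian_bracket :: "'a::real_vector \<Rightarrow> 'a \<Rightarrow> 'a" where
  "abelian_bracket x y = 0"

definition commutator :: "'a::ring_1 ^ 'n ^ 'n \<Rightarrow> 'a ^ 'n ^ 'n \<Rightarrow> 'a ^ 'n ^ 'n" where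
  "commutator A B = A ** B - B ** A"

definition su2 :: "(complex ^ 2 ^ 2) set" where
  "su2 = {A. (\<chi> i j. cnj (A $ j $ i)) = - A \<and> trace A = 0}"

definition sl2_real :: "(real ^ 2 ^ 2) set" where
  "sl2_real = {A. trace A = 0}"


section \<open>Exterior forms and the Chevalley--Eilenberg differential\<close>

text \<open>A \<open>k\<close>-form takes a sequence of arguments but only reads the entries \<open>0, \<dots>, k - 1\<close>, so that
  equality of \<open>k\<close>-forms is equality of functions.\<close>

type_synonym 'a form = "(nat \<Rightarrow> 'a) \<Rightarrow> real"

definition alternating_form :: "nat \<Rightarrow> 'a::real_vector form \<Rightarrow> bool" where
  "alternating_form k \<omega> \<longleftrightarrow>
     (\<forall>v w. (\<forall>i<k. v i = w i) \<longrightarrow> \<omega> v = \<omega> w) \<and>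
     (\<forall>v. \<forall>i<k. linear (\<lambda>x. \<omega> (v(i := x)))) \<and>
     (\<forall>v i j. i < j \<and> j < k \<and> v i = v j \<longrightarrow> \<omega> v = 0)"

text \<open>Wedge product of a \<open>p\<close>-form and a \<open>q\<close>-form, normalised so that
  \<open>(\<alpha> \<and> \<beta>)(x, y) = \<alpha>(x) \<beta>(y) - \<alpha>(y) \<beta>(x)\<close> for \<open>1\<close>-forms.\<close>

definition wedge :: "nat \<Rightarrow> nat \<Rightarrow> 'a form \<Rightarrow> 'a form \<Rightarrow> 'a form" where
  "wedge p q \<alpha> \<beta> v =
     (\<Sum>\<sigma> | \<sigma> permutes {..<p + q}.
        of_int (sign \<sigma>) * \<alpha> (\<lambda>i. v (\<sigma> i)) * \<beta> (\<lambda>i. v (\<sigma> (p + i)))) / (fact p * fact q)"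

primrec wedge_power :: "nat \<Rightarrow> 'a form \<Rightarrow> nat \<Rightarrow> 'a form" where
  "wedge_power p \<omega> 0 = (\<lambda>v. 1)"
| "wedge_power p \<omega> (Suc m) = wedge p (p * m) \<omega> (wedge_power p \<omega> m)"

text \<open>\<open>skip i\<close> enumerates the natural numbers other than \<open>i\<close> in increasing order; for \<open>i < j\<close>,
  \<open>skip j \<circ> skip i\<close> enumerates those other than \<open>i\<close> and \<open>j\<close>.\<close>

definition skip :: "nat \<Rightarrow> nat \<Rightarrow> nat" where
  "skip i m = (if m < i then m else Suc m)"

text \<open>For a \<open>k\<close>-form (trivial real coefficients),
  \<open>d\<omega>(v\<^sub>0, \<dots>, v\<^sub>k) = \<Sum>i<j. (-1)\<^bsup>i+j\<^esup> \<omega>([v\<^sub>i, v\<^sub>j], v\<^sub>0, \<dots>, v\<^sub>k)\<close>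
  with \<open>v\<^sub>i\<close> and \<open>v\<^sub>j\<close> omitted after the bracket; thus \<open>d\<alpha>(x, y) = - \<alpha>([x, y])\<close>
  for a \<open>1\<close>-form.\<close>

definition ce_diff :: "('a \<Rightarrow> 'a \<Rightarrow> 'a) \<Rightarrow> nat \<Rightarrow> 'a form \<Rightarrow> 'a form" where
  "ce_diff br k \<omega> v =
     (\<Sum>(i, j) \<in> {(i, j). i < j \<and> j \<le> k}.
        (-1) ^ (i + j) * \<omega> (case_nat (br (v i) (v j)) (\<lambda>m. v (skip j (skip i m)))))"


section \<open>Locally conformally symplectic Lie algebras\<close>

locale lcs_lie_algebra = lie_algebra br
  for br :: "'a::real_vector \<Rightarrow> 'a \<Rightarrow> 'a" +
  fixes n :: nat and \<Omega> \<theta> :: "'a form"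
  assumes n_ge_2: "n \<ge> 2"
    and dim_eq: "dim (UNIV :: 'a set) = 2 * n"
    and form_\<Omega>: "alternating_form 2 \<Omega>"
    and form_\<theta>: "alternating_form 1 \<theta>"
    and nondegenerate: "wedge_power 2 \<Omega> n \<noteq> (\<lambda>v. 0)"
    and d_\<theta>: "ce_diff br 1 \<theta> = (\<lambda>v. 0)"
    and d_\<Omega>: "ce_diff br 2 \<Omega> = wedge 1 2 \<theta> \<Omega>"

end

theory Submission
  imports Defs "HOL-Computational_Algebra.Fundamental_Theorem_Algebra"
begin

text \<open>
  Write the algebra as \<open>S \<oplus> A\<close> with \<open>S\<close> semisimple and \<open>A\<close> central. By Cartan's criterion the Killing
  form \<open>K\<close> is nondegenerate on \<open>S\<close>; hence \<open>\<theta>\<close> vanishes on \<open>S\<close>, and some \<open>c \<in> A\<close> has \<open>\<theta>(c) = 1\<close>.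
  Contracting \<open>d\<Omega> = \<theta> \<and> \<Omega>\<close> with \<open>c\<close> gives
  \<open>\<Omega>(x, y) = \<eta>([x, y]) + \<theta>(x) \<eta>(y) - \<theta>(y) \<eta>(x)\<close> with \<open>\<eta> = - \<Omega>(\<cdot>, c)\<close>. If \<open>H \<in> S\<close> represents
  \<open>\<eta>\<close> on \<open>S\<close> through \<open>K\<close>, nondegeneracy of \<open>\<Omega>\<close> forces \<open>A = \<real>c\<close>, \<open>K(H, H) \<noteq> 0\<close> and the centralizer
  of \<open>H\<close> to be spanned by \<open>H\<close> and \<open>c\<close>. So \<open>S\<close> has rank one: over the complex numbers, vanishing traces
  of commutators on sums of generalised eigenspaces of \<open>ad H\<close> leave only the eigenvalues \<open>0\<close> and a
  pair of opposite simple ones, whence \<open>dim S = 3\<close>. In an orthogonal basis \<open>H\<close>, \<open>e\<close>, \<open>f = [H, e]\<close> the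
  brackets are \<open>[H, f] = q e\<close> and \<open>[e, f] = p H\<close>, and the signs of \<open>p\<close> and \<open>q\<close> decide between
  \<open>su\<^sub>2\<close> and \<open>sl\<^sub>2(\<real>)\<close>.
\<close>

section \<open>Traces and generalised eigenspaces\<close>

text \<open>Nondegeneracy enters through one observation. If s in S commutes with H, or s lies in A
  with \<theta>(s) = 0, then \<eta>([s, y]) = 0, hence \<Omega>(s, y) = - \<theta>(y) \<eta>(s).
  These functionals are all multiples of \<theta> and H is itself such an s, so every such s is a
  multiple of H, and \<eta>(H) = K(H, H) cannot vanish. The eigenvalues of ad H may be imaginary, so
  the count takes place in the complexification; ad H is not known to be diagonalisable, hence
  generalised eigenspaces. The vector c is carried along instead of passing to S: the ambient space
  is a whole type, so restrictions and quotients are replaced by partial diagonal sums of a matrix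
  and by statements relative to a pair of subspaces. No root system is built. Traces show that a
  nonzero weight \<nu> is simple and that k \<nu> is no weight for integers k \<ge> 2. With \<nu> of
  largest modulus, a weight outside 0, \<nu>, -\<nu> would, again by a trace, force the weights
  \<nu>/2 and -\<nu>/2, and the double \<nu> of the first is forbidden.\<close>

locale complex_findim = finite_dimensional_vector_space scale Basis
  for scale :: "complex \<Rightarrow> 'b::ab_group_add \<Rightarrow> 'b" and Basis :: "'b set"
begin

abbreviation lin :: "('b \<Rightarrow> 'b) \<Rightarrow> bool" where
  "lin \<equiv> Vector_Spaces.linear scale scale"

lemma lin_add: "lin f \<Longrightarrow> f (x + y) = f x + f y"
  and lin_scale: "lin f \<Longrightarrow> f (scale c x) = scale c (f x)"
  by (simp_all add: Vector_Spaces.linear_iff)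

lemma lin_0: "lin f \<Longrightarrow> f 0 = 0"
  using module_hom.zero module_hom_iff_linear by blast

lemma lin_diff: "lin f \<Longrightarrow> f (x - y) = f x - f y"
  using module_hom.diff module_hom_iff_linear by blast

lemma lin_sum: "lin f \<Longrightarrow> f (\<Sum>a\<in>S. g a) = (\<Sum>a\<in>S. f (g a))"
  using module_hom.sum module_hom_iff_linear by blast

lemma lin_span:
  assumes "lin f" "\<And>b. b \<in> S \<Longrightarrow> f b \<in> W" "subspace W" "v \<in> span S"
  shows "f v \<in> W"
  using assms
  by (metis (no_types, lifting) image_subset_iff module_hom.span_image module_hom_iff_linear imageI span_minimal subsetD)

lemma linI: "(\<And>x y. f (x + y) = f x + f y) \<Longrightarrow> (\<And>c x. f (scale c x) = scale c (f x)) \<Longrightarrow> lin f"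
  by (simp add: Vector_Spaces.linear_iff vector_space_axioms)

lemma lin_shift: "lin f \<Longrightarrow> lin (\<lambda>v. f v - scale c v)"
  by (rule linI) (simp_all add: lin_add lin_scale scale_right_distrib scale_right_diff_distrib mult.commute)

lemma lin_funpow: "lin f \<Longrightarrow> lin (f ^^ k)"
  by (induction k) (simp_all add: Vector_Spaces.linear_iff)

lemma representation_span_subset:
  assumes "independent B" "S \<subseteq> B" "v \<in> span S" "c \<in> B - S"
  shows "representation B v c = 0"
proof -
  have "representation B v = representation S v"
    using assms representation_extend by blast
  thus ?thesis
    using assms representation_ne_zero by auto
qed

lemma sum_representation_subset:
  assumes "independent B" "S \<subseteq> B" "finite S" "v \<in> span S"
  shows "(\<Sum>c\<in>S. scale (representation B v c) c) = v"
proof -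
  have "representation B v = representation S v"
    using assms representation_extend by blast
  thus ?thesis
    using assms sum_representation_eq[of S v S] independent_mono by auto
qed

text \<open>The trace of the \<open>S\<close>-block of the matrix of \<open>T\<close> in the basis
  \<open>B\<close>. It is the trace of the restriction of \<open>T\<close> whenever
  \<open>span S\<close> is invariant, without \<open>T\<close> having to be restricted.\<close>

definition diag_sum :: "'b set \<Rightarrow> 'b set \<Rightarrow> ('b \<Rightarrow> 'b) \<Rightarrow> complex" where
  "diag_sum B S T = (\<Sum>b\<in>S. representation B (T b) b)"

lemma representation_lin_sum:
  assumes "independent B" "span B = UNIV" "lin T"
  shows "representation B (T (\<Sum>c\<in>S. scale (f c) c)) b = (\<Sum>c\<in>S. f c * representation B (T c) b)"
proof -
  have "T (\<Sum>c\<in>S. scale (f c) c) = (\<Sum>c\<in>S. scale (f c) (T c))"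
    using assms by (simp add: lin_sum lin_scale)
  thus ?thesis
    using assms by (simp add: representation_sum representation_scale)
qed

text \<open>Since both operators preserve \<open>span S\<close>, the \<open>S\<close>-block of a
  product is the product of the \<open>S\<close>-blocks, and the usual double sum can be
  swapped.\<close>

lemma diag_sum_commute:
  assumes B: "independent B" "span B = UNIV" and S: "finite S" "S \<subseteq> B"
    and A: "lin A" "\<And>b. b \<in> S \<Longrightarrow> A b \<in> span S"
    and C: "lin C" "\<And>b. b \<in> S \<Longrightarrow> C b \<in> span S"
  shows "diag_sum B S (\<lambda>v. A (C v)) = diag_sum B S (\<lambda>v. C (A v))"
proof -
  have *: "representation B (A' (C' b)) b = (\<Sum>c\<in>S. representation B (C' b) c * representation B (A' c) b)"
    if "lin A'" "lin C'" "\<And>b. b \<in> S \<Longrightarrow> C' b \<in> span S" "b \<in> S" for A' C' b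
  proof -
    have "C' b = (\<Sum>c\<in>S. scale (representation B (C' b) c) c)"
      using sum_representation_subset[OF B(1) S(2) S(1)] that by simp
    thus ?thesis
      using representation_lin_sum[OF B that(1)] by metis
  qed
  have "diag_sum B S (\<lambda>v. A (C v)) = (\<Sum>b\<in>S. \<Sum>c\<in>S. representation B (C b) c * representation B (A c) b)"
    unfolding diag_sum_def by (intro sum.cong refl *) (use A C in auto)
  also have "\<dots> = (\<Sum>c\<in>S. \<Sum>b\<in>S. representation B (C b) c * representation B (A c) b)"
    by (rule sum.swap)
  also have "\<dots> = diag_sum B S (\<lambda>v. C (A v))"
    unfolding diag_sum_def by (intro sum.cong refl) (simp add: * A C mult.commute)
  finally show ?thesis .
qed

text \<open>The Killing form is computed in the fixed basis \<open>Basis\<close>, eigenvalues are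
  read off an adapted one; this lemma connects the two.\<close>

lemma diag_sum_basis_change:
  assumes B: "independent B" "span B = UNIV" "finite B"
    and C: "independent C" "span C = UNIV" "finite C" and T: "lin T"
  shows "diag_sum B B T = diag_sum C C T"
proof -
  have *: "representation B (T b) b = (\<Sum>c\<in>C. representation C (T b) c * representation B c b)" for b
  proof -
    have "T b = (\<Sum>c\<in>C. scale (representation C (T b) c) c)"
      using sum_representation_subset[of C C "T b"] C by auto
    thus ?thesis
      using representation_lin_sum[OF B(1,2), of "\<lambda>v. v"] linI[of "\<lambda>v. v"] by metis
  qed
  have **: "representation C (T c) c = (\<Sum>b\<in>B. representation B c b * representation C (T b) c)" for c
  proof -
    have "c = (\<Sum>b\<in>B. scale (representation B c b) b)"
      using sum_representation_subset[of B B c] B by auto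
    thus ?thesis
      using representation_lin_sum[OF C(1,2) T] by metis
  qed
  show ?thesis
    unfolding diag_sum_def * ** by (subst sum.swap) (simp add: mult.commute)
qed

lemma diag_sum_add:
  assumes "independent B" "span B = UNIV"
  shows "diag_sum B S (\<lambda>v. T v + U v) = diag_sum B S T + diag_sum B S U"
  using assms by (simp add: diag_sum_def representation_add sum.distrib)

lemma diag_sum_diff:
  assumes "independent B" "span B = UNIV"
  shows "diag_sum B S (\<lambda>v. T v - U v) = diag_sum B S T - diag_sum B S U"
  using assms by (simp add: diag_sum_def representation_diff sum_subtractf)

lemma diag_sum_scale:
  assumes "independent B" "span B = UNIV"
  shows "diag_sum B S (\<lambda>v. scale c (T v)) = c * diag_sum B S T"
  using assms by (simp add: diag_sum_def representation_scale sum_distrib_left)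

section \<open>Generalised eigenspaces and their independence\<close>

definition gen_eigenspace :: "('b \<Rightarrow> 'b) \<Rightarrow> complex \<Rightarrow> 'b set" where
  "gen_eigenspace D \<mu> = {v. \<exists>k. ((\<lambda>v. D v - scale \<mu> v) ^^ k) v = 0}"

lemma funpow_zero_mono:
  assumes "lin f" "(f ^^ k) v = 0" "k \<le> l"
  shows "(f ^^ l) v = 0"
proof -
  have "(f ^^ l) v = (f ^^ (l - k)) ((f ^^ k) v)"
    using assms(3) by (metis funpow_add comp_apply le_add_diff_inverse2)
  thus ?thesis
    using assms lin_funpow lin_0 by metis
qed

lemma subspace_gen_eigenspace:
  assumes "lin D"
  shows "subspace (gen_eigenspace D \<mu>)"
proof -
  let ?f = "\<lambda>v. D v - scale \<mu> v"
  note f = lin_shift[OF assms, of \<mu>]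
  show ?thesis
  proof (rule subspaceI)
    show "0 \<in> gen_eigenspace D \<mu>"
      unfolding gen_eigenspace_def by (auto intro!: exI[of _ 0])
  next
    fix x y assume "x \<in> gen_eigenspace D \<mu>" "y \<in> gen_eigenspace D \<mu>"
    then obtain k l where "(?f ^^ k) x = 0" "(?f ^^ l) y = 0"
      by (auto simp: gen_eigenspace_def)
    hence "(?f ^^ (max k l)) x = 0" "(?f ^^ (max k l)) y = 0"
      using funpow_zero_mono[OF f] by (meson max.cobounded1 max.cobounded2)+
    hence "(?f ^^ (max k l)) (x + y) = 0"
      by (simp add: lin_add[OF lin_funpow[OF f]])
    thus "x + y \<in> gen_eigenspace D \<mu>"
      unfolding gen_eigenspace_def by blast
  next
    fix c x assume "x \<in> gen_eigenspace D \<mu>"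
    then obtain k where "(?f ^^ k) x = 0"
      by (auto simp: gen_eigenspace_def)
    hence "(?f ^^ k) (scale c x) = 0"
      by (simp add: lin_scale[OF lin_funpow[OF f]])
    thus "scale c x \<in> gen_eigenspace D \<mu>"
      unfolding gen_eigenspace_def by blast
  qed
qed

lemma gen_eigenspace_shift:
  assumes "lin D" "v \<in> gen_eigenspace D \<mu>"
  shows "D v - scale \<nu> v \<in> gen_eigenspace D \<mu>"
proof -
  let ?f = "\<lambda>v. D v - scale \<mu> v"
  from assms obtain k where "(?f ^^ k) v = 0"
    by (auto simp: gen_eigenspace_def)
  hence "(?f ^^ k) (?f v) = 0"
    using funpow_zero_mono[OF lin_shift[OF assms(1)], of k \<mu> v "Suc k"]
    by (simp add: funpow_Suc_right del: funpow.simps)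
  hence "?f v \<in> gen_eigenspace D \<mu>"
    by (auto simp: gen_eigenspace_def)
  hence "?f v + scale (\<mu> - \<nu>) v \<in> gen_eigenspace D \<mu>"
    using subspace_gen_eigenspace[OF assms(1)] assms(2) by (simp add: subspace_add subspace_scale)
  thus ?thesis
    by (simp add: algebra_simps)
qed

lemma funpow_shift_zero:
  "((\<lambda>v. D v - scale \<mu> v) ^^ Suc k) v = ((\<lambda>v. D v - scale \<mu> v) ^^ k) (D v - scale \<mu> v)"
  by (simp add: funpow_Suc_right del: funpow.simps)

text \<open>Induction on the sum of the two exponents: shifting \<open>v\<close> by either value
  lowers one exponent and keeps the other, so both shifted vectors vanish and \<open>v\<close> is an
  eigenvector for two different values.\<close>

lemma gen_eigenspace_disjoint:
  assumes D: "lin D" and "\<mu> \<noteq> \<nu>" "v \<in> gen_eigenspace D \<mu>" "v \<in> gen_eigenspace D \<nu>"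
  shows "v = 0"
proof -
  have "v = 0" if "((\<lambda>v. D v - scale \<mu> v) ^^ k) v = 0" "((\<lambda>v. D v - scale \<nu> v) ^^ l) v = 0" for k l v
    using that
  proof (induction "k + l" arbitrary: k l v rule: less_induct)
    case less
    show ?case
    proof (cases k; cases l)
      fix k' l' assume kl: "k = Suc k'" "l = Suc l'"
      have comm: "((\<lambda>v. D v - scale \<alpha> v) ^^ m) (D v - scale \<beta> v) = 0"
        if "((\<lambda>v. D v - scale \<alpha> v) ^^ m) v = 0" for \<alpha> \<beta> m
      proof -
        let ?f = "\<lambda>v. D v - scale \<alpha> v"
        have *: "D v - scale \<beta> v = ?f v + scale (\<alpha> - \<beta>) v"
          by (simp add: algebra_simps)
        have "(?f ^^ m) (?f v) = 0"
          using funpow_zero_mono[OF lin_shift[OF D], of m \<alpha> v "Suc m"] that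
          by (simp add: funpow_Suc_right del: funpow.simps)
        thus ?thesis
          unfolding * by (simp add: that lin_add[OF lin_funpow[OF lin_shift[OF D]]]
              lin_scale[OF lin_funpow[OF lin_shift[OF D]]])
      qed
      have "((\<lambda>v. D v - scale \<mu> v) ^^ k') (D v - scale \<mu> v) = 0"
        "((\<lambda>v. D v - scale \<nu> v) ^^ l') (D v - scale \<nu> v) = 0"
        using less.prems unfolding kl funpow_shift_zero by blast+
      hence "D v - scale \<mu> v = 0" "D v - scale \<nu> v = 0"
        using less.hyps[of k' l "D v - scale \<mu> v"] less.hyps[of k l' "D v - scale \<nu> v"]
          comm[OF less.prems(1)] comm[OF less.prems(2)] kl by simp_all
      hence "scale \<mu> v = scale \<nu> v"
        by (metis eq_iff_diff_eq_0)
      thus "v = 0"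
        using assms(2) by simp
    qed (use less in auto)
  qed
  thus ?thesis
    using assms by (auto simp: gen_eigenspace_def)
qed

text \<open>A power of \<open>D - \<nu>\<close> removes one summand and leaves a shorter sum that
  still lies in the space of \<open>\<mu>\<close>; by induction that sum is zero. So the original
  sum lies in the spaces of both \<open>\<nu>\<close> and \<open>\<mu>\<close>.\<close>

lemma gen_eigenspace_sum_disjoint:
  assumes D: "lin D" and "finite F" "\<mu> \<notin> F" "\<And>\<nu>. \<nu> \<in> F \<Longrightarrow> y \<nu> \<in> gen_eigenspace D \<nu>"
    and "(\<Sum>\<nu>\<in>F. y \<nu>) \<in> gen_eigenspace D \<mu>"
  shows "(\<Sum>\<nu>\<in>F. y \<nu>) = 0"
  using assms(2-)
proof (induction F arbitrary: y \<mu> rule: finite_induct)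
  case empty
  then show ?case by simp
next
  case (insert \<nu> F)
  let ?f = "\<lambda>v. D v - scale \<nu> v"
  note f = lin_shift[OF D, of \<nu>]
  have inv: "(?f ^^ k) v \<in> gen_eigenspace D \<alpha>" if "v \<in> gen_eigenspace D \<alpha>" for \<alpha> v k
    using that by (induction k) (simp_all add: gen_eigenspace_shift[OF D])
  from insert.prems obtain k where k: "(?f ^^ k) (y \<nu>) = 0"
    by (auto simp: gen_eigenspace_def)
  have "(?f ^^ k) (\<Sum>\<nu>\<in>insert \<nu> F. y \<nu>) = (\<Sum>\<alpha>\<in>F. (?f ^^ k) (y \<alpha>))"
    using insert.hyps k lin_sum[OF lin_funpow[OF f]] by (subst lin_sum[OF lin_funpow[OF f]]) simp
  moreover from this have "(\<Sum>\<alpha>\<in>F. (?f ^^ k) (y \<alpha>)) \<in> gen_eigenspace D \<mu>"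
    using inv[OF insert.prems(3), of k] by simp
  hence "(\<Sum>\<alpha>\<in>F. (?f ^^ k) (y \<alpha>)) = 0"
    using insert.prems inv by (intro insert.IH[of \<mu>]) auto
  ultimately have "(\<Sum>\<nu>\<in>insert \<nu> F. y \<nu>) \<in> gen_eigenspace D \<nu>"
    by (auto simp: gen_eigenspace_def)
  thus ?case
    using gen_eigenspace_disjoint[OF D, of \<nu> \<mu>] insert.prems by blast
qed

lemma shift_surj_on_gen_eigenspace:
  assumes D: "lin D" and W: "subspace W" "\<And>v. v \<in> W \<Longrightarrow> D v \<in> W" and "\<nu> \<noteq> \<mu>"
    and b: "b \<in> W" "b \<in> gen_eigenspace D \<nu>"
  obtains w where "w \<in> W" "D w - scale \<mu> w = b"
proof -
  have "\<exists>w\<in>W. D w - scale \<mu> w = b" if "((\<lambda>v. D v - scale \<nu> v) ^^ k) b = 0" "b \<in> W" for k b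
    using that
  proof (induction k arbitrary: b)
    case 0
    then show ?case
      using W by (auto intro!: bexI[of _ 0] simp: lin_0[OF D])
  next
    case (Suc k)
    have "D b - scale \<nu> b \<in> W"
      using Suc W by (simp add: subspace_diff subspace_scale)
    then obtain w where w: "w \<in> W" "D w - scale \<mu> w = D b - scale \<nu> b"
      using Suc.IH[of "D b - scale \<nu> b"] Suc.prems(1) unfolding funpow_shift_zero by blast
    \<comment> \<open>From (D - \<mu>) b = (\<nu> - \<mu>) b + (D - \<nu>) b and (D - \<mu>) w = (D
      - \<nu>) b it follows that (b - w) / (\<nu> - \<mu>) is a preimage of b.\<close>
    define c where "c = 1 / (\<nu> - \<mu>)"
    have c: "c * \<nu> - c * \<mu> = 1"
      using assms(4) by (simp add: c_def divide_simps)
    have "D (scale c (b - w)) - scale \<mu> (scale c (b - w)) = scale c (D b - scale \<mu> b - (D w - scale \<mu> w))"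
      by (simp add: lin_scale[OF D] lin_diff[OF D] algebra_simps)
    also have "\<dots> = scale (c * \<nu> - c * \<mu>) b"
      unfolding w by (simp add: algebra_simps)
    finally have "D (scale c (b - w)) - scale \<mu> (scale c (b - w)) = b"
      using c by simp
    thus ?case
      using w Suc.prems W by (intro bexI[of _ "scale c (b - w)"]) (simp_all add: subspace_diff subspace_scale)
  qed
  thus ?thesis
    using b that by (auto simp: gen_eigenspace_def)
qed

text \<open>A weak substitute for a Jordan basis: generalised eigenvectors whose eigenvalues
  \<open>a b\<close> are the diagonal entries of the matrix of \<open>D\<close>. This is all that
  trace computations ask for.\<close>

definition adapted :: "('b \<Rightarrow> 'b) \<Rightarrow> ('b \<Rightarrow> complex) \<Rightarrow> 'b set \<Rightarrow> bool" where
  "adapted D a B \<longleftrightarrow> independent B \<and>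
     (\<forall>b\<in>B. b \<in> gen_eigenspace D (a b) \<and> D b - scale (a b) b \<in> span (B - {b}))"

lemma adapted_invariant:
  assumes "adapted D a B" "lin D" "v \<in> span B"
  shows "D v \<in> span B"
proof (rule lin_span[OF assms(2) _ _ assms(3)])
  fix b assume "b \<in> B"
  hence "D b - scale (a b) b \<in> span B" "scale (a b) b \<in> span B"
    using assms(1) span_mono[of "B - {b}" B] by (auto simp: adapted_def intro: span_scale span_base)
  thus "D b \<in> span B"
    by (metis diff_add_cancel span_add)
qed auto

lemma adapted_representation:
  assumes "adapted D a B" "span B = UNIV" "b \<in> B"
  shows "representation B (D b) b = a b"
proof -
  have B: "independent B" and *: "D b - scale (a b) b \<in> span (B - {b})"
    using assms by (auto simp: adapted_def)
  have "representation B (D b - scale (a b) b) b = 0"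
    by (rule representation_span_subset[OF B _ *]) (use assms in auto)
  thus ?thesis
    using assms B by (simp add: representation_diff representation_scale representation_basis)
qed

text \<open>Subtracting from \<open>x\<close> its \<open>\<mu>\<close>-part leaves a sum of
  generalised eigenvectors for other values which is still in the space of \<open>\<mu>\<close>,
  hence zero.\<close>

lemma adapted_gen_eigenspace:
  assumes D: "lin D" and B: "adapted D a B" "span B = UNIV" "finite B"
  shows "gen_eigenspace D \<mu> = span {b\<in>B. a b = \<mu>}"
proof
  show "span {b\<in>B. a b = \<mu>} \<subseteq> gen_eigenspace D \<mu>"
    using B by (intro span_minimal subspace_gen_eigenspace[OF D]) (auto simp: adapted_def)
next
  have ind: "independent B"
    using B by (auto simp: adapted_def)
  show "gen_eigenspace D \<mu> \<subseteq> span {b\<in>B. a b = \<mu>}"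
  proof
    fix x assume x: "x \<in> gen_eigenspace D \<mu>"
    define r where "r = representation B x"
    define y where "y = (\<Sum>b\<in>{b\<in>B. a b = \<mu>}. scale (r b) b)"
    define z where "z \<nu> = (\<Sum>b\<in>{b\<in>B. a b = \<nu>}. scale (r b) b)" for \<nu>
    have zs: "z \<nu> \<in> span {b\<in>B. a b = \<nu>}" for \<nu>
      unfolding z_def by (intro span_sum span_scale span_base)
    have zg: "z \<nu> \<in> gen_eigenspace D \<nu>" for \<nu>
      using zs[of \<nu>] span_minimal[OF _ subspace_gen_eigenspace[OF D, of \<nu>], of "{b\<in>B. a b = \<nu>}"] B
      by (auto simp: adapted_def)
    have "x = (\<Sum>b\<in>B. scale (r b) b)"
      using sum_representation_subset[of B B x] ind B by (auto simp: r_def)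
    also have "\<dots> = (\<Sum>\<nu>\<in>a ` B. z \<nu>)"
      unfolding z_def by (rule sum.image_gen[OF B(3)])
    finally have xz: "x = (\<Sum>\<nu>\<in>a ` B. z \<nu>)" .
    have "z \<mu> = 0" if "\<mu> \<notin> a ` B"
    proof -
      have "{b\<in>B. a b = \<mu>} = {}" using that by auto
      thus ?thesis unfolding z_def by (simp only: sum.empty)
    qed
    hence xz': "x = z \<mu> + (\<Sum>\<nu>\<in>a ` B - {\<mu>}. z \<nu>)"
      using xz B by (cases "\<mu> \<in> a ` B") (auto simp: sum.remove)
    have "(\<Sum>\<nu>\<in>a ` B - {\<mu>}. z \<nu>) = x - z \<mu>"
      using xz' by (metis add_diff_cancel_left')
    also have "\<dots> \<in> gen_eigenspace D \<mu>"
      by (intro subspace_diff subspace_gen_eigenspace D x zg)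
    finally have "(\<Sum>\<nu>\<in>a ` B - {\<mu>}. z \<nu>) = 0"
      by (intro gen_eigenspace_sum_disjoint[OF D, of _ \<mu>]) (use B zg in auto)
    thus "x \<in> span {b\<in>B. a b = \<mu>}"
      using xz' zs[of \<mu>] by simp
  qed
qed

section \<open>Construction of adapted bases\<close>

lemma gen_eigenspace_shiftD:
  assumes "D v - scale \<mu> v \<in> gen_eigenspace D \<mu>"
  shows "v \<in> gen_eigenspace D \<mu>"
  using assms funpow_shift_zero unfolding gen_eigenspace_def mem_Collect_eq by metis

text \<open>One iterate more than the dimension. A dependence of the set of iterates yields
  coefficients only if the iterates are distinct; two coinciding iterates give a relation
  directly.\<close>

lemma krylov_dependent:
  assumes "lin D"
  obtains c :: "nat \<Rightarrow> complex" and N i where "i \<le> N" "c i \<noteq> 0" "(\<Sum>i\<le>N. scale (c i) ((D ^^ i) w)) = 0"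
proof -
  let ?g = "\<lambda>i. (D ^^ i) w"
  define N where "N = dimension"
  show ?thesis
  proof (cases "inj_on ?g {..N}")
    case True
    hence "card (?g ` {..N}) > dimension"
      by (simp add: card_image N_def)
    hence "dependent (?g ` {..N})"
      using independent_card_le_dim[of _ UNIV] dim_UNIV dimension_def by (metis not_le subset_UNIV)
    then obtain u where u: "\<exists>v\<in>?g ` {..N}. u v \<noteq> 0" "(\<Sum>v\<in>?g ` {..N}. scale (u v) v) = 0"
      by (subst (asm) dependent_finite) auto
    have "(\<Sum>i\<le>N. scale (u (?g i)) (?g i)) = 0"
      using u(2) by (simp add: sum.reindex[OF True])
    thus ?thesis
      using u(1) that[of _ N "\<lambda>i. u (?g i)"] by auto
  next
    case False
    then obtain i j where ij: "i \<noteq> j" "j \<le> N" "i \<le> N" "?g i = ?g j"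
      by (auto simp: inj_on_def)
    have "(\<Sum>k\<le>N. scale ((if k = i then 1 else 0) - (if k = j then 1 else 0)) (?g k))
        = (\<Sum>k\<le>N. (if k = i then ?g k else 0) - (if k = j then ?g k else 0))"
      by (intro sum.cong refl) auto
    also have "\<dots> = 0"
      using ij by (simp add: sum_subtractf)
    finally show ?thesis
      using that[of i N "\<lambda>k. (if k = i then 1 else 0) - (if k = j then 1 else 0)"] ij by simp
  qed
qed

text \<open>Stands in for an eigenvector in the quotient by \<open>W\<close>. Split \<open>p\<close>
  as (X - \<mu>) q and put u = q(D) w: either \<open>u\<close> is outside \<open>W\<close> and is
  the vector sought, or \<open>q\<close> is a polynomial of smaller degree with the same
  property.\<close>

lemma eigenvector_modulo:
  fixes p :: "complex poly"
  assumes D: "lin D" and W: "subspace W" "w \<notin> W"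
    and p: "p \<noteq> 0" "(\<Sum>i\<le>degree p. scale (coeff p i) ((D ^^ i) w)) \<in> W"
  shows "\<exists>u \<mu>. u \<notin> W \<and> D u - scale \<mu> u \<in> W"
  using p
proof (induction "degree p" arbitrary: p)
  case 0
  hence "scale (coeff p 0) w \<in> W" "coeff p 0 \<noteq> 0"
    by (auto simp: leading_coeff_neq_0 dest: leading_coeff_neq_0)
  hence "scale (1 / coeff p 0) (scale (coeff p 0) w) \<in> W"
    using W subspace_scale by blast
  with \<open>coeff p 0 \<noteq> 0\<close> W show ?case
    by simp
next
  case (Suc m)
  have "\<not> constant (poly p)"
    using Suc by (simp add: constant_degree)
  then obtain \<mu> where "poly p \<mu> = 0"
    using fundamental_theorem_of_algebra by blast
  then obtain q where q: "p = [:- \<mu>, 1:] * q"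
    by (auto simp: poly_eq_0_iff_dvd)
  have "q \<noteq> 0"
    using q Suc by auto
  hence deg: "degree p = Suc (degree q)"
    unfolding q by (subst degree_mult_eq) auto
  define u where "u = (\<Sum>i\<le>degree q. scale (coeff q i) ((D ^^ i) w))"
  have cp: "coeff p i = coeff (pCons 0 q) i - \<mu> * coeff q i" for i
    unfolding q by simp
  have "(\<Sum>i\<le>degree p. scale (coeff p i) ((D ^^ i) w))
      = (\<Sum>i\<le>Suc (degree q). scale (coeff (pCons 0 q) i) ((D ^^ i) w)) - (\<Sum>i\<le>Suc (degree q). scale (\<mu> * coeff q i) ((D ^^ i) w))"
    unfolding deg cp by (simp only: scale_left_diff_distrib sum_subtractf)
  also have "(\<Sum>i\<le>Suc (degree q). scale (coeff (pCons 0 q) i) ((D ^^ i) w)) = D u"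
    unfolding u_def by (subst sum.atMost_Suc_shift) (simp add: lin_sum[OF D] lin_scale[OF D])
  also have "(\<Sum>i\<le>Suc (degree q). scale (\<mu> * coeff q i) ((D ^^ i) w)) = scale \<mu> u"
    unfolding u_def by (simp add: scale_sum_right coeff_eq_0)
  finally have *: "D u - scale \<mu> u \<in> W"
    using Suc.prems by simp
  show ?case
  proof (cases "u \<in> W")
    case True
    thus ?thesis
      using Suc.hyps(1)[of q] Suc.hyps(2) deg \<open>q \<noteq> 0\<close> by (simp add: u_def)
  next
    case False
    thus ?thesis using * by blast
  qed
qed

lemma exists_eigenvector_modulo:
  assumes D: "lin D" and W: "subspace W" "W \<noteq> UNIV"
  obtains u \<mu> where "u \<notin> W" "D u - scale \<mu> u \<in> W"
proof -
  obtain w where w: "w \<notin> W"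
    using W by blast
  obtain c N i where c: "i \<le> N" "c i \<noteq> 0" "(\<Sum>i\<le>N. scale (c i) ((D ^^ i) w)) = 0"
    using krylov_dependent[OF D] .
  define p where "p = (\<Sum>i\<le>N. monom (c i) i)"
  have cp: "coeff p j = (if j \<le> N then c j else 0)" for j
    unfolding p_def by (simp add: coeff_sum)
  have "p \<noteq> 0"
    using cp[of i] c by auto
  have "degree p \<le> N"
    by (rule degree_le) (simp add: cp)
  moreover have "c i = 0" if "degree p < i" "i \<le> N" for i
    using that cp[of i] coeff_eq_0[of p i] by simp
  ultimately have "(\<Sum>i\<le>degree p. scale (coeff p i) ((D ^^ i) w)) = (\<Sum>i\<le>N. scale (c i) ((D ^^ i) w))"
    by (intro sum.mono_neutral_cong_left) (auto simp: cp)
  hence "(\<Sum>i\<le>degree p. scale (coeff p i) ((D ^^ i) w)) \<in> W"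
    using c W subspace_0 by simp
  thus ?thesis
    using eigenvector_modulo[OF D W(1) w \<open>p \<noteq> 0\<close>] that by blast
qed

text \<open>An eigenvector \<open>u\<close> modulo \<open>span B\<close> satisfies D u - \<mu> u = f
  + g, with \<open>g\<close> the part for the value \<open>\<mu>\<close> and \<open>f\<close> the
  rest. On the generalised eigenvectors making up \<open>f\<close> the operator D - \<mu> is onto,
  so \<open>f\<close> is the image of some \<open>h\<close> in \<open>span B\<close>, and v = u - h
  is a generalised eigenvector that enlarges the basis. Starting from a prescribed \<open>B\<close>
  matters later, when a given eigenvector has to be a basis member.\<close>

lemma adapted_extend:
  assumes D: "lin D" and "adapted D a B"
  obtains a' B' where "B \<subseteq> B'" "\<And>b. b \<in> B \<Longrightarrow> a' b = a b" "adapted D a' B'" "span B' = UNIV"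
proof -
  have "\<exists>a' B'. B \<subseteq> B' \<and> (\<forall>b\<in>B. a' b = a b) \<and> adapted D a' B' \<and> span B' = UNIV"
    using assms(2)
  proof (induction "dimension - card B" arbitrary: a B rule: less_induct)
    case (less B a)
    show ?case
    proof (cases "span B = UNIV")
      case True
      thus ?thesis using less.prems by blast
    next
      case False
      let ?W = "span B"
      have ind: "independent B"
        using less.prems by (simp add: adapted_def)
      hence fin: "finite B"
        by (rule finiteI_independent)
      obtain u \<mu> where u: "u \<notin> ?W" "D u - scale \<mu> u \<in> ?W"
        using exists_eigenvector_modulo[OF D _ False] by auto
      define r where "r = representation B (D u - scale \<mu> u)"
      let ?S = "{b\<in>B. a b \<noteq> \<mu>}" and ?S' = "{b\<in>B. a b = \<mu>}"
      define f where "f = (\<Sum>b\<in>?S. scale (r b) b)"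
      define g where "g = (\<Sum>b\<in>?S'. scale (r b) b)"
      have "D u - scale \<mu> u = (\<Sum>b\<in>B. scale (r b) b)"
        using sum_representation_subset[of B B] ind fin u by (auto simp: r_def)
      also have "\<dots> = f + g"
        unfolding f_def g_def using fin
        by (subst sum.union_disjoint[symmetric]) (auto intro!: sum.cong)
      finally have ufg: "D u - scale \<mu> u = f + g" .
      have "\<exists>w. w \<in> ?W \<and> D w - scale \<mu> w = b" if "b \<in> ?S" for b
      proof -
        have "a b \<noteq> \<mu>" "b \<in> ?W" "b \<in> gen_eigenspace D (a b)"
          using that less.prems span_base by (auto simp: adapted_def)
        then obtain w where "w \<in> ?W" "D w - scale \<mu> w = b"
          by (rule shift_surj_on_gen_eigenspace[OF D subspace_span adapted_invariant[OF less.prems D], rotated])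
        thus ?thesis by blast
      qed
      then obtain w where w': "\<forall>b\<in>?S. w b \<in> ?W \<and> D (w b) - scale \<mu> (w b) = b"
        using bchoice[of ?S "\<lambda>b w. w \<in> ?W \<and> D w - scale \<mu> w = b"] by blast
      hence w: "w b \<in> ?W" "D (w b) - scale \<mu> (w b) = b" if "b \<in> ?S" for b
        using that by simp_all
      define h where "h = (\<Sum>b\<in>?S. scale (r b) (w b))"
      have h: "h \<in> ?W"
        unfolding h_def using w by (intro span_sum span_scale) auto
      have "D h - scale \<mu> h = (\<Sum>b\<in>?S. scale (r b) (D (w b) - scale \<mu> (w b)))"
        unfolding h_def lin_sum[OF D] lin_scale[OF D] scale_sum_right
        by (simp add: sum_subtractf scale_right_diff_distrib mult.commute)
      also have "\<dots> = f"
        unfolding f_def by (intro sum.cong refl) (simp add: w)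
      finally have hf: "D h - scale \<mu> h = f" .
      define v where "v = u - h"
      have v: "v \<notin> ?W"
        using u h span_add[of v B h] by (auto simp: v_def)
      have "D v - scale \<mu> v = (D u - scale \<mu> u) - (D h - scale \<mu> h)"
        by (simp add: v_def lin_diff[OF D] scale_right_diff_distrib)
      hence vg: "D v - scale \<mu> v = g"
        using ufg hf by simp
      have "?S' \<subseteq> gen_eigenspace D \<mu>"
        using less.prems by (auto simp: adapted_def)
      hence "g \<in> gen_eigenspace D \<mu>"
        unfolding g_def using subspace_gen_eigenspace[OF D]
        by (intro subspace_sum subspace_scale) auto
      hence v_eig: "v \<in> gen_eigenspace D \<mu>"
        using vg by (metis gen_eigenspace_shiftD)
      have gW: "g \<in> ?W"
        unfolding g_def by (intro span_sum span_scale span_base) auto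
      have vB: "v \<notin> B"
        using v span_base by blast
      have ad: "adapted D (a(v := \<mu>)) (insert v B)"
        unfolding adapted_def
      proof (intro conjI ballI)
        show "independent (insert v B)"
          using v ind by (simp add: independent_insert)
      next
        fix b assume "b \<in> insert v B"
        thus "b \<in> gen_eigenspace D ((a(v := \<mu>)) b)"
          using v_eig less.prems by (auto simp: adapted_def)
      next
        fix b assume b: "b \<in> insert v B"
        show "D b - scale ((a(v := \<mu>)) b) b \<in> span (insert v B - {b})"
        proof (cases "b = v")
          case True
          thus ?thesis using vg gW vB by simp
        next
          case False
          hence "D b - scale (a b) b \<in> span (B - {b})"
            using b less.prems by (auto simp: adapted_def)
          moreover have "span (B - {b}) \<subseteq> span (insert v B - {b})"
            by (rule span_mono) auto
          ultimately show ?thesis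
            using False by auto
        qed
      qed
      have "card (insert v B) \<le> dimension"
        using ad independent_card_le_dim[of "insert v B" UNIV] dim_UNIV dimension_def
        by (auto simp: adapted_def)
      hence "dimension - card (insert v B) < dimension - card B"
        using fin vB by simp
      from less.hyps[OF this ad] obtain a' B' where
        "insert v B \<subseteq> B'" "\<forall>b\<in>insert v B. a' b = (a(v := \<mu>)) b" "adapted D a' B'" "span B' = UNIV"
        by blast
      thus ?thesis
        using vB by (intro exI[of _ a'] exI[of _ B']) auto
    qed
  qed
  thus ?thesis
    using that by blast
qed

lemma adapted_exists:
  assumes "lin D"
  obtains a B where "adapted D a B" "span B = UNIV"
  by (rule adapted_extend[OF assms, of "\<lambda>_. 0" "{}"]) (auto simp: adapted_def that independent_empty)

lemma adapted_finite: "adapted D a B \<Longrightarrow> finite B"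
  by (auto simp: adapted_def intro: finiteI_independent)

text \<open>In an adapted basis the diagonal entries of D E are the squared moduli of the
  eigenvalues of \<open>D\<close>, so a vanishing trace makes every eigenvalue zero. The last
  conclusion then says that \<open>D\<close> is nilpotent.\<close>

lemma conjugate_operator:
  assumes D: "lin D"
  obtains E where "lin E" "\<And>v \<mu>. v \<in> gen_eigenspace D \<mu> \<Longrightarrow> E v = scale (cnj \<mu>) v"
    "\<And>C. independent C \<Longrightarrow> span C = UNIV \<Longrightarrow> diag_sum C C (\<lambda>v. D (E v)) = 0 \<Longrightarrow> gen_eigenspace D 0 = UNIV"
proof -
  obtain a B where B: "adapted D a B" "span B = UNIV"
    using adapted_exists[OF D] .
  have ind: "independent B" and fin: "finite B"
    using B adapted_finite by (auto simp: adapted_def)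
  define E where "E v = (\<Sum>b\<in>B. scale (representation B v b * cnj (a b)) b)" for v
  have E: "lin E"
    unfolding E_def using ind B
    by (intro linI) (simp_all add: representation_add representation_scale algebra_simps sum.distrib scale_sum_right)
  have Eb: "E b = scale (cnj (a b)) b" if "b \<in> B" for b
  proof -
    have "E b = (\<Sum>c\<in>B. if c = b then scale (cnj (a b)) b else 0)"
      unfolding E_def by (intro sum.cong refl) (use ind that in \<open>auto simp: representation_basis\<close>)
    thus ?thesis
      using that fin by simp
  qed
  have "E v = scale (cnj \<mu>) v" if "v \<in> gen_eigenspace D \<mu>" for v \<mu>
  proof -
    have v: "v \<in> span {b\<in>B. a b = \<mu>}"
      using that adapted_gen_eigenspace[OF D B fin] by simp
    have "E v - scale (cnj \<mu>) v \<in> {0}"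
      by (rule lin_span[OF lin_shift[OF E, of "cnj \<mu>"] _ _ v]) (auto simp: Eb)
    thus ?thesis by simp
  qed
  moreover have "gen_eigenspace D 0 = UNIV"
    if C: "independent C" "span C = UNIV" and 0: "diag_sum C C (\<lambda>v. D (E v)) = 0" for C
  proof -
    have DE: "lin (\<lambda>v. D (E v))"
      using D E by (intro linI) (simp_all add: lin_add lin_scale)
    have "diag_sum C C (\<lambda>v. D (E v)) = diag_sum B B (\<lambda>v. D (E v))"
      using C B ind fin DE by (intro diag_sum_basis_change) (auto intro: finiteI_independent)
    also have "\<dots> = (\<Sum>b\<in>B. cnj (a b) * a b)"
      unfolding diag_sum_def
    proof (intro sum.cong refl)
      fix b assume b: "b \<in> B"
      have "D (E b) = scale (cnj (a b)) (D b)"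
        using b by (simp add: Eb lin_scale[OF D])
      thus "representation B (D (E b)) b = cnj (a b) * a b"
        using B ind b by (simp add: representation_scale adapted_representation)
    qed
    also have "\<dots> = of_real (\<Sum>b\<in>B. (cmod (a b))\<^sup>2)"
      by (simp add: complex_norm_square mult.commute del: of_real_power)
    finally have "(\<Sum>b\<in>B. (cmod (a b))\<^sup>2) = 0"
      using 0 by (metis of_real_eq_0_iff)
    hence "\<forall>b\<in>B. a b = 0"
      using fin by (subst (asm) sum_nonneg_eq_0_iff) auto
    hence "{b\<in>B. a b = 0} = B"
      by auto
    thus ?thesis
      using adapted_gen_eigenspace[OF D B fin, of 0] B by simp
  qed
  ultimately show ?thesis
    using E that by blast
qed

end

section \<open>Complex Lie algebras and the Killing form\<close>

locale complex_lie = complex_findim scale Basis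
  for scale :: "complex \<Rightarrow> 'b::ab_group_add \<Rightarrow> 'b" and Basis :: "'b set" +
  fixes bk :: "'b \<Rightarrow> 'b \<Rightarrow> 'b"
  assumes lin_left: "lin (\<lambda>x. bk x y)"
    and lin_right: "lin (bk x)"
    and bk_self: "bk x x = 0"
    and bk_deriv: "bk x (bk y z) = bk (bk x y) z + bk y (bk x z)"
begin

lemmas bk_add_left = lin_add[OF lin_left] and bk_add_right = lin_add[OF lin_right]
  and bk_diff_left = lin_diff[OF lin_left] and bk_diff_right = lin_diff[OF lin_right]
  and bk_scale_left = lin_scale[OF lin_left] and bk_scale_right = lin_scale[OF lin_right]
  and bk_0_left = lin_0[OF lin_left] and bk_0_right = lin_0[OF lin_right]

lemma bk_anti: "bk x y = - bk y x"
proof -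
  have "bk (x + y) (x + y) = 0"
    by (rule bk_self)
  thus ?thesis
    unfolding bk_add_left bk_add_right by (simp add: bk_self add_eq_0_iff)
qed

lemma bk_bk: "bk (bk x y) v = bk x (bk y v) - bk y (bk x v)"
  using bk_deriv[of x y v] by simp

lemma basis: "independent Basis" "span Basis = UNIV"
  using independent_Basis span_Basis by auto

lemma lin_bk_bk: "lin (\<lambda>v. bk x (bk y v))"
  by (intro linI) (simp_all add: bk_add_right bk_scale_right)

lemma diag_sum_commute_Basis:
  assumes "lin A" "lin C"
  shows "diag_sum Basis Basis (\<lambda>v. A (C v)) = diag_sum Basis Basis (\<lambda>v. C (A v))"
  by (rule diag_sum_commute) (use assms basis finite_Basis in auto)

section \<open>The Killing form and its radical\<close>

definition killing :: "'b \<Rightarrow> 'b \<Rightarrow> complex" where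
  "killing x y = diag_sum Basis Basis (\<lambda>v. bk x (bk y v))"

lemma killing_sym: "killing x y = killing y x"
  unfolding killing_def by (rule diag_sum_commute_Basis[OF lin_right lin_right])

lemma killing_add_left: "killing (x + y) z = killing x z + killing y z"
  unfolding killing_def bk_add_left by (rule diag_sum_add[OF basis])

lemma killing_scale_left: "killing (scale c x) z = c * killing x z"
  unfolding killing_def by (simp add: bk_scale_left diag_sum_scale[OF basis])

lemma killing_add_right: "killing z (x + y) = killing z x + killing z y"
  by (simp only: killing_sym[of z] killing_add_left)

lemma killing_scale_right: "killing z (scale c x) = c * killing z x"
  by (simp only: killing_sym[of z] killing_scale_left)

lemma killing_diff_right: "killing z (x - y) = killing z x - killing z y"
  using killing_add_right[of z "x - y" y] by simp

lemma killing_invariant: "killing (bk x y) z = killing x (bk y z)"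
proof -
  have "killing (bk x y) z = diag_sum Basis Basis (\<lambda>v. bk x (bk y (bk z v))) - diag_sum Basis Basis (\<lambda>v. bk y (bk x (bk z v)))"
    unfolding killing_def bk_bk by (rule diag_sum_diff[OF basis])
  also have "diag_sum Basis Basis (\<lambda>v. bk y (bk x (bk z v))) = diag_sum Basis Basis (\<lambda>v. bk x (bk z (bk y v)))"
    by (rule diag_sum_commute_Basis[OF lin_right lin_bk_bk])
  also have "diag_sum Basis Basis (\<lambda>v. bk x (bk y (bk z v))) - \<dots> = killing x (bk y z)"
    unfolding killing_def bk_bk by (simp add: bk_diff_right diag_sum_diff[OF basis])
  finally show ?thesis .
qed

text \<open>Leibniz rule: applying ad h - (\<nu> + \<mu>) to [u, v] gives [(ad h - \<nu>) u, v] +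
  [u, (ad h - \<mu>) v], and each term has a smaller sum of exponents.\<close>

lemma bk_gen_eigenspace:
  assumes "u \<in> gen_eigenspace (bk h) \<nu>" "v \<in> gen_eigenspace (bk h) \<mu>"
  shows "bk u v \<in> gen_eigenspace (bk h) (\<nu> + \<mu>)"
proof -
  have "bk u v \<in> gen_eigenspace (bk h) (\<nu> + \<mu>)"
    if "((\<lambda>v. bk h v - scale \<nu> v) ^^ k) u = 0" "((\<lambda>v. bk h v - scale \<mu> v) ^^ l) v = 0" for k l u v
    using that
  proof (induction "k + l" arbitrary: k l u v rule: less_induct)
    case less
    have zero: "0 \<in> gen_eigenspace (bk h) (\<nu> + \<mu>)"
      using subspace_gen_eigenspace[OF lin_right] subspace_0 by blast
    show ?case
    proof (cases k; cases l)
      fix k' l' assume kl: "k = Suc k'" "l = Suc l'"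
      have 1: "((\<lambda>v. bk h v - scale \<nu> v) ^^ k') (bk h u - scale \<nu> u) = 0"
        using less.prems(1) unfolding kl funpow_shift_zero .
      have 2: "((\<lambda>v. bk h v - scale \<mu> v) ^^ l') (bk h v - scale \<mu> v) = 0"
        using less.prems(2) unfolding kl funpow_shift_zero .
      have "bk (bk h u - scale \<nu> u) v \<in> gen_eigenspace (bk h) (\<nu> + \<mu>)"
        using less.hyps[OF _ 1 less.prems(2)] kl by simp
      moreover have "bk u (bk h v - scale \<mu> v) \<in> gen_eigenspace (bk h) (\<nu> + \<mu>)"
        using less.hyps[OF _ less.prems(1) 2] kl by simp
      ultimately have "bk (bk h u - scale \<nu> u) v + bk u (bk h v - scale \<mu> v) \<in> gen_eigenspace (bk h) (\<nu> + \<mu>)"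
        using subspace_gen_eigenspace[OF lin_right] subspace_add by blast
      also have "bk (bk h u - scale \<nu> u) v + bk u (bk h v - scale \<mu> v) = bk h (bk u v) - scale (\<nu> + \<mu>) (bk u v)"
        by (simp add: bk_diff_left bk_diff_right bk_scale_left bk_scale_right bk_deriv[of h u v] scale_left_distrib)
      finally show ?thesis
        by (rule gen_eigenspace_shiftD)
    qed (use less zero in \<open>auto simp: bk_0_left bk_0_right\<close>)
  qed
  thus ?thesis
    using assms unfolding gen_eigenspace_def by blast
qed

text \<open>The key step of Cartan's criterion: the operator acting as the conjugate eigenvalue on each
  generalised eigenspace of \<open>ad x\<close> is a derivation, and its trace against \<open>ad x\<close> is the sum of the
  squared moduli of the eigenvalues of \<open>ad x\<close>.\<close>

lemma nilpotent_of_killing_radical: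
  assumes R: "\<And>y z. y \<in> R \<Longrightarrow> killing y z = 0"
    and x: "x \<in> span {bk y z |y z. y \<in> R \<and> z \<in> R}"
  shows "gen_eigenspace (bk x) 0 = UNIV"
proof -
  obtain E where E: "lin E" "\<And>v \<mu>. v \<in> gen_eigenspace (bk x) \<mu> \<Longrightarrow> E v = scale (cnj \<mu>) v"
    "\<And>C. independent C \<Longrightarrow> span C = UNIV \<Longrightarrow> diag_sum C C (\<lambda>v. bk x (E v)) = 0 \<Longrightarrow> gen_eigenspace (bk x) 0 = UNIV"
    using conjugate_operator[OF lin_right[of x]] by metis
  obtain a B where B: "adapted (bk x) a B" "span B = UNIV"
    using adapted_exists[OF lin_right] .
  have Bg: "b \<in> gen_eigenspace (bk x) (a b)" if "b \<in> B" for b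
    using B that by (auto simp: adapted_def)
  have 1: "E (bk u v) - bk (E u) v - bk u (E v) = 0" if u: "u \<in> B" and v: "v \<in> B" for u v
    using E(2)[OF bk_gen_eigenspace[OF Bg[OF u] Bg[OF v]]] E(2)[OF Bg[OF u]] E(2)[OF Bg[OF v]]
    by (simp add: bk_scale_left bk_scale_right scale_left_distrib)
  have l1: "lin (\<lambda>v. E (bk u v) - bk (E u) v - bk u (E v))" for u
    by (intro linI) (simp_all add: bk_add_right bk_scale_right lin_add[OF E(1)] lin_scale[OF E(1)] scale_right_diff_distrib algebra_simps)
  have l2: "lin (\<lambda>u. E (bk u v) - bk (E u) v - bk u (E v))" for v
    by (intro linI) (simp_all add: bk_add_left bk_scale_left lin_add[OF E(1)] lin_scale[OF E(1)] scale_right_diff_distrib algebra_simps)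
  have 2: "E (bk u v) - bk (E u) v - bk u (E v) \<in> {0}" if u: "u \<in> B" for u v
    by (rule lin_span[OF l1, of B]) (use 1 u B in auto)
  have "E (bk u v) - bk (E u) v - bk u (E v) \<in> {0}" for u v
    by (rule lin_span[OF l2, of B]) (use 2 B in auto)
  hence "E (bk u v) - (bk (E u) v + bk u (E v)) = 0" for u v
    by (metis diff_diff_eq singletonD)
  hence "E (bk u v) = bk (E u) v + bk u (E v)" for u v
    by (rule eq_iff_diff_eq_0[THEN iffD2])
  hence 3: "bk z (E v) - E (bk z v) = - bk (E z) v" for z v
    by simp
  have lE: "lin (\<lambda>v. bk u (E v))" for u
    by (intro linI) (simp_all add: bk_add_right bk_scale_right lin_add[OF E(1)] lin_scale[OF E(1)])
  \<comment> \<open>\<phi>(w) is the trace of ad w composed with \<open>E\<close>. On a bracket it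
    is tr(ad y [ad z, E]), and [ad z, E] = - ad (E z) because \<open>E\<close> is a derivation; so
    it equals -K(y, E z), which vanishes for y in R.\<close>
  define \<phi> where "\<phi> w = diag_sum Basis Basis (\<lambda>v. bk w (E v))" for w
  have \<phi>_add: "\<phi> (u + w) = \<phi> u + \<phi> w" for u w
    unfolding \<phi>_def by (simp add: bk_add_left diag_sum_add[OF basis])
  have \<phi>_scale: "\<phi> (scale c u) = c * \<phi> u" for c u
    unfolding \<phi>_def by (simp add: bk_scale_left diag_sum_scale[OF basis])
  have \<phi>_bk: "\<phi> (bk y z) = 0" if "y \<in> R" for y z
  proof -
    have "\<phi> (bk y z) = diag_sum Basis Basis (\<lambda>v. bk y (bk z (E v))) - diag_sum Basis Basis (\<lambda>v. bk z (bk y (E v)))"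
      unfolding \<phi>_def bk_bk by (rule diag_sum_diff[OF basis])
    also have "diag_sum Basis Basis (\<lambda>v. bk z (bk y (E v))) = diag_sum Basis Basis (\<lambda>v. bk y (E (bk z v)))"
      by (rule diag_sum_commute_Basis[OF lin_right lE])
    also have "diag_sum Basis Basis (\<lambda>v. bk y (bk z (E v))) - \<dots> = diag_sum Basis Basis (\<lambda>v. bk y (bk z (E v) - E (bk z v)))"
      by (simp add: bk_diff_right diag_sum_diff[OF basis])
    also have "\<dots> = diag_sum Basis Basis (\<lambda>v. bk y (bk (scale (-1) (E z)) v))"
      unfolding 3 bk_scale_left by simp
    also have "\<dots> = killing y (scale (-1) (E z))"
      unfolding killing_def ..
    finally show ?thesis
      using R[OF that] by simp
  qed
  have "\<phi> x = 0"
    using x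
  proof (induction rule: span_induct_alt)
    case base
    show ?case using \<phi>_scale[of 0 0] by simp
  next
    case (step c x y)
    then show ?case using \<phi>_bk by (auto simp: \<phi>_add \<phi>_scale)
  qed
  thus ?thesis
    using E(3)[OF basis] by (simp add: \<phi>_def)
qed

end

section \<open>Complex Lie algebras of rank one\<close>

text \<open>The properties that the complexified \<open>H\<close> and \<open>c\<close> are shown to
  have. The assumption \<open>not_image\<close> records that brackets lie in the semisimple summand,
  which meets the central line only in zero.\<close>

locale rank_one_lie = complex_lie scale Basis bk
  for scale :: "complex \<Rightarrow> 'b::ab_group_add \<Rightarrow> 'b" and Basis :: "'b set" and bk +
  fixes h c :: 'b
  assumes central: "bk c x = 0"
    and radical: "(\<And>z. killing x z = 0) \<Longrightarrow> x \<in> span {c}"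
    and kernel: "bk h x = 0 \<Longrightarrow> x \<in> span {h, c}"
    and h_nonisotropic: "killing h h \<noteq> 0"
    and not_image: "bk h x = scale \<alpha> c \<Longrightarrow> bk h x = 0"
begin

abbreviation G :: "complex \<Rightarrow> 'b set" where
  "G \<equiv> gen_eigenspace (bk h)"

lemma killing_c: "killing c x = 0"
  by (simp add: killing_def central diag_sum_def representation_zero)

lemma span_hc: "x \<in> span {h, c} \<Longrightarrow> \<exists>t s. x = scale t h + scale s c"
proof -
  assume "x \<in> span {h, c}"
  then obtain t where "x - scale t h \<in> span {c}"
    using span_breakdown_eq by blast
  then obtain s where "x - scale t h = scale s c"
    by (auto simp: span_singleton)
  hence "x = scale t h + scale s c"
    by (metis add.commute diff_add_cancel)
  thus ?thesis by blast
qed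

text \<open>A bracket [h, x] that commutes with \<open>h\<close> is t h + s c. Invariance gives K(h,
  [h, x]) = 0, so t = 0 because K(h, h) \<noteq> 0, and \<open>not_image\<close> excludes the rest.
  Hence the eigenvalue 0 is semisimple.\<close>

lemma bk_h_twice: "bk h (bk h x) = 0 \<Longrightarrow> bk h x = 0"
proof -
  assume "bk h (bk h x) = 0"
  then obtain t s where ts: "bk h x = scale t h + scale s c"
    using kernel span_hc by blast
  have "killing h (bk h x) = killing (bk h h) x"
    by (simp add: killing_invariant)
  hence "killing h (bk h x) = 0"
    by (simp add: bk_self killing_def bk_0_left diag_sum_def representation_zero)
  hence "t * killing h h = 0"
    by (simp add: ts killing_add_right killing_scale_right killing_c killing_sym[of h c])
  hence "bk h x = scale s c"
    using ts h_nonisotropic by simp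
  thus ?thesis by (rule not_image)
qed

lemma G_0: "x \<in> G 0 \<Longrightarrow> x \<in> span {h, c}"
proof -
  assume "x \<in> G 0"
  then obtain k where "(bk h ^^ k) x = 0"
    by (auto simp: gen_eigenspace_def)
  hence "bk h x = 0"
  proof (induction k arbitrary: x)
    case 0
    then show ?case by (simp add: bk_0_right)
  next
    case (Suc k)
    hence "bk h (bk h x) = 0"
      by (intro Suc.IH) (simp add: funpow_swap1)
    then show ?case by (rule bk_h_twice)
  qed
  thus ?thesis by (rule kernel)
qed

section \<open>Weights of \<open>bk h\<close>\<close>

lemma eigenvectorI: "bk h x = scale \<nu> x \<Longrightarrow> x \<in> G \<nu>"
  unfolding gen_eigenspace_def by (auto intro!: exI[of _ 1])

lemma eigenvector_exists:
  assumes "v \<in> G \<nu>" "v \<noteq> 0"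
  obtains x where "x \<noteq> 0" "bk h x = scale \<nu> x"
proof -
  let ?f = "\<lambda>v. bk h v - scale \<nu> v"
  have "\<exists>x. x \<noteq> 0 \<and> ?f x = 0" if "(?f ^^ k) v = 0" "v \<noteq> 0" for k v
    using that
  proof (induction k arbitrary: v)
    case (Suc k)
    have "(?f ^^ k) (?f v) = 0"
      using Suc.prems(1) unfolding funpow_shift_zero .
    with Suc.IH[of "?f v"] Suc.prems(2) show ?case
      by blast
  qed simp
  thus ?thesis
    using assms that unfolding gen_eigenspace_def by force
qed

text \<open>\<open>x\<close> is outside the Killing radical, which consists of central vectors, so
  it pairs with some basis member. The form pairs the weight \<nu> only with -\<nu>: for any other
  weight, y = (ad h + \<nu>) w, and moving ad h to the other side cancels K(x, y).\<close>

lemma weight_pair: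
  assumes x: "x \<noteq> 0" "bk h x = scale \<nu> x" "\<nu> \<noteq> 0" and B: "adapted (bk h) a B" "span B = UNIV"
  obtains y where "y \<in> B" "a y = - \<nu>" "killing x y \<noteq> 0"
proof -
  have "\<exists>y\<in>B. killing x y \<noteq> 0"
  proof (rule ccontr)
    assume *: "\<not> ?thesis"
    have "killing x z = 0" for z
    proof -
      have "z \<in> span B" using B by simp
      thus ?thesis
      proof (induction rule: span_induct_alt)
        case base
        show ?case using killing_scale_right[of x 0 0] by simp
      next
        case (step c b y)
        thus ?case using * by (simp add: killing_add_right killing_scale_right)
      qed
    qed
    hence "x \<in> span {c}" by (rule radical)
    then obtain s where "x = scale s c"
      by (auto simp: span_singleton)
    hence "bk h x = 0"
      using central[of h] bk_anti[of h c] by (simp add: bk_scale_right)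
    thus False using x by simp
  qed
  then obtain y where y: "y \<in> B" "killing x y \<noteq> 0" by blast
  have "a y = - \<nu>"
  proof (rule ccontr)
    assume "a y \<noteq> - \<nu>"
    moreover have "y \<in> G (a y)" using B y by (auto simp: adapted_def)
    ultimately obtain w where w: "bk h w - scale (- \<nu>) w = y"
      using shift_surj_on_gen_eigenspace[OF lin_right subspace_UNIV] by (metis UNIV_I)
    have "killing x y = killing (bk x h) w + \<nu> * killing x w"
      unfolding w[symmetric] by (simp add: killing_diff_right killing_scale_right killing_add_right killing_invariant)
    also have "bk x h = scale (- \<nu>) x"
      using bk_anti[of x h] x by simp
    finally show False
      using y by (simp add: killing_scale_left del: scale_minus_left)
  qed
  thus ?thesis using y that by blast
qed

text \<open>The trace of \<open>ad [x, y]\<close> on a subspace invariant under \<open>ad x\<close> and \<open>ad y\<close> vanishes, while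
  \<open>ad [x, y]\<close> is a nonzero multiple of \<open>ad h\<close>.\<close>

lemma weight_sum_zero:
  assumes B: "adapted (bk h) a B" "span B = UNIV" and S: "S \<subseteq> B"
    and xy: "bk x y = scale t h + scale s c" "t \<noteq> 0"
    and inv: "\<And>b. b \<in> S \<Longrightarrow> bk x b \<in> span S" "\<And>b. b \<in> S \<Longrightarrow> bk y b \<in> span S"
  shows "(\<Sum>b\<in>S. a b) = 0"
proof -
  have ind: "independent B" and fin: "finite S"
    using B S finite_subset[OF S adapted_finite[OF B(1)]] by (auto simp: adapted_def)
  have "diag_sum B S (bk (bk x y)) = 0"
    unfolding bk_bk using diag_sum_commute[OF ind B(2) fin S lin_right inv(1) lin_right inv(2)]
    by (simp add: diag_sum_diff[OF ind B(2)])
  moreover have "bk (bk x y) v = scale t (bk h v)" for v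
    by (simp add: xy bk_add_left bk_scale_left central)
  hence "bk (bk x y) = (\<lambda>v. scale t (bk h v))"
    by auto
  ultimately have "t * diag_sum B S (bk h) = 0"
    using diag_sum_scale[OF ind B(2), of S t "bk h"] by simp
  moreover have "diag_sum B S (bk h) = (\<Sum>b\<in>S. a b)"
    unfolding diag_sum_def using S by (intro sum.cong refl adapted_representation[OF B]) auto
  ultimately show ?thesis
    using xy by simp
qed

text \<open>Take \<open>x\<close> together with all basis members of weight -k \<nu>, k \<ge> 0.
  Their span is invariant: ad y lowers the weight, ad x raises it, and from weight 0 it reaches only
  multiples of \<open>x\<close>, because that space is inside span {h, c}. The vanishing trace reads
  \<nu> - \<nu> (sum of the k) = 0, so exactly one member has k > 0 and its k is 1.\<close>

lemma opposite_weight: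
  assumes x: "x \<noteq> 0" "bk h x = scale \<nu> x" "\<nu> \<noteq> 0"
  obtains y t s where "y \<noteq> 0" "G (- \<nu>) = span {y}" "bk x y = scale t h + scale s c" "t \<noteq> 0"
    "\<And>k :: nat. k \<ge> 2 \<Longrightarrow> G (- (of_nat k * \<nu>)) = {0}"
proof -
  \<comment> \<open>\<open>x\<close> has to be a basis member itself: the trace below counts the
    weight \<nu> once, for \<open>x\<close> alone, whatever the size of its weight space.\<close>
  have "adapted (bk h) (\<lambda>_. \<nu>) {x}"
    using x by (auto simp: adapted_def eigenvectorI span_zero)
  then obtain a B where "{x} \<subseteq> B" "\<And>b. b \<in> {x} \<Longrightarrow> a b = \<nu>" and B: "adapted (bk h) a B" "span B = UNIV"
    using adapted_extend[OF lin_right] by metis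
  hence xB: "x \<in> B" "a x = \<nu>" by auto
  have ind: "independent B" and fin: "finite B"
    using B adapted_finite by (auto simp: adapted_def)
  note GB = adapted_gen_eigenspace[OF lin_right B fin]
  have Bg: "b \<in> G (a b)" if "b \<in> B" for b
    using B that by (auto simp: adapted_def)
  obtain y where y: "y \<in> B" "a y = - \<nu>" "killing x y \<noteq> 0"
    using weight_pair[OF x B] .
  have "bk x y \<in> G 0"
    using bk_gen_eigenspace[OF Bg[OF xB(1)] Bg[OF y(1)]] xB y by simp
  then obtain t s where ts: "bk x y = scale t h + scale s c"
    using G_0 span_hc by blast
  have "killing h (bk x y) = killing (bk h x) y"
    by (simp add: killing_invariant)
  hence "t * killing h h = \<nu> * killing x y"
    by (simp add: ts x killing_add_right killing_scale_right killing_scale_left killing_c killing_sym[of h c])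
  hence t: "t \<noteq> 0"
    using x y by auto
  define S' where "S' = {b\<in>B. \<exists>k::nat. a b = - (of_nat k * \<nu>)}"
  have in_S': "G (- (of_nat k * \<nu>)) \<subseteq> span (insert x S')" for k :: nat
    unfolding GB by (rule span_mono) (auto simp: S'_def)
  have "x \<notin> S'"
  proof
    assume "x \<in> S'"
    then obtain k :: nat where "\<nu> = - (of_nat k * \<nu>)"
      using xB by (auto simp: S'_def)
    hence "(1 + of_nat k) * \<nu> = 0" by (simp add: distrib_right eq_neg_iff_add_eq_0)
    hence "(of_nat (Suc k) :: complex) = 0" using x by simp
    thus False by (simp only: of_nat_eq_0_iff)
  qed
  have inv_x: "bk x b \<in> span (insert x S')" if "b \<in> insert x S'" for b
  proof (cases "b = x")
    case True
    thus ?thesis by (simp add: bk_self span_zero)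
  next
    case False
    with that obtain k where b: "b \<in> B" "a b = - (of_nat k * \<nu>)"
      by (auto simp: S'_def)
    have *: "bk x b \<in> G (\<nu> - of_nat k * \<nu>)"
      using bk_gen_eigenspace[OF Bg[OF xB(1)] Bg[OF b(1)]] xB b by simp
    show ?thesis
    proof (cases k)
      case 0
      hence "b \<in> span {h, c}"
        using Bg[OF b(1)] b G_0 by simp
      then obtain t s where "b = scale t h + scale s c"
        using span_hc by blast
      hence "bk x b = scale t (bk x h)"
        using central[of x] bk_anti[of x c] by (simp add: bk_add_right bk_scale_right)
      also have "bk x h = scale (- \<nu>) x"
        using bk_anti[of x h] x by simp
      finally show ?thesis
        by (metis insertI1 span_base span_scale)
    next
      case (Suc k')
      hence "\<nu> - of_nat k * \<nu> = - (of_nat k' * \<nu>)"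
        by (simp add: algebra_simps)
      thus ?thesis using * in_S'[of k'] by auto
    qed
  qed
  have inv_y: "bk y b \<in> span (insert x S')" if "b \<in> insert x S'" for b
  proof (cases "b = x")
    case True
    hence "bk y b \<in> G (- (of_nat 0 * \<nu>))"
      using bk_gen_eigenspace[OF Bg[OF y(1)] Bg[OF xB(1)]] xB y by simp
    thus ?thesis using in_S' by blast
  next
    case False
    with that obtain k where b: "b \<in> B" "a b = - (of_nat k * \<nu>)"
      by (auto simp: S'_def)
    have "- \<nu> + - (of_nat k * \<nu>) = - (of_nat (Suc k) * \<nu>)"
      by (simp add: algebra_simps)
    hence "bk y b \<in> G (- (of_nat (Suc k) * \<nu>))"
      using bk_gen_eigenspace[OF Bg[OF y(1)] Bg[OF b(1)]] y b by metis
    thus ?thesis using in_S' by blast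
  qed
  have finS': "finite S'"
    using fin by (simp add: S'_def)
  have "(\<Sum>b\<in>insert x S'. a b) = 0"
    by (rule weight_sum_zero[OF B _ ts t inv_x inv_y]) (use xB in \<open>auto simp: S'_def\<close>)
  hence sum: "\<nu> + (\<Sum>b\<in>S'. a b) = 0"
    using \<open>x \<notin> S'\<close> finS' xB by simp
  have "\<forall>b\<in>S'. \<exists>k::nat. a b = - (of_nat k * \<nu>)"
    by (auto simp: S'_def)
  then obtain \<kappa> :: "'b \<Rightarrow> nat" where \<kappa>: "\<And>b. b \<in> S' \<Longrightarrow> a b = - (of_nat (\<kappa> b) * \<nu>)"
    by metis
  have "(\<Sum>b\<in>S'. a b) = - (of_nat (\<Sum>b\<in>S'. \<kappa> b) * \<nu>)"
    by (simp add: \<kappa> sum_negf sum_distrib_right)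
  hence "(1 - of_nat (\<Sum>b\<in>S'. \<kappa> b)) * \<nu> = 0"
    using sum by (simp add: algebra_simps)
  hence "(of_nat (\<Sum>b\<in>S'. \<kappa> b) :: complex) = of_nat 1"
    using x by simp
  hence \<kappa>1: "(\<Sum>b\<in>S'. \<kappa> b) = 1"
    by (simp only: of_nat_eq_iff)
  have yS': "y \<in> S'"
    using y by (auto simp: S'_def intro!: exI[of _ "1::nat"])
  have "\<kappa> y = 1"
    using \<kappa>[OF yS'] y x by simp
  hence "(\<Sum>b\<in>S' - {y}. \<kappa> b) = 0"
    using \<kappa>1 yS' finS' by (simp add: sum.remove)
  hence \<kappa>0: "\<kappa> b = 0" if "b \<in> S'" "b \<noteq> y" for b
    using that finS' by simp
  have only: "b = y" if "b \<in> B" "a b = - (of_nat k * \<nu>)" "k \<ge> 1" for b and k :: nat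
  proof (rule ccontr)
    assume "b \<noteq> y"
    have "b \<in> S'" using that by (auto simp: S'_def)
    hence "a b = 0" using \<kappa> \<kappa>0 \<open>b \<noteq> y\<close> by simp
    thus False using that x by simp
  qed
  have "{b\<in>B. a b = - \<nu>} = {y}"
    using y only[where k = 1] by fastforce
  hence "G (- \<nu>) = span {y}"
    by (simp add: GB)
  moreover have "G (- (of_nat k * \<nu>)) = {0}" if "k \<ge> 2" for k :: nat
  proof -
    have "{b\<in>B. a b = - (of_nat k * \<nu>)} = {}"
    proof -
      have "a b \<noteq> - (of_nat k * \<nu>)" if "b \<in> B" for b
      proof
        assume *: "a b = - (of_nat k * \<nu>)"
        hence "b = y" using only[OF \<open>b \<in> B\<close> *] \<open>k \<ge> 2\<close> by simp
        hence "(of_nat k :: complex) = of_nat 1" using * y x by simp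
        thus False using \<open>k \<ge> 2\<close> by (simp only: of_nat_eq_iff)
      qed
      thus ?thesis by blast
    qed
    thus ?thesis
      unfolding GB by (simp only: span_empty)
  qed
  moreover have "y \<noteq> 0"
    using ind y dependent_zero by blast
  ultimately show ?thesis
    using that ts t by blast
qed

lemma weight_neg:
  assumes "v \<in> G \<nu>" "v \<noteq> 0" "\<nu> \<noteq> 0"
  obtains w where "w \<in> G (- \<nu>)" "w \<noteq> 0"
proof -
  obtain x where x: "x \<noteq> 0" "bk h x = scale \<nu> x"
    using eigenvector_exists assms(1,2) .
  obtain y where "y \<noteq> 0" "G (- \<nu>) = span {y}"
    using opposite_weight[OF x assms(3)] .
  thus ?thesis
    using that span_base by blast
qed

text \<open>\<open>opposite_weight\<close> for an eigenvector of weight -\<nu>, which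
  \<open>weight_neg\<close> provides; it speaks about the weight opposite to that one.\<close>

lemma weight_space:
  assumes "v \<in> G \<nu>" "v \<noteq> 0" "\<nu> \<noteq> 0"
  obtains z where "G \<nu> = span {z}" "\<And>k :: nat. k \<ge> 2 \<Longrightarrow> G (of_nat k * \<nu>) = {0}"
proof -
  obtain w where "w \<in> G (- \<nu>)" "w \<noteq> 0"
    using weight_neg assms .
  then obtain y where y: "y \<noteq> 0" "bk h y = scale (- \<nu>) y"
    by (rule eigenvector_exists)
  moreover have "- \<nu> \<noteq> 0"
    using assms(3) by simp
  ultimately obtain z where "G (- (- \<nu>)) = span {z}"
    "\<And>k :: nat. k \<ge> 2 \<Longrightarrow> G (- (of_nat k * - \<nu>)) = {0}"
    by (rule opposite_weight) blast
  thus ?thesis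
    using that by simp
qed

lemma integer_multiple_weight:
  assumes v: "v \<in> G \<nu>" "v \<noteq> 0" "\<nu> \<noteq> 0" and w: "w \<in> G (of_int k * \<nu>)" "w \<noteq> 0"
  shows "k \<in> {-1, 0, 1}"
proof (rule ccontr)
  assume k: "k \<notin> {-1, 0, 1}"
  show False
  proof (cases "k > 0")
    case True
    hence "nat k \<ge> 2" "of_nat (nat k) = (of_int k :: complex)"
      using k by auto
    thus False
      using weight_space[OF v] w by (metis singletonD)
  next
    case False
    hence k2: "nat (- k) \<ge> 2" "of_nat (nat (- k)) * (- \<nu>) = of_int k * \<nu>"
      using k by auto
    obtain u where u: "u \<in> G (- \<nu>)" "u \<noteq> 0"
      using weight_neg v .
    show False
      using weight_space[OF u] w k2 v by (metis neg_equal_0_iff_equal singletonD)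
  qed
qed

text \<open>Consider the weights in a b0 + \<int> \<nu>, divided by \<nu>; the trace on their span
  is zero. They share one imaginary part, which must then vanish; they are not integers, and
  maximality of \<nu> puts them in (-1, 1). A coset of \<int> has at most one positive and one
  negative member there, each simple. Sum zero makes them 1/2 and -1/2, and then \<nu> is twice a
  weight.\<close>

lemma weights:
  assumes B: "adapted (bk h) a B" "span B = UNIV"
    and x: "x \<noteq> 0" "bk h x = scale \<nu> x" "\<nu> \<noteq> 0"
    and max: "\<And>b. b \<in> B \<Longrightarrow> cmod (a b) \<le> cmod \<nu>"
    and b0: "b0 \<in> B"
  shows "a b0 \<in> {0, \<nu>, - \<nu>}"
proof (rule ccontr)
  assume no: "a b0 \<notin> {0, \<nu>, - \<nu>}"
  have ind: "independent B" and fin: "finite B"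
    using B adapted_finite by (auto simp: adapted_def)
  note GB = adapted_gen_eigenspace[OF lin_right B fin]
  have Bg: "b \<in> G (a b)" if "b \<in> B" for b
    using B that by (auto simp: adapted_def)
  have B0: "b \<noteq> 0" if "b \<in> B" for b
    using that ind dependent_zero by blast
  have xG: "x \<in> G \<nu>"
    using x eigenvectorI by blast
  obtain y t s where y: "G (- \<nu>) = span {y}" "bk x y = scale t h + scale s c" "t \<noteq> 0"
    using opposite_weight[OF x] .
  have yG: "y \<in> G (- \<nu>)"
    unfolding y by (simp add: span_base)
  define S where "S = {b\<in>B. \<exists>k::int. a b = a b0 + of_int k * \<nu>}"
  have b0S: "b0 \<in> S"
    using b0 by (auto simp: S_def intro!: exI[of _ 0])
  have finS: "finite S" using fin by (simp add: S_def)
  have in_S: "G (a b0 + of_int k * \<nu>) \<subseteq> span S" for k :: int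
    unfolding GB by (rule span_mono) (auto simp: S_def)
  have inv: "bk x b \<in> span S" "bk y b \<in> span S" if "b \<in> S" for b
  proof -
    obtain k where b: "b \<in> B" "a b = a b0 + of_int k * \<nu>"
      using \<open>b \<in> S\<close> by (auto simp: S_def)
    have "\<nu> + a b = a b0 + of_int (k + 1) * \<nu>" "- \<nu> + a b = a b0 + of_int (k - 1) * \<nu>"
      by (simp_all add: b algebra_simps)
    thus "bk x b \<in> span S" "bk y b \<in> span S"
      using bk_gen_eigenspace[OF xG Bg[OF b(1)]] bk_gen_eigenspace[OF yG Bg[OF b(1)]] in_S by (metis subsetD)+
  qed
  have sum: "(\<Sum>b\<in>S. a b) = 0"
    by (rule weight_sum_zero[OF B _ y(2,3) inv]) (auto simp: S_def)
  define r where "r b = a b / \<nu>" for b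
  have ar: "a b = r b * \<nu>" for b
    using x by (simp add: r_def)
  have rk: "\<exists>k::int. r b = r b0 + of_int k" if "b \<in> S" for b
    using that x by (auto simp: S_def r_def add_divide_distrib)
  have rsum: "(\<Sum>b\<in>S. r b) = 0"
    using sum by (simp add: r_def flip: sum_divide_distrib)
  have "Im (r b) = Im (r b0)" if "b \<in> S" for b
    using rk[OF that] by auto
  hence "of_nat (card S) * Im (r b0) = Im (\<Sum>b\<in>S. r b)"
    by simp
  hence "Im (r b0) = 0"
    using rsum b0S finS by auto
  hence real: "r b = of_real (Re (r b))" if "b \<in> S" for b
    using rk[OF that] by (auto simp: complex_eq_iff)
  \<comment> \<open>An integer ratio for \<open>b\<close> forces one for \<open>b0\<close>, which
    \<open>integer_multiple_weight\<close> restricts to -1, 0, 1: the cases excluded by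
    \<open>no\<close>.\<close>
  have nonint: "r b \<noteq> of_int k" if bS: "b \<in> S" for b k
  proof
    assume "r b = of_int k"
    moreover obtain l where "r b = r b0 + of_int l" using rk[OF bS] by blast
    ultimately have "r b0 = of_int (k - l)" by (simp add: algebra_simps)
    then obtain m :: int where r0: "r b0 = of_int m" by blast
    hence "b0 \<in> G (of_int m * \<nu>)"
      using Bg[OF b0] ar[of b0] by simp
    hence "m \<in> {-1, 0, 1}"
      using integer_multiple_weight[OF xG x(1,3)] B0[OF b0] by blast
    hence "r b0 \<in> {-1, 0, 1}"
      unfolding r0 by auto
    thus False
      using no ar[of b0] by auto
  qed
  have bound: "\<bar>Re (r b)\<bar> < 1" if "b \<in> S" for b
  proof -
    have "cmod (r b) \<le> 1"
      using max[of b] that x by (simp add: r_def norm_divide S_def)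
    hence "\<bar>Re (r b)\<bar> \<le> 1"
      using abs_Re_le_cmod order_trans by blast
    moreover have "\<bar>Re (r b)\<bar> \<noteq> 1"
      using nonint[OF that, of 1] nonint[OF that, of "-1"] real[OF that] by (auto simp: abs_if split: if_splits)
    ultimately show ?thesis by simp
  qed
  have nz: "Re (r b) \<noteq> 0" if "b \<in> S" for b
    using nonint[OF that, of 0] real[OF that] by auto
  have diff: "\<exists>k::int. Re (r b) - Re (r b') = of_int k" if b: "b \<in> S" "b' \<in> S" for b b'
  proof -
    obtain k l where "r b = r b0 + of_int k" "r b' = r b0 + of_int l"
      using rk[OF b(1)] rk[OF b(2)] by blast
    thus ?thesis by (auto intro!: exI[of _ "k - l"])
  qed
  \<comment> \<open>Ratios in the coset at distance below 1 are equal, and two different basis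
    members cannot share a one-dimensional weight space.\<close>
  have same: "b = b'" if b: "b \<in> S" "b' \<in> S" and lt: "\<bar>Re (r b) - Re (r b')\<bar> < 1" for b b'
  proof (rule ccontr)
    assume ne: "b \<noteq> b'"
    obtain k :: int where k: "Re (r b) - Re (r b') = of_int k"
      using diff[OF b] by blast
    moreover from this have "\<bar>k\<bar> < 1" using lt by linarith
    ultimately have "Re (r b) = Re (r b')" by simp
    hence "r b = r b'" using real[OF b(1)] real[OF b(2)] by simp
    hence eq: "a b = a b'" using ar by metis
    have bB: "b \<in> B" "b' \<in> B" using b by (auto simp: S_def)
    have "a b \<noteq> 0" using nz[OF b(1)] by (auto simp: r_def)
    then obtain z where z: "G (a b) = span {z}"
      by (rule weight_space[OF Bg[OF bB(1)] B0[OF bB(1)]]) (rule that)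
    obtain \<alpha> \<beta> where ab: "b = scale \<alpha> z" "b' = scale \<beta> z"
      using Bg[OF bB(1)] Bg[OF bB(2)] unfolding eq[symmetric] z span_singleton by blast
    hence "\<beta> \<noteq> 0" using B0[OF bB(2)] by auto
    hence "b = scale (\<alpha> / \<beta>) b'" using ab by simp
    hence "b \<in> span (B - {b})"
      using ne bB by (metis DiffI singletonD span_base span_scale)
    thus False using ind bB dependent_def by blast
  qed
  have "\<exists>b\<in>S. Re (r b) > 0"
  proof (rule ccontr)
    assume "\<not> ?thesis"
    hence neg: "Re (r b) < 0" if "b \<in> S" for b using nz that by force
    have "(\<Sum>b\<in>S. - Re (r b)) > 0"
      using finS b0S neg by (intro sum_pos) auto
    moreover have "(\<Sum>b\<in>S. Re (r b)) = 0"
      using rsum by (metis Re_sum zero_complex.sel(1))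
    ultimately show False by (simp add: sum_negf)
  qed
  then obtain p where p: "p \<in> S" "Re (r p) > 0" by blast
  have "\<exists>b\<in>S. Re (r b) < 0"
  proof (rule ccontr)
    assume "\<not> ?thesis"
    hence pos: "Re (r b) > 0" if "b \<in> S" for b using nz that by force
    have "(\<Sum>b\<in>S. Re (r b)) > 0"
      using finS b0S pos by (intro sum_pos) auto
    moreover have "(\<Sum>b\<in>S. Re (r b)) = 0"
      using rsum by (metis Re_sum zero_complex.sel(1))
    ultimately show False by simp
  qed
  then obtain q where q: "q \<in> S" "Re (r q) < 0" by blast
  have "b = p \<or> b = q" if b: "b \<in> S" for b
  proof (cases "Re (r b) > 0")
    case True
    thus ?thesis using same[OF b p(1)] bound[OF b] bound[OF p(1)] p by auto
  next
    case False
    thus ?thesis using same[OF b q(1)] bound[OF b] bound[OF q(1)] q by auto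
  qed
  hence "S = {p, q}" using p q by auto
  moreover have "p \<noteq> q" using p q by auto
  ultimately have pq: "r p + r q = 0" using rsum by simp
  hence "Re (r p) + Re (r q) = 0" by (simp add: complex_eq_iff)
  moreover obtain k :: int where "Re (r p) - Re (r q) = of_int k"
    using diff[OF p(1) q(1)] by blast
  moreover have "Re (r p) - Re (r q) < 2" "Re (r p) - Re (r q) > 0"
    using bound[OF p(1)] bound[OF q(1)] p q by auto
  ultimately have "k = 1" "Re (r p) + Re (r q) = 0" "Re (r p) - Re (r q) = 1"
    by auto
  hence "Re (r p) = 1 / 2" by simp
  hence "r p = 1 / 2" using real[OF p(1)] by (metis of_real_1 of_real_divide of_real_numeral)
  hence ap: "of_int 2 * a p = \<nu>" by (simp add: ar[of p] mult.commute)
  hence "a p \<noteq> 0" using x by auto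
  have pB: "p \<in> B" using p by (simp add: S_def)
  have "(2::int) \<in> {-1, 0, 1}"
    by (rule integer_multiple_weight[OF Bg[OF pB] B0[OF pB] \<open>a p \<noteq> 0\<close> _ x(1)]) (use xG ap in simp)
  thus False by simp
qed

text \<open>\<open>h\<close> and \<open>c\<close> span weight 0, and a weight of largest modulus and
  its opposite contribute one dimension each. Only this upper bound is proved here; the lower one
  comes from 2n \<ge> 4.\<close>

theorem dimension_le_4: "dimension \<le> 4"
proof -
  obtain a B where B: "adapted (bk h) a B" "span B = UNIV"
    using adapted_exists[OF lin_right] .
  have fin: "finite B"
    using B adapted_finite by auto
  have Bg: "b \<in> G (a b)" if "b \<in> B" for b
    using B that by (auto simp: adapted_def)
  have B0: "b \<noteq> 0" if "b \<in> B" for b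
    using that B dependent_zero unfolding adapted_def by blast
  have dim: "dimension \<le> 4" if "\<And>b. b \<in> B \<Longrightarrow> b \<in> span {h, c, u, v}" for u v
  proof -
    have "span B \<subseteq> span {h, c, u, v}"
      using that by (intro span_minimal) auto
    hence "dim UNIV \<le> card {h, c, u, v}"
      using B by (intro dim_le_card) auto
    also have "\<dots> \<le> 4"
      using card_insert_le_m1[of 4] by (auto simp: card_insert_if)
    finally show ?thesis
      by (simp add: dim_UNIV dimension_def)
  qed
  show ?thesis
  proof (cases "\<exists>b\<in>B. a b \<noteq> 0")
    case False
    have "b \<in> span {h, c, 0, 0}" if "b \<in> B" for b
      using G_0[of b] Bg[OF that] False that span_mono[of "{h, c}" "{h, c, 0, 0}"] by auto
    thus ?thesis by (rule dim)
  next
    case True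
    then obtain b1 where b1: "b1 \<in> B" "a b1 \<noteq> 0" by blast
    obtain b2 where b2: "b2 \<in> B" "\<And>b. b \<in> B \<Longrightarrow> cmod (a b) \<le> cmod (a b2)"
    proof -
      have "Max ((\<lambda>b. cmod (a b)) ` B) \<in> (\<lambda>b. cmod (a b)) ` B"
        using fin b1 by (intro Max_in) auto
      then obtain b2 where "b2 \<in> B" "cmod (a b2) = Max ((\<lambda>b. cmod (a b)) ` B)"
        by auto
      thus ?thesis using fin that by (metis (no_types, lifting) Max_ge finite_imageI imageI)
    qed
    define \<nu> where "\<nu> = a b2"
    have l0: "\<nu> \<noteq> 0"
      using b2(2)[OF b1(1)] b1 by (auto simp: \<nu>_def)
    have b2G: "b2 \<in> G \<nu>" using Bg b2 by (simp add: \<nu>_def)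
    obtain x where x: "x \<noteq> 0" "bk h x = scale \<nu> x"
      using eigenvector_exists[OF b2G B0[OF b2(1)]] .
    obtain y where y: "G (- \<nu>) = span {y}"
      using opposite_weight[OF x l0] .
    obtain z where z: "G \<nu> = span {z}"
      using weight_space[OF b2G B0[OF b2(1)] l0] .
    have "b \<in> span {h, c, y, z}" if b: "b \<in> B" for b
    proof -
      have "a b \<in> {0, \<nu>, - \<nu>}"
        by (rule weights[OF B x l0 _ b]) (use b2 in \<open>simp add: \<nu>_def\<close>)
      hence "b \<in> G 0 \<or> b \<in> span {z} \<or> b \<in> span {y}"
        using Bg[OF b] z y by auto
      moreover have "span {h, c} \<subseteq> span {h, c, y, z}" "span {z} \<subseteq> span {h, c, y, z}" "span {y} \<subseteq> span {h, c, y, z}"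
        by (intro span_mono; auto)+
      ultimately show ?thesis using G_0 by blast
    qed
    thus ?thesis by (rule dim)
  qed
qed

end

section \<open>Real Lie algebras and their complexification\<close>

context lie_algebra
begin

lemma br_linear: "linear (br x)" "linear (\<lambda>x. br x y)"
  using bilinear_br by (auto simp: bilinear_def)

lemmas br_add_right = linear_add[OF br_linear(1)] and br_add_left = linear_add[OF br_linear(2)]
  and br_diff_right = linear_diff[OF br_linear(1)] and br_diff_left = linear_diff[OF br_linear(2)]
  and br_scale_right = linear_scale[OF br_linear(1)] and br_scale_left = linear_scale[OF br_linear(2)]
  and br_0_right = linear_0[OF br_linear(1)] and br_0_left = linear_0[OF br_linear(2)]

lemma br_anti: "br x y = - br y x"
proof -
  have "br (x + y) (x + y) = 0"
    by (rule br_self)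
  thus ?thesis
    unfolding br_add_left br_add_right by (simp add: br_self add_eq_0_iff)
qed

lemma br_deriv: "br x (br y z) = br (br x y) z + br y (br x z)"
proof -
  have "br y (br z x) = - br y (br x z)"
    using br_anti[of z x] linear_neg[OF br_linear(1)] by simp
  moreover have "br z (br x y) = - br (br x y) z"
    by (rule br_anti)
  ultimately show ?thesis
    using jacobi[of x y z] by (simp add: algebra_simps)
qed

end

text \<open>The complexification: the pair (x, y) stands for x + i y, and \<open>cbr\<close> below
  is the complex bilinear extension of the bracket.\<close>

definition cscale :: "complex \<Rightarrow> 'a::real_vector \<times> 'a \<Rightarrow> 'a \<times> 'a" where
  "cscale z v = (Re z *\<^sub>R fst v - Im z *\<^sub>R snd v, Re z *\<^sub>R snd v + Im z *\<^sub>R fst v)"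

definition cbr :: "('a::real_vector \<Rightarrow> 'a \<Rightarrow> 'a) \<Rightarrow> 'a \<times> 'a \<Rightarrow> 'a \<times> 'a \<Rightarrow> 'a \<times> 'a" where
  "cbr br v w = (br (fst v) (fst w) - br (snd v) (snd w), br (fst v) (snd w) + br (snd v) (fst w))"

lemma vector_space_cscale: "vector_space (cscale :: complex \<Rightarrow> 'a::real_vector \<times> 'a \<Rightarrow> _)"
  by unfold_locales (simp_all add: cscale_def prod_eq_iff algebra_simps)

interpretation cv: vector_space cscale
  by (rule vector_space_cscale)

lemma cscale_real: "cscale z (x, 0) = (Re z *\<^sub>R x, Im z *\<^sub>R x)"
  by (simp add: cscale_def)

text \<open>A chosen finite basis turns the finite-dimensionality assumption into instances of the
  locale with a basis, over the reals for \<open>R\<close> and over the complex numbers for its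
  image \<open>CR\<close>.\<close>

locale based_lie_algebra = lie_algebra br for br :: "'a::real_vector \<Rightarrow> 'a \<Rightarrow> 'a" +
  fixes R :: "'a set"
  assumes finite_R: "finite R" and independent_R: "independent R" and span_R: "span R = UNIV"
begin

sublocale fd: finite_dimensional_vector_space scaleR R
  rewrites "module.span scaleR = span" and "module.subspace scaleR = subspace"
    and "module.dependent scaleR = dependent" and "vector_space.dim scaleR = dim"
proof -
  show "finite_dimensional_vector_space scaleR R"
    by unfold_locales (use finite_R independent_R span_R in
        \<open>auto simp: span_raw_def dependent_raw_def algebra_simps\<close>)
qed (simp_all add: span_raw_def subspace_raw_def dependent_raw_def dim_raw_def)

definition CR :: "('a \<times> 'a) set" where
  "CR = (\<lambda>b. (b, 0)) ` R"

lemma sum_cscale_real: "(\<Sum>b\<in>S. cscale (f b) (b, 0)) = (\<Sum>b\<in>S. Re (f b) *\<^sub>R b, \<Sum>b\<in>S. Im (f b) *\<^sub>R b)"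
  by (simp add: cscale_real prod_eq_iff fst_sum snd_sum)

lemma cspan_CR: "cv.span CR = UNIV"
proof -
  have 1: "(x, 0) \<in> cv.span CR" for x
  proof -
    have "x \<in> span R" by (simp add: span_R)
    thus ?thesis
    proof (induction rule: span_induct_alt)
      case base
      then show ?case using cv.span_zero by (simp add: zero_prod_def)
    next
      case (step c x y)
      hence "(x, 0) \<in> CR" by (simp add: CR_def)
      moreover have "(c *\<^sub>R x + y, 0) = cscale (of_real c) (x, 0) + (y, 0)"
        by (simp add: cscale_real)
      ultimately show ?case
        using step cv.span_add cv.span_scale cv.span_base by metis
    qed
  qed
  have "(x, y) = (x, 0) + cscale \<i> (y, 0)" for x y :: 'a
    by (simp add: cscale_real)
  hence "(x, y) \<in> cv.span CR" for x y
    using 1 cv.span_add cv.span_scale by metis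
  thus ?thesis by auto
qed

lemma cindependent_CR: "cv.independent CR"
proof (rule cv.independent_if_scalars_zero)
  show "finite CR"
    by (simp add: CR_def finite_R)
  fix f v assume f: "(\<Sum>v\<in>CR. cscale (f v) v) = 0" and v: "v \<in> CR"
  have "(\<Sum>v\<in>CR. cscale (f v) v) = (\<Sum>b\<in>R. cscale (f (b, 0)) (b, 0))"
    unfolding CR_def by (subst sum.reindex) (auto simp: inj_on_def)
  hence "(\<Sum>b\<in>R. Re (f (b, 0)) *\<^sub>R b) = 0" "(\<Sum>b\<in>R. Im (f (b, 0)) *\<^sub>R b) = 0"
    using f by (simp_all add: sum_cscale_real zero_prod_def)
  hence "Re (f (b, 0)) = 0" "Im (f (b, 0)) = 0" if "b \<in> R" for b
    using independentD[OF independent_R finite_R order_refl _ that, of "\<lambda>b. Re (f (b, 0))"]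
      independentD[OF independent_R finite_R order_refl _ that, of "\<lambda>b. Im (f (b, 0))"] by simp_all
  thus "f v = 0"
    using v by (auto simp: CR_def complex_eq_iff)
qed

sublocale cx: complex_lie cscale CR "cbr br"
proof -
  have lin: "Vector_Spaces.linear cscale cscale f"
    if "\<And>v w. f (v + w) = f v + f w" "\<And>z v. f (cscale z v) = cscale z (f v)" for f :: "'a \<times> 'a \<Rightarrow> 'a \<times> 'a"
    using that vector_space_cscale by (simp add: Vector_Spaces.linear_iff)
  show "complex_lie cscale CR (cbr br)"
  proof (intro complex_lie.intro complex_lie_axioms.intro complex_findim.intro)
    show "finite_dimensional_vector_space cscale CR"
      by unfold_locales (simp_all add: CR_def finite_R cindependent_CR[unfolded CR_def] cspan_CR[unfolded CR_def])
    show "Vector_Spaces.linear cscale cscale (\<lambda>x. cbr br x y)" for y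
      by (rule lin) (simp_all add: cbr_def cscale_def br_add_left br_scale_left br_diff_left algebra_simps prod_eq_iff)
    show "Vector_Spaces.linear cscale cscale (cbr br x)" for x
      by (rule lin) (simp_all add: cbr_def cscale_def br_add_right br_scale_right br_diff_right algebra_simps prod_eq_iff)
    show "cbr br x x = 0" for x
      using br_anti[of "fst x" "snd x"] by (simp add: cbr_def br_self zero_prod_def)
    show "cbr br x (cbr br y z) = cbr br (cbr br x y) z + cbr br y (cbr br x z)" for x y z
      by (simp add: cbr_def br_add_left br_diff_left br_add_right br_diff_right
          br_deriv[of "fst x" "fst y"] br_deriv[of "fst x" "snd y"] br_deriv[of "snd x" "fst y"] br_deriv[of "snd x" "snd y"]
          algebra_simps)
  qed
qed

lemma cbr_real: "cbr br (x, 0) (y, 0) = (br x y, 0)"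
  by (simp add: cbr_def br_0_left br_0_right)

lemma representation_CR:
  assumes "b \<in> R"
  shows "cv.representation CR (w, 0) (b, 0) = of_real (representation R w b)"
proof -
  define f where "f v = (if v \<in> CR then of_real (representation R w (fst v)) else 0 :: complex)" for v
  have fin: "finite CR" by (simp add: CR_def finite_R)
  have "cv.representation CR (w, 0) = f"
  proof (rule cv.representation_eqI[OF cindependent_CR])
    show "finite {v. f v \<noteq> 0}"
      by (rule finite_subset[OF _ fin]) (auto simp: f_def)
    have "(\<Sum>v | f v \<noteq> 0. cscale (f v) v) = (\<Sum>v\<in>CR. cscale (f v) v)"
      by (rule sum.mono_neutral_left[OF fin]) (auto simp: f_def)
    also have "\<dots> = (\<Sum>b\<in>R. cscale (of_real (representation R w b)) (b, 0))"
      unfolding CR_def by (subst sum.reindex) (auto simp: inj_on_def f_def CR_def)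
    also have "\<dots> = (w, 0)"
      unfolding sum_cscale_real
      using sum_representation_eq[of R w R] independent_R finite_R span_R by simp
    finally show "(\<Sum>v | f v \<noteq> 0. cscale (f v) v) = (w, 0)" .
  qed (auto simp: cspan_CR f_def split: if_splits)
  thus ?thesis
    using assms by (simp add: f_def CR_def)
qed

text \<open>The real Killing form of the whole algebra. Taking the real part loses nothing, by
  \<open>killing_real\<close>: real vectors have real coordinates in \<open>CR\<close>.\<close>

definition K :: "'a \<Rightarrow> 'a \<Rightarrow> real" where
  "K x y = Re (cx.killing (x, 0) (y, 0))"

lemma killing_real: "cx.killing (x, 0) (y, 0) = of_real (K x y)"
proof -
  have "cx.killing (x, 0) (y, 0) = (\<Sum>b\<in>R. cv.representation CR (cbr br (x, 0) (cbr br (y, 0) (b, 0))) (b, 0))"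
    unfolding cx.killing_def cx.diag_sum_def by (subst CR_def, subst sum.reindex) (auto simp: inj_on_def)
  also have "\<dots> = of_real (\<Sum>b\<in>R. representation R (br x (br y b)) b)"
    by (simp add: cbr_real representation_CR)
  finally show ?thesis
    by (simp add: K_def)
qed

lemma killing_complex: "cx.killing (x, y) (z, 0) = of_real (K x z) + \<i> * of_real (K y z)"
proof -
  have "(x, y) = (x, 0) + cscale \<i> (y, 0)"
    by (simp add: cscale_real)
  thus ?thesis
    by (simp only: cx.killing_add_left cx.killing_scale_left killing_real)
qed

lemma K_sym: "K x y = K y x"
  by (simp add: K_def cx.killing_sym)

lemma K_add_left: "K (x + y) z = K x z + K y z"
  using cx.killing_add_left[of "(x, 0)" "(y, 0)" "(z, 0)"] by (simp add: K_def)

lemma K_scale_left: "K (r *\<^sub>R x) z = r * K x z"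
  using cx.killing_scale_left[of "of_real r" "(x, 0)" "(z, 0)"] by (simp add: K_def cscale_real)

lemma K_linear_left: "linear (\<lambda>x. K x z)"
  by (rule linearI) (simp_all add: K_add_left K_scale_left)

lemma K_linear_right: "linear (K z)"
  using K_linear_left[of z] by (simp add: K_sym[of _ z])

lemma K_invariant: "K (br x y) z = K x (br y z)"
  using cx.killing_invariant[of "(x, 0)" "(y, 0)" "(z, 0)"] by (simp add: K_def cbr_real)

text \<open>A real vector that is \<open>K\<close>-orthogonal to all real vectors is orthogonal to
  the complexification too, so the eigenvalue argument made there applies and its conclusion is read
  on real vectors.\<close>

lemma funpow_br_nilpotent:
  assumes R': "\<And>y z. y \<in> R' \<Longrightarrow> K y z = 0" and x: "x \<in> span {br y z |y z. y \<in> R' \<and> z \<in> R'}"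
  shows "\<exists>k. (br x ^^ k) v = 0"
proof -
  let ?R = "(\<lambda>y. (y, 0 :: 'a)) ` R'"
  have 0: "cx.killing y z = 0" if "y \<in> ?R" for y z
  proof -
    obtain u where u: "y = (u, 0)" "u \<in> R'" using \<open>y \<in> ?R\<close> by auto
    have "cx.killing y z = cx.killing (fst z, snd z) (u, 0)"
      using u by (simp add: cx.killing_sym)
    also have "\<dots> = 0"
      unfolding killing_complex using R' u K_sym[of _ u] by simp
    finally show ?thesis .
  qed
  have "(x, 0) \<in> cv.span {cbr br y z |y z. y \<in> ?R \<and> z \<in> ?R}"
    using x
  proof (induction rule: span_induct_alt)
    case base
    then show ?case using cv.span_zero by (simp add: zero_prod_def)
  next
    case (step c x y)
    then obtain u w where uw: "x = br u w" "u \<in> R'" "w \<in> R'" by blast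
    have "(x, 0) = cbr br (u, 0) (w, 0)"
      by (simp add: uw cbr_real)
    hence "(x, 0) \<in> {cbr br y z |y z. y \<in> ?R \<and> z \<in> ?R}"
      using uw by blast
    hence "cscale (of_real c) (x, 0) + (y, 0) \<in> cv.span {cbr br y z |y z. y \<in> ?R \<and> z \<in> ?R}"
      using step by (intro cv.span_add cv.span_scale) (simp_all add: cv.span_base)
    thus ?case
      by (simp add: cscale_real)
  qed
  hence "cx.gen_eigenspace (cbr br (x, 0)) 0 = UNIV"
    by (rule cx.nilpotent_of_killing_radical[OF 0, rotated])
  hence "(v, 0) \<in> cx.gen_eigenspace (cbr br (x, 0)) 0"
    by simp
  then obtain k where "(cbr br (x, 0) ^^ k) (v, 0) = 0"
    by (auto simp: cx.gen_eigenspace_def)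
  moreover have "(cbr br (x, 0) ^^ k) (v, 0) = ((br x ^^ k) v, 0)"
    by (induction k) (simp_all add: cbr_real)
  ultimately show ?thesis
    by (auto simp: zero_prod_def)
qed

text \<open>Engel's theorem for the adjoint action, relative to a pair of invariant subspaces in place of
  a quotient representation.\<close>

lemma engel:
  assumes L: "subspace L" "\<And>x y. x \<in> L \<Longrightarrow> y \<in> L \<Longrightarrow> br x y \<in> L"
    and nil: "\<And>x v. x \<in> L \<Longrightarrow> \<exists>k. (br x ^^ k) v = 0"
    and V: "subspace V" "subspace V'" "V' \<subset> V"
      "\<And>x v. x \<in> L \<Longrightarrow> v \<in> V \<Longrightarrow> br x v \<in> V" "\<And>x v. x \<in> L \<Longrightarrow> v \<in> V' \<Longrightarrow> br x v \<in> V'"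
  shows "\<exists>v\<in>V - V'. \<forall>x\<in>L. br x v \<in> V'"
proof -
  define stable where "stable M V \<longleftrightarrow> subspace V \<and> (\<forall>x\<in>M. \<forall>v\<in>V. br x v \<in> V)" for M V
  \<comment> \<open>\<open>E M\<close> says that \<open>M\<close> is a subalgebra for which the
    theorem holds, for all pairs of invariant subspaces. A member of largest dimension is enlarged
    by one vector until it must be \<open>L\<close>.\<close>
  define E where "E M \<longleftrightarrow> stable M M \<and> M \<subseteq> L \<and>
    (\<forall>V V'. stable M V \<and> stable M V' \<and> V' \<subset> V \<longrightarrow> (\<exists>v\<in>V - V'. \<forall>x\<in>M. br x v \<in> V'))" for M
  have "E {0}"
    unfolding E_def stable_def using L subspace_0 by (auto simp: br_0_left)
  moreover have "\<forall>M. E M \<longrightarrow> dim M < Suc (card R)"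
    using fd.dim_subset_UNIV by (simp add: fd.dimension_def less_Suc_eq_le)
  ultimately obtain M where M: "E M" and max: "\<And>N. E N \<Longrightarrow> dim N \<le> dim M"
    using ex_has_greatest_nat[of E "{0}" dim] by blast
  have Msub: "subspace M" and MsL: "M \<subseteq> L"
    using M by (auto simp: E_def stable_def)
  have EM: "\<exists>v\<in>V - V'. \<forall>x\<in>M. br x v \<in> V'" if "stable M V" "stable M V'" "V' \<subset> V" for V V'
    using M that by (simp add: E_def)
  have stM: "stable M M"
    using M by (simp add: E_def)
  have "M = L"
  proof (rule ccontr)
    assume "M \<noteq> L"
    hence "M \<subset> L" using MsL by auto
    moreover have "stable M L"
      using L MsL by (auto simp: stable_def)
    \<comment> \<open>The property of \<open>M\<close> applied to the pair \<open>L\<close>,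
      \<open>M\<close> itself yields a vector outside \<open>M\<close> that normalises
      \<open>M\<close>.\<close>
    ultimately have "\<exists>v\<in>L - M. \<forall>x\<in>M. br x v \<in> M"
      using stM by (intro EM)
    then obtain x where x: "x \<in> L" "x \<notin> M" "\<And>m. m \<in> M \<Longrightarrow> br m x \<in> M"
      by blast
    have xm: "br x m \<in> M" if "m \<in> M" for m
      using x(3)[OF that] br_anti[of x m] Msub by (simp add: subspace_neg)
    define N where "N = span (insert x M)"
    have spanM: "span M = M" using Msub by simp
    have N: "\<exists>t. u - t *\<^sub>R x \<in> M" if "u \<in> N" for u
      using that unfolding N_def span_breakdown_eq spanM .
    have MN: "M \<subseteq> N" unfolding N_def using span_superset by blast
    have xN: "x \<in> N" unfolding N_def by (simp add: span_base)
    have subN: "subspace N" by (simp add: N_def)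
    have "br u w \<in> N" if u: "u \<in> N" and w: "w \<in> N" for u w
    proof -
      obtain s t where st: "u - s *\<^sub>R x \<in> M" "w - t *\<^sub>R x \<in> M" using N u w by blast
      define m m' where "m = u - s *\<^sub>R x" and "m' = w - t *\<^sub>R x"
      have "u = m + s *\<^sub>R x" "w = m' + t *\<^sub>R x" by (simp_all add: m_def m'_def)
      hence "br u w = br m m' + t *\<^sub>R br m x + s *\<^sub>R br x m'"
        by (simp add: br_add_left br_add_right br_scale_left br_scale_right br_self)
      moreover have "br m m' \<in> M" "br m x \<in> M" "br x m' \<in> M"
        using st stM x(3) xm unfolding m_def[symmetric] m'_def[symmetric] by (auto simp: stable_def)
      ultimately have "br u w \<in> M"
        using Msub by (simp add: subspace_add subspace_scale)
      thus ?thesis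
        using MN by blast
    qed
    moreover have "N \<subseteq> L"
      unfolding N_def using x MsL L by (intro span_minimal) auto
    moreover have "\<exists>v\<in>V - V'. \<forall>u\<in>N. br u v \<in> V'"
      if V: "stable N V" "stable N V'" "V' \<subset> V" for V V'
    proof -
      have "stable M V" "stable M V'"
        using V MN by (auto simp: stable_def)
      then obtain v0 where v0: "v0 \<in> V" "v0 \<notin> V'" "\<And>m. m \<in> M \<Longrightarrow> br m v0 \<in> V'"
        using EM[OF _ _ V(3)] by blast
      have sub: "subspace V" "subspace V'"
        using V by (auto simp: stable_def)
      obtain k where "(br x ^^ k) v0 = 0"
        using nil x by blast
      hence ex: "\<exists>k. (br x ^^ k) v0 \<in> V'"
        using sub subspace_0 by metis
      \<comment> \<open>The vectors annihilated by \<open>M\<close> modulo \<open>V'\<close> are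
        preserved by ad x. The last iterate (ad x)^(j-1) v0 still outside \<open>V'\<close> is
        therefore annihilated by \<open>x\<close> and by \<open>M\<close> modulo
        \<open>V'\<close>.\<close>
      define j where "j = (LEAST k. (br x ^^ k) v0 \<in> V')"
      have j: "(br x ^^ j) v0 \<in> V'"
        unfolding j_def using ex by (rule LeastI_ex)
      have "j \<noteq> 0" using j v0 by (cases j) auto
      then obtain i where i: "j = Suc i" by (cases j) auto
      have W: "(br x ^^ l) v0 \<in> V \<and> (\<forall>m\<in>M. br m ((br x ^^ l) v0) \<in> V')" for l
      proof (induction l)
        case 0
        then show ?case using v0 by simp
      next
        case (Suc l)
        have "br m (br x ((br x ^^ l) v0)) \<in> V'" if m: "m \<in> M" for m
        proof -
          have "br (br m x) ((br x ^^ l) v0) \<in> V'"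
            using Suc x m by blast
          moreover have "br x (br m ((br x ^^ l) v0)) \<in> V'"
            using Suc m V xN by (auto simp: stable_def)
          ultimately show ?thesis
            unfolding br_deriv[of m x] using sub subspace_add by blast
        qed
        then show ?case
          using Suc V xN by (auto simp: stable_def)
      qed
      define v where "v = (br x ^^ i) v0"
      have "v \<notin> V'"
        unfolding v_def using not_less_Least[of i "\<lambda>k. (br x ^^ k) v0 \<in> V'"] i j_def by auto
      moreover have "v \<in> V" "\<And>m. m \<in> M \<Longrightarrow> br m v \<in> V'"
        using W[of i] by (auto simp: v_def)
      moreover have "br x v \<in> V'"
        using j by (simp add: i v_def)
      moreover have "br u v \<in> V'" if "u \<in> N" for u
      proof -
        obtain s where s: "u - s *\<^sub>R x \<in> M" using N \<open>u \<in> N\<close> by blast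
        have "br u v = br (u - s *\<^sub>R x) v + s *\<^sub>R br x v"
          by (simp add: br_diff_left br_scale_left)
        thus ?thesis
          using calculation(3)[OF s] calculation(4) sub by (simp add: subspace_add subspace_scale)
      qed
      ultimately show ?thesis by blast
    qed
    ultimately have "E N"
      using subN by (auto simp: E_def stable_def)
    hence "dim N \<le> dim M" by (rule max)
    moreover have "x \<notin> span M"
      unfolding spanM by (rule x(2))
    hence "dim N = dim M + 1"
      unfolding N_def by (simp add: fd.dim_insert)
    ultimately show False by simp
  qed
  moreover have "stable L V" "stable L V'"
    using V by (auto simp: stable_def)
  ultimately show ?thesis
    using EM V(3) by blast
qed

end

section \<open>Reductive Lie algebras\<close>

locale reductive_lie_algebra = based_lie_algebra br R
  for br :: "'a::real_vector \<Rightarrow> 'a \<Rightarrow> 'a" and R +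
  fixes S A :: "'a set"
  assumes ideal_S: "lie_ideal br UNIV S" and ideal_A: "lie_ideal br UNIV A"
    and S_A: "S \<inter> A = {0}" and S_plus_A: "{s + a |s a. s \<in> S \<and> a \<in> A} = UNIV"
    and semisimple_S: "lie_semisimple br S" and abelian_A: "lie_abelian br A"
begin

lemma subspace_S: "subspace S" and subspace_A: "subspace A"
  using ideal_S ideal_A by (auto simp: lie_ideal_def)

lemma S_A_zero: "x \<in> S \<Longrightarrow> x \<in> A \<Longrightarrow> x = 0"
  using S_A by blast

lemma decompose:
  obtains s a where "x = s + a" "s \<in> S" "a \<in> A"
proof -
  have "x \<in> {s + a |s a. s \<in> S \<and> a \<in> A}"
    by (simp add: S_plus_A)
  thus ?thesis using that by blast
qed

lemma br_S_A: "s \<in> S \<Longrightarrow> a \<in> A \<Longrightarrow> br s a = 0"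
proof (rule S_A_zero)
  assume sa: "s \<in> S" "a \<in> A"
  show "br s a \<in> A"
    using sa ideal_A by (auto simp: lie_ideal_def)
  have "br a s \<in> S"
    using sa ideal_S by (auto simp: lie_ideal_def)
  thus "br s a \<in> S"
    using br_anti[of s a] subspace_S by (simp add: subspace_neg)
qed

lemma central_A: "a \<in> A \<Longrightarrow> br x a = 0" "a \<in> A \<Longrightarrow> br a x = 0"
proof -
  have *: "br x a = 0" if "a \<in> A" for x a
  proof -
    obtain s a' where "x = s + a'" "s \<in> S" "a' \<in> A"
      by (rule decompose)
    thus ?thesis
      using that abelian_A by (simp add: br_add_left br_S_A lie_abelian_def)
  qed
  thus "a \<in> A \<Longrightarrow> br x a = 0" .
  show "a \<in> A \<Longrightarrow> br a x = 0"
    using * br_anti[of a x] by simp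
qed

lemma br_in_S: "br x y \<in> S"
proof -
  obtain s a where y: "y = s + a" "s \<in> S" "a \<in> A"
    by (rule decompose)
  have "br x y = br x s"
    by (simp add: y br_add_right central_A)
  thus ?thesis
    using y ideal_S by (auto simp: lie_ideal_def)
qed

text \<open>The projection \<open>P\<close> of \<open>J\<close> to \<open>S\<close> is an abelian
  ideal of \<open>S\<close>, since the components in \<open>A\<close> do not affect brackets;
  semisimplicity makes it zero.\<close>

lemma abelian_ideal_subset_A:
  assumes J: "subspace J" "\<And>x y. y \<in> J \<Longrightarrow> br x y \<in> J" "\<And>x y. x \<in> J \<Longrightarrow> y \<in> J \<Longrightarrow> br x y = 0"
  shows "J \<subseteq> A"
proof -
  define P where "P = {s\<in>S. \<exists>a\<in>A. s + a \<in> J}"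
  have "subspace P"
    unfolding P_def
  proof (rule subspaceI)
    show "0 \<in> {s\<in>S. \<exists>a\<in>A. s + a \<in> J}"
      using subspace_0 J(1) subspace_S subspace_A by force
  next
    fix x y assume "x \<in> {s\<in>S. \<exists>a\<in>A. s + a \<in> J}" "y \<in> {s\<in>S. \<exists>a\<in>A. s + a \<in> J}"
    then obtain a b where ab: "x \<in> S" "y \<in> S" "a \<in> A" "b \<in> A" "x + a \<in> J" "y + b \<in> J" by blast
    hence "(x + a) + (y + b) \<in> J" "a + b \<in> A" "x + y \<in> S"
      using J(1) subspace_A subspace_S by (auto intro: subspace_add)
    thus "x + y \<in> {s\<in>S. \<exists>a\<in>A. s + a \<in> J}"
      by (auto intro!: bexI[of _ "a + b"] simp: algebra_simps)
  next
    fix c x assume "x \<in> {s\<in>S. \<exists>a\<in>A. s + a \<in> J}"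
    then obtain a where "x \<in> S" "a \<in> A" "x + a \<in> J" by blast
    hence "c *\<^sub>R (x + a) \<in> J" "c *\<^sub>R a \<in> A" "c *\<^sub>R x \<in> S"
      using J(1) subspace_A subspace_S by (auto intro: subspace_scale)
    thus "c *\<^sub>R x \<in> {s\<in>S. \<exists>a\<in>A. s + a \<in> J}"
      by (auto intro!: bexI[of _ "c *\<^sub>R a"] simp: algebra_simps)
  qed
  moreover have "br x y \<in> P" if xy: "x \<in> S" "y \<in> P" for x y
  proof -
    obtain a where "a \<in> A" "y + a \<in> J" using xy by (auto simp: P_def)
    hence "br x y \<in> J"
      using J(2)[of "y + a" x] by (simp add: br_add_right central_A)
    thus ?thesis
      using br_in_S subspace_A subspace_0 by (force simp: P_def)
  qed
  ultimately have "lie_ideal br S P"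
    by (auto simp: lie_ideal_def P_def)
  moreover have "br x y = 0" if "x \<in> P" "y \<in> P" for x y
  proof -
    obtain a b where ab: "a \<in> A" "x + a \<in> J" "b \<in> A" "y + b \<in> J"
      using \<open>x \<in> P\<close> \<open>y \<in> P\<close> by (auto simp: P_def)
    have "br (x + a) (y + b) = 0"
      using ab J(3) by blast
    thus ?thesis
      using ab by (simp add: br_add_left br_add_right central_A)
  qed
  hence "lie_derived br P \<subseteq> {0}"
    unfolding lie_derived_def by (intro span_minimal) auto
  hence "lie_derived br P = {0}"
    using span_0 by (auto simp: lie_derived_def)
  hence "lie_solvable br P"
    unfolding lie_solvable_def by (intro exI[of _ 1]) simp
  ultimately have P0: "P = {0}"
    using semisimple_S by (auto simp: lie_semisimple_def)
  show ?thesis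
  proof
    fix j assume j: "j \<in> J"
    obtain s a where sa: "j = s + a" "s \<in> S" "a \<in> A"
      by (rule decompose)
    hence "s \<in> P" using j by (auto simp: P_def)
    thus "j \<in> A" using P0 sa by simp
  qed
qed

lemma K_central:
  assumes "\<And>x. br a x = 0"
  shows "K a x = 0"
proof -
  have "cbr br (a, 0) v = 0" for v
    by (simp add: cbr_def assms br_0_left zero_prod_def)
  hence "cx.killing (a, 0) (x, 0) = 0"
    by (simp add: cx.killing_def cx.diag_sum_def cv.representation_zero)
  thus ?thesis by (simp add: K_def)
qed

lemma K_A: "a \<in> A \<Longrightarrow> K x a = 0"
  using K_central[of a x] central_A(2) by (simp add: K_sym)

text \<open>Cartan's criterion. For the radical \<open>I\<close> of \<open>K\<close>, the ideal J =
  [I, I] acts nilpotently. If \<open>J\<close> were nonzero, Engel's theorem would give it a nonzero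
  centre, an abelian ideal and hence inside \<open>A\<close>, although \<open>J\<close> is inside
  \<open>S\<close>. So \<open>I\<close> is itself an abelian ideal.\<close>

lemma K_radical:
  assumes "\<And>y. K x y = 0"
  shows "x \<in> A"
proof -
  define I where "I = {x. \<forall>y. K x y = 0}"
  have subI: "subspace I"
    by (rule subspaceI) (auto simp: I_def K_add_left K_scale_left linear_0[OF K_linear_left])
  have ideal_I: "br z y \<in> I" if "y \<in> I" for y z
  proof -
    have "K (br z y) w = - K (br y z) w" for w
      using br_anti[of z y] linear_neg[OF K_linear_left] by simp
    thus ?thesis
      using that by (auto simp: I_def K_invariant)
  qed
  define J where "J = span {br y z |y z. y \<in> I \<and> z \<in> I}"
  have subJ: "subspace J" by (simp add: J_def)
  have J_S: "J \<subseteq> S"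
    unfolding J_def using br_in_S subspace_S by (intro span_minimal) auto
  have ideal_J: "br w y \<in> J" if "y \<in> J" for w y
    using that unfolding J_def
  proof (induction rule: span_induct_alt)
    case base
    then show ?case by (simp add: br_0_right span_zero)
  next
    case (step c x y)
    then obtain u v where uv: "x = br u v" "u \<in> I" "v \<in> I" by blast
    have "br w x = br (br w u) v + br u (br w v)"
      unfolding uv by (rule br_deriv)
    moreover have "br (br w u) v \<in> J" "br u (br w v) \<in> J"
      unfolding J_def using uv ideal_I by (auto intro!: span_base)
    ultimately have "br w x \<in> J"
      using subJ by (simp add: subspace_add)
    hence "c *\<^sub>R br w x + br w y \<in> J"
      using subJ step by (simp add: J_def span_add span_scale)
    thus ?case
      by (simp add: br_add_right br_scale_right J_def)
  qed
  have nil: "\<exists>k. (br x ^^ k) v = 0" if "x \<in> J" for x v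
    by (rule funpow_br_nilpotent[of I]) (use that in \<open>auto simp: I_def J_def\<close>)
  have J0: "J = {0}"
  proof (rule ccontr)
    assume "J \<noteq> {0}"
    hence "{0} \<subset> J" using subspace_0[OF subJ] by auto
    hence "\<exists>v\<in>J - {0}. \<forall>x\<in>J. br x v \<in> {0}"
      by (intro engel subJ ideal_J nil) (auto simp: br_0_right)
    then obtain v where v: "v \<in> J" "v \<noteq> 0" "\<And>x. x \<in> J \<Longrightarrow> br x v = 0" by auto
    define Z where "Z = {v\<in>J. \<forall>x\<in>J. br x v = 0}"
    have "Z \<subseteq> A"
    proof (rule abelian_ideal_subset_A)
      show "subspace Z"
        using subJ by (intro subspaceI)
          (auto simp: Z_def br_0_right br_add_right br_scale_right subspace_0 subspace_add subspace_scale)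
      show "br w y \<in> Z" if "y \<in> Z" for w y
      proof -
        have "br x (br w y) = 0" if x: "x \<in> J" for x
        proof -
          have "br (br x w) y = 0"
            using ideal_J[OF x, of w] br_anti[of x w] \<open>y \<in> Z\<close> subJ by (simp add: Z_def subspace_neg)
          moreover have "br x y = 0" using x \<open>y \<in> Z\<close> by (simp add: Z_def)
          ultimately show ?thesis
            by (simp add: br_deriv[of x w y] br_0_right)
        qed
        thus ?thesis using that ideal_J by (simp add: Z_def)
      qed
      show "br x y = 0" if "x \<in> Z" "y \<in> Z" for x y
        using that by (simp add: Z_def)
    qed
    moreover have "v \<in> Z" using v by (simp add: Z_def)
    ultimately show False using J_S v S_A_zero by blast
  qed
  have "I \<subseteq> A"
  proof (rule abelian_ideal_subset_A[OF subI ideal_I])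
    fix x y assume "x \<in> I" "y \<in> I"
    hence "br x y \<in> J"
      unfolding J_def by (auto intro!: span_base)
    thus "br x y = 0" using J0 by simp
  qed
  thus ?thesis using assms by (auto simp: I_def)
qed

section \<open>Functionals on \<open>S\<close> represented through the Killing form\<close>

definition pr :: "'a \<Rightarrow> 'a" where
  "pr x = (THE s. s \<in> S \<and> x - s \<in> A)"

lemma prI: "s \<in> S \<Longrightarrow> x - s \<in> A \<Longrightarrow> pr x = s"
  unfolding pr_def
proof (rule the_equality)
  fix t assume t: "t \<in> S \<and> x - t \<in> A" and s: "s \<in> S" "x - s \<in> A"
  have "t - s \<in> S" using s t subspace_S by (simp add: subspace_diff)
  moreover have "(x - s) - (x - t) \<in> A" using s t subspace_A by (blast intro: subspace_diff)
  hence "t - s \<in> A" by simp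
  ultimately have "t - s = 0" by (rule S_A_zero)
  thus "t = s" by simp
qed auto

lemma pr: "pr x \<in> S" "x - pr x \<in> A"
proof -
  obtain s a where "x = s + a" "s \<in> S" "a \<in> A"
    by (rule decompose)
  thus "pr x \<in> S" "x - pr x \<in> A"
    using prI[of s x] by auto
qed

lemma pr_S: "s \<in> S \<Longrightarrow> pr s = s"
  by (rule prI) (auto simp: subspace_0 subspace_A)

lemma K_pr: "K x (pr y) = K x y"
proof -
  have "K x y - K x (pr y) = K x (y - pr y)"
    by (simp add: linear_diff[OF K_linear_right])
  thus ?thesis using K_A[OF pr(2)] by simp
qed

text \<open>The map \<open>T\<close> lists the \<open>K\<close>-products with a basis of
  \<open>S\<close>. It is injective on \<open>S\<close> by \<open>K_radical\<close>, hence onto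
  \<open>S\<close> by dimension, and \<open>H\<close> is the preimage of the vector that lists the
  values of \<open>f\<close>.\<close>

lemma K_represents:
  fixes f :: "'a \<Rightarrow> real"
  assumes f: "linear f"
  obtains H where "H \<in> S" "\<And>x. K H x = f (pr x)"
proof -
  obtain B where B: "B \<subseteq> S" "independent B" "S \<subseteq> span B"
    using basis_exists by metis
  have finB: "finite B" using fd.finiteI_independent B by blast
  have spanB: "span B = S"
    using B subspace_S by (metis span_minimal subset_antisym)
  define T where "T x = (\<Sum>b\<in>B. K x b *\<^sub>R b)" for x
  have T: "linear T"
    unfolding T_def by (rule linearI)
      (simp_all add: K_add_left K_scale_left sum.distrib scaleR_add_left scaleR_sum_right)
  have eq_S: "g s = g' s" if "linear g" "linear g'" "\<And>b. b \<in> B \<Longrightarrow> g b = g' b" "s \<in> S" for g g' :: "'a \<Rightarrow> real" and s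
    using linear_eq_on[OF that(1,2)] that(3,4) spanB by blast
  have "inj_on T S"
  proof -
    have "x = 0" if "x \<in> S" "T x = 0" for x
    proof -
      have "K x b = 0" if "b \<in> B" for b
        using independentD[OF B(2) finB order_refl _ that, of "K x"] \<open>T x = 0\<close> by (simp add: T_def)
      hence "K x s = 0" if "s \<in> S" for s
        using eq_S[OF K_linear_right, of "\<lambda>_. 0" x s] that by (simp add: linear_zero)
      hence "K x y = 0" for y
        using K_pr[of x y] pr by metis
      thus ?thesis
        using that K_radical S_A_zero by blast
    qed
    thus ?thesis
      using linear_inj_on_iff_eq_0[OF T subspace_S] by blast
  qed
  hence inj: "inj_on T (span B)"
    by (simp add: spanB)
  have "independent (T ` B)"
    using linear_independent_injective_image[OF T B(2) inj] .
  moreover have "T ` B \<subseteq> S"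
    unfolding T_def using B subspace_S by (auto intro!: subspace_sum subspace_scale)
  moreover have "card (T ` B) = dim S"
    using B inj span_superset[of B] by (subst card_image) (auto simp: basis_card_eq_dim intro: inj_on_subset)
  ultimately have "S \<subseteq> span (T ` B)"
    using finB by (intro fd.card_ge_dim_independent) auto
  hence "S \<subseteq> T ` S"
    by (simp add: linear_span_image[OF T] spanB)
  moreover have "(\<Sum>b\<in>B. f b *\<^sub>R b) \<in> S"
    using B subspace_S by (auto intro!: subspace_sum subspace_scale)
  ultimately obtain H where H: "H \<in> S" "(\<Sum>b\<in>B. f b *\<^sub>R b) = T H"
    by blast
  hence "(\<Sum>b\<in>B. (K H b - f b) *\<^sub>R b) = 0"
    by (simp add: T_def scaleR_diff_left sum_subtractf)
  hence "K H b - f b = 0" if "b \<in> B" for b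
    using independentD[OF B(2) finB order_refl _ that, of "\<lambda>b. K H b - f b"] by simp
  hence "K H s = f s" if "s \<in> S" for s
    using eq_S[OF K_linear_right f _ that] by simp
  hence "K H x = f (pr x)" for x
    using pr K_pr by metis
  thus ?thesis using H that by blast
qed

text \<open>The vector \<open>t\<close> representing \<theta> on \<open>S\<close> satisfies
  K([t, x], y) = \<theta>([x, y]) = 0, so it is central and K(t, s) = 0. This replaces the equality
  of \<open>S\<close> with its derived algebra.\<close>

lemma closed_form_vanishes:
  fixes \<theta> :: "'a \<Rightarrow> real"
  assumes "linear \<theta>" "\<And>x y. \<theta> (br x y) = 0" "s \<in> S"
  shows "\<theta> s = 0"
proof -
  obtain t where t: "t \<in> S" "\<And>x. K t x = \<theta> (pr x)"
    using K_represents[OF assms(1)] by blast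
  have "br t x = 0" for x
  proof -
    have "K (br t x) y = 0" for y
      by (simp add: K_invariant t pr_S br_in_S assms(2))
    thus ?thesis
      using K_radical br_in_S S_A_zero by blast
  qed
  hence "K t s = 0"
    by (rule K_central)
  thus ?thesis using t(2)[of s] pr_S[OF assms(3)] by simp
qed

end

text \<open>The forms appear as functions of vectors: \<open>d_om\<close> is d\<Omega> = \<theta>
  \<and> \<Omega> evaluated on three arguments, and \<open>nondeg\<close> is the trivial kernel
  deduced from the nonzero top power.\<close>

locale reductive_lcs = reductive_lie_algebra br R S A
  for br :: "'a::real_vector \<Rightarrow> 'a \<Rightarrow> 'a" and R S A +
  fixes om :: "'a \<Rightarrow> 'a \<Rightarrow> real" and th :: "'a \<Rightarrow> real"
  assumes om_linear: "linear (om x)" and om_anti: "om x y = - om y x"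
    and th_linear: "linear th" and th_closed: "th (br x y) = 0"
    and d_om: "- om (br x y) z + om (br x z) y - om (br y z) x = th x * om y z + th y * om z x + th z * om x y"
    and nondeg: "(\<And>y. om u y = 0) \<Longrightarrow> u = 0"
    and th_nonzero: "\<exists>x. th x \<noteq> 0"
    and dim_ge_4: "dim (UNIV :: 'a set) \<ge> 4"
begin

lemma om_add_right: "om x (y + z) = om x y + om x z"
  and om_scale_right: "om x (r *\<^sub>R y) = r * om x y"
  using linear_add[OF om_linear] linear_scale[OF om_linear] by auto

lemma om_add_left: "om (y + z) x = om y x + om z x"
  using om_anti[of "y + z" x] om_anti[of y x] om_anti[of z x] by (simp add: om_add_right)

lemma om_scale_left: "om (r *\<^sub>R y) x = r * om y x"
  using om_anti[of "r *\<^sub>R y" x] om_anti[of y x] by (simp add: om_scale_right)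

lemma om_diff_left: "om (y - z) x = om y x - om z x"
  using om_add_left[of "y - z" z x] by simp

lemma om_0_left: "om 0 x = 0"
  using om_scale_left[of 0 0 x] by simp

lemma th_S: "s \<in> S \<Longrightarrow> th s = 0"
  by (rule closed_form_vanishes[OF th_linear th_closed])

lemma unit_central: "\<exists>c\<in>A. th c = 1"
proof -
  obtain x where x: "th x \<noteq> 0" using th_nonzero by blast
  have "th (x - pr x) = th x"
    using th_S[OF pr(1)] by (simp add: linear_diff[OF th_linear])
  thus ?thesis
    using x pr(2)[of x] subspace_A
    by (intro bexI[of _ "(1 / th x) *\<^sub>R (x - pr x)"]) (simp_all add: linear_scale[OF th_linear] subspace_scale)
qed

definition c :: 'a where "c = (SOME c. c \<in> A \<and> th c = 1)"

lemma c: "c \<in> A" "th c = 1"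
  using someI_ex[of "\<lambda>c. c \<in> A \<and> th c = 1"] unit_central by (auto simp: c_def)

text \<open>With the convention d\<eta>(x, y) = - \<eta>([x, y]), this sign makes the formula below
  read \<Omega> = \<theta> \<and> \<eta> - d\<eta>.\<close>

definition eta :: "'a \<Rightarrow> real" where "eta x = - om x c"

lemma eta_linear: "linear eta"
  by (rule linearI) (simp_all add: eta_def om_add_left om_scale_left)

text \<open>Contracting \<open>d\<Omega> = \<theta> \<and> \<Omega>\<close> with the central element \<open>c\<close> gives a primitive of \<open>\<Omega>\<close> for the twisted
  differential.\<close>

lemma om_eq: "om x y = eta (br x y) + th x * eta y - th y * eta x"
  using d_om[of x y c] om_anti[of c x]
  by (simp add: c central_A om_0_left eta_def)

definition H :: 'a where "H = (SOME H. H \<in> S \<and> (\<forall>x. K H x = eta (pr x)))"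

lemma H_S: "H \<in> S" and K_H: "K H x = eta (pr x)"
proof -
  have "\<exists>H. H \<in> S \<and> (\<forall>x. K H x = eta (pr x))"
    using K_represents[OF eta_linear] by blast
  from someI_ex[OF this] show "H \<in> S" "K H x = eta (pr x)"
    by (auto simp: H_def)
qed

lemma eta_br: "eta (br x y) = K H (br x y)"
  by (simp add: K_H pr_S br_in_S)

lemma om_centralizer:
  assumes "s \<in> S" "br H s = 0"
  shows "om s y = - th y * eta s"
proof -
  have "eta (br s y) = K (br H s) y"
    by (simp add: eta_br K_invariant)
  thus ?thesis
    using om_eq[of s y] assms K_central[of 0 y] br_0_left by (simp add: th_S)
qed

lemma span_pr: "x \<in> span T" if "pr x \<in> span T" "x - pr x \<in> span T"
  using span_add[OF that] by simp

text \<open>If H = 0, then \<eta> vanishes on \<open>S\<close>, so \<open>S\<close> is in the kernel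
  of \<Omega> and thus zero. The algebra is then abelian and \<Omega> = \<theta> \<and> \<eta> has
  rank at most 2, too small for dimension 4.\<close>

lemma H_nonzero: "H \<noteq> 0"
proof
  assume "H = 0"
  hence K0: "K H x = 0" for x
    using K_central[of H] br_0_left by simp
  have S0: "s = 0" if "s \<in> S" for s
  proof (rule nondeg)
    fix y
    have "eta s = 0"
      using K0[of s] K_H[of s] pr_S[OF that] by simp
    thus "om s y = 0"
      using om_centralizer[OF that, of y] \<open>H = 0\<close> br_0_left by simp
  qed
  have br0: "br x y = 0" for x y
    using S0 br_in_S by blast
  have om: "om x y = th x * eta y - th y * eta x" for x y
    using om_eq[of x y] br0 linear_0[OF eta_linear] by simp
  have zero: "x = 0" if "th x = 0" "eta x = 0" for x
    using that by (intro nondeg) (simp add: om)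
  obtain d where d: "\<And>y. th y = 0 \<Longrightarrow> y \<in> span {d}"
  proof (cases "\<exists>d. th d = 0 \<and> eta d \<noteq> 0")
    case True
    then obtain d where d: "th d = 0" "eta d \<noteq> 0" by blast
    have "y \<in> span {d}" if "th y = 0" for y
    proof -
      have "y - (eta y / eta d) *\<^sub>R d = 0"
        using that d by (intro zero)
          (simp_all add: linear_diff[OF th_linear] linear_scale[OF th_linear] linear_diff[OF eta_linear] linear_scale[OF eta_linear])
      thus ?thesis by (auto simp: span_singleton)
    qed
    thus ?thesis using that by blast
  next
    case False
    hence "y \<in> span {0}" if "th y = 0" for y
      using zero that by auto
    thus ?thesis using that by blast
  qed
  have "x \<in> span {c, d}" for x
  proof -
    have "th (x - th x *\<^sub>R c) = 0"
      by (simp add: linear_diff[OF th_linear] linear_scale[OF th_linear] c)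
    thus ?thesis
      using d unfolding span_breakdown_eq by blast
  qed
  hence "dim (UNIV :: 'a set) \<le> card {c, d}"
    by (intro dim_le_card) auto
  also have "\<dots> \<le> 2"
    by (simp add: card_insert_if)
  finally show False using dim_ge_4 by simp
qed

lemma om_H: "om H y = - th y * eta H"
  by (rule om_centralizer[OF H_S br_self])

lemma eta_H: "eta H \<noteq> 0"
  using om_H nondeg[of H] H_nonzero by auto

lemma K_H_H: "K H H = eta H"
  by (simp add: K_H pr_S H_S)

text \<open>Contraction with \<open>u\<close> and with \<open>H\<close> both give multiples of
  \<theta>; the combination of \<open>u\<close> and \<open>H\<close> for which they cancel is in the
  kernel of \<Omega>.\<close>

lemma eq_multiple_H:
  assumes "\<And>y. om u y = - th y * eta u"
  shows "u = (eta u / eta H) *\<^sub>R H"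
proof -
  have "u - (eta u / eta H) *\<^sub>R H = 0"
    using assms eta_H by (intro nondeg) (simp add: om_diff_left om_scale_left om_H)
  thus ?thesis by simp
qed

lemma A_eq: "a \<in> A \<Longrightarrow> a = th a *\<^sub>R c"
proof -
  assume a: "a \<in> A"
  define a' where "a' = a - th a *\<^sub>R c"
  have a': "a' \<in> A" "th a' = 0"
    using a c subspace_A
    by (simp_all add: a'_def subspace_diff subspace_scale linear_diff[OF th_linear] linear_scale[OF th_linear])
  have "om a' y = - th y * eta a'" for y
    using om_eq[of a' y] a' by (simp add: central_A linear_0[OF eta_linear])
  hence "a' = (eta a' / eta H) *\<^sub>R H"
    by (rule eq_multiple_H)
  hence "a' \<in> S"
    using H_S subspace_S subspace_scale by metis
  thus ?thesis
    using a' S_A_zero[of a'] by (simp add: a'_def)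
qed

lemma centralizer_H:
  assumes "br H x = 0"
  obtains t s where "x = t *\<^sub>R H + s *\<^sub>R c"
proof -
  have "br H (pr x) = 0"
  proof -
    have "br H x = br H (pr x) + br H (x - pr x)"
      by (simp flip: br_add_right)
    thus ?thesis
      using assms by (simp add: central_A(1)[OF pr(2)])
  qed
  hence "pr x = (eta (pr x) / eta H) *\<^sub>R H"
    by (intro eq_multiple_H om_centralizer pr)
  moreover have "x - pr x = th (x - pr x) *\<^sub>R c"
    by (rule A_eq[OF pr(2)])
  moreover have "x = pr x + (x - pr x)" by simp
  ultimately show ?thesis using that by metis
qed

lemma rank_one: "rank_one_lie cscale CR (cbr br) (H, 0) (c, 0)"
proof (intro rank_one_lie.intro cx.complex_lie_axioms rank_one_lie_axioms.intro)
  show "cbr br (c, 0) x = 0" for x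
    by (simp add: cbr_def central_A c br_0_left zero_prod_def)
next
  fix v assume 0: "\<And>z. cx.killing v z = 0"
  obtain x y where v: "v = (x, y)" by (cases v)
  have "K x z = 0" "K y z = 0" for z
    using 0[of "(z, 0)"] unfolding v killing_complex by (simp_all add: complex_eq_iff)
  hence "x \<in> A" "y \<in> A"
    using K_radical by auto
  hence "x = th x *\<^sub>R c" "y = th y *\<^sub>R c"
    using A_eq by auto
  hence "v = cscale (Complex (th x) (th y)) (c, 0)"
    by (simp add: v cscale_real)
  thus "v \<in> cv.span {(c, 0)}"
    by (metis cv.span_base cv.span_scale singletonI)
next
  fix v assume 0: "cbr br (H, 0) v = 0"
  obtain x y where v: "v = (x, y)" by (cases v)
  have "br H x = 0" "br H y = 0"
    using 0 by (auto simp: v cbr_def br_0_left zero_prod_def)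
  then obtain t s t' s' where "x = t *\<^sub>R H + s *\<^sub>R c" "y = t' *\<^sub>R H + s' *\<^sub>R c"
    using centralizer_H by metis
  hence "v = cscale (Complex t t') (H, 0) + cscale (Complex s s') (c, 0)"
    by (simp add: v cscale_real)
  thus "v \<in> cv.span {(H, 0), (c, 0)}"
    by (simp add: cv.span_add cv.span_scale cv.span_base)
next
  show "cx.killing (H, 0) (H, 0) \<noteq> 0"
    by (simp add: killing_real K_H_H eta_H)
next
  fix v \<alpha> assume eq: "cbr br (H, 0) v = cscale \<alpha> (c, 0)"
  obtain x y where v: "v = (x, y)" by (cases v)
  have "br H x = Re \<alpha> *\<^sub>R c" "br H y = Im \<alpha> *\<^sub>R c"
    using eq by (auto simp: v cbr_def br_0_left cscale_real)
  hence "br H x = 0" "br H y = 0"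
    using br_in_S S_A_zero subspace_scale[OF subspace_A c(1)] by metis+
  thus "cbr br (H, 0) v = 0"
    by (simp add: v cbr_def br_0_left zero_prod_def)
qed

lemma dim_eq_4: "dim (UNIV :: 'a set) = 4"
proof -
  have "cx.dimension \<le> 4"
    using rank_one_lie.dimension_le_4[OF rank_one] .
  moreover have "card CR = card R"
    unfolding CR_def by (rule card_image) (auto simp: inj_on_def)
  moreover have "dim (UNIV :: 'a set) = card R"
    using fd.dim_UNIV by simp
  ultimately show ?thesis using dim_ge_4 by (simp add: cx.dimension_def)
qed

text \<open>Otherwise, by polarisation, \<open>K\<close> vanishes on the orthogonal complement of
  \<open>H\<close> in \<open>S\<close>; that complement is then in the radical, so zero, and
  \<open>H\<close> and \<open>c\<close> alone would span the algebra.\<close>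

lemma exists_e: "\<exists>e. e \<in> S \<and> K H e = 0 \<and> K e e \<noteq> 0"
proof (rule ccontr)
  assume "\<not> ?thesis"
  hence iso: "K v v = 0" if "v \<in> S" "K H v = 0" for v using that by blast
  have iso2: "K v w = 0" if v: "v \<in> S" "K H v = 0" and w: "w \<in> S" "K H w = 0" for v w
  proof -
    have "K (v + w) (v + w) = 0"
      using v w subspace_S by (intro iso) (simp_all add: subspace_add linear_add[OF K_linear_right])
    thus ?thesis
      using iso v w K_sym[of w v] by (simp add: K_add_left linear_add[OF K_linear_right])
  qed
  have decomp: "s - (K H s / K H H) *\<^sub>R H \<in> S" "K H (s - (K H s / K H H) *\<^sub>R H) = 0" if "s \<in> S" for s
    using that H_S subspace_S eta_H
    by (simp_all add: subspace_diff subspace_scale linear_diff[OF K_linear_right] linear_scale[OF K_linear_right] K_H_H)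
  have 0: "K v (pr y) = 0" if v: "v \<in> S" "K H v = 0" for v y
  proof -
    have "K v (pr y) = K v (pr y - (K H (pr y) / K H H) *\<^sub>R H) + (K H (pr y) / K H H) * K v H"
      by (simp add: linear_diff[OF K_linear_right] linear_scale[OF K_linear_right])
    thus ?thesis
      using iso2[OF v decomp[OF pr(1)[of y]]] v K_sym[of v H] by simp
  qed
  have "v = 0" if v: "v \<in> S" "K H v = 0" for v
    using 0[OF v] K_radical[of v] S_A_zero[OF v(1)] by (simp add: K_pr)
  hence S_eq: "s = (K H s / K H H) *\<^sub>R H" if "s \<in> S" for s
    using decomp[OF that] by (metis eq_iff_diff_eq_0)
  have "x \<in> span {H, c}" for x
  proof (rule span_pr)
    show "pr x \<in> span {H, c}"
      using S_eq[OF pr(1)[of x]] by (metis insertI1 span_base span_scale)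
    show "x - pr x \<in> span {H, c}"
      using A_eq[OF pr(2)[of x]] by (metis insertCI span_base span_scale)
  qed
  hence "dim (UNIV :: 'a set) \<le> card {H, c}"
    by (intro dim_le_card) auto
  also have "\<dots> \<le> 2"
    by (simp add: card_insert_if)
  finally show False using dim_ge_4 by simp
qed

text \<open>Invariance makes [x, y] orthogonal to \<open>x\<close> and \<open>y\<close>. So
  \<open>H\<close>, \<open>e\<close>, \<open>f\<close> are orthogonal, [H, f] is a multiple of
  \<open>e\<close>, and [e, f] is a multiple of \<open>H\<close>. Here q \<noteq> 0 because ad H is
  injective on the complement of \<open>H\<close> in \<open>S\<close>, and p \<noteq> 0 because p
  K(H, H) = K([H, e], f) = K(f, f), which is nonzero as \<open>f\<close> is not in the
  radical.\<close>

lemma standard_basis: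
  obtains e f p q where "br H e = f" "br H f = q *\<^sub>R e" "br e f = p *\<^sub>R H" "p \<noteq> 0" "q \<noteq> 0"
    "\<And>x. \<exists>\<alpha> \<beta> \<gamma> \<delta>. x = \<alpha> *\<^sub>R H + \<beta> *\<^sub>R e + \<gamma> *\<^sub>R f + \<delta> *\<^sub>R c"
    "\<And>\<alpha> \<beta> \<gamma> \<delta>. \<alpha> *\<^sub>R H + \<beta> *\<^sub>R e + \<gamma> *\<^sub>R f + \<delta> *\<^sub>R c = 0 \<Longrightarrow> \<alpha> = 0 \<and> \<beta> = 0 \<and> \<gamma> = 0 \<and> \<delta> = 0"
proof -
  obtain e where e: "e \<in> S" "K H e = 0" "K e e \<noteq> 0"
    using exists_e by blast
  define f where "f = br H e"
  note Kr = linear_add[OF K_linear_right] linear_scale[OF K_linear_right] linear_0[OF K_linear_right]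
  have KHH: "K H H \<noteq> 0" using eta_H by (simp add: K_H_H)
  have K_br: "K (br x y) x = 0" for x y
    using K_invariant[of x x y] K_central[of 0 y] K_sym[of "br x y" x] by (simp add: br_self br_0_left)
  have K_br': "K (br y x) x = 0" for x y
    using K_invariant[of y x x] by (simp add: br_self Kr)
  have f: "f \<in> S" "K H f = 0" "K e f = 0"
    using K_br[of H e] K_br'[of H e] by (simp_all only: f_def br_in_S K_sym[of H] K_sym[of e])
  have kz: "K e H = 0" "K f H = 0" "K f e = 0"
    using e(2) f(2,3) by (simp_all only: K_sym[of e H] K_sym[of f H] K_sym[of f e])
  have kb: "K x (br x y) = 0" "K x (br y x) = 0" for x y
    using K_br[of x y] K_br'[of y x] by (simp_all only: K_sym[of x])
  have inj: "v = 0" if v: "v \<in> S" "K H v = 0" "br H v = 0" for v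
  proof -
    obtain t s where ts: "v = t *\<^sub>R H + s *\<^sub>R c"
      using centralizer_H[OF v(3)] .
    have "v - t *\<^sub>R H \<in> S"
      using that H_S subspace_S by (simp add: subspace_diff subspace_scale)
    hence "s *\<^sub>R c = 0"
      unfolding ts using S_A_zero[of "s *\<^sub>R c"] subspace_scale[OF subspace_A c(1)] by simp
    hence v_t: "v = t *\<^sub>R H" unfolding ts by (metis add.right_neutral)
    hence "t * K H H = 0" using v(2) by (simp add: Kr)
    thus ?thesis using v_t KHH by simp
  qed
  have "f \<noteq> 0"
    using inj[OF e(1,2)] e(3) by (auto simp: f_def Kr)
  have zero: "\<alpha> = 0 \<and> \<beta> = 0 \<and> \<gamma> = 0 \<and> \<delta> = 0"
    if 0: "\<alpha> *\<^sub>R H + \<beta> *\<^sub>R e + \<gamma> *\<^sub>R f + \<delta> *\<^sub>R c = 0" for \<alpha> \<beta> \<gamma> \<delta>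
  proof -
    have "th (\<alpha> *\<^sub>R H + \<beta> *\<^sub>R e + \<gamma> *\<^sub>R f + \<delta> *\<^sub>R c) = \<delta>"
      by (simp add: linear_add[OF th_linear] linear_scale[OF th_linear] th_S H_S e f c)
    hence \<delta>: "\<delta> = 0" using 0 linear_0[OF th_linear] by simp
    hence 1: "\<alpha> *\<^sub>R H + \<beta> *\<^sub>R e + \<gamma> *\<^sub>R f = 0" using 0 by simp
    have "K H (\<alpha> *\<^sub>R H + \<beta> *\<^sub>R e + \<gamma> *\<^sub>R f) = \<alpha> * K H H"
      "K e (\<alpha> *\<^sub>R H + \<beta> *\<^sub>R e + \<gamma> *\<^sub>R f) = \<beta> * K e e"
      using e f kz by (simp_all add: Kr)
    hence "\<alpha> * K H H = 0" "\<beta> * K e e = 0"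
      unfolding 1 by (simp_all add: Kr)
    hence "\<alpha> = 0" "\<beta> = 0" using KHH e by simp_all
    thus ?thesis using 1 \<delta> \<open>f \<noteq> 0\<close> by simp
  qed
  have dist: "H \<noteq> e" "H \<noteq> f" "H \<noteq> c" "e \<noteq> f" "e \<noteq> c" "f \<noteq> c"
    using zero[of 1 "-1" 0 0] zero[of 1 0 "-1" 0] zero[of 1 0 0 "-1"] zero[of 0 1 "-1" 0] zero[of 0 1 0 "-1"] zero[of 0 0 1 "-1"]
    by auto
  have "independent {H, e, f, c}"
  proof (rule independent_if_scalars_zero)
    fix g x assume "(\<Sum>v\<in>{H, e, f, c}. g v *\<^sub>R v) = 0" "x \<in> {H, e, f, c}"
    thus "g x = 0"
      using zero[of "g H" "g e" "g f" "g c"] dist by (auto simp: add.assoc)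
  qed simp
  moreover have "card {H, e, f, c} = 4"
    using dist by simp
  ultimately have "UNIV \<subseteq> span {H, e, f, c}"
    using dim_eq_4 by (intro fd.card_ge_dim_independent) auto
  hence spans: "\<exists>\<alpha> \<beta> \<gamma> \<delta>. x = \<alpha> *\<^sub>R H + \<beta> *\<^sub>R e + \<gamma> *\<^sub>R f + \<delta> *\<^sub>R c" for x
  proof -
    have "x \<in> span {H, e, f, c}" for x
      using \<open>UNIV \<subseteq> _\<close> by blast
    then obtain \<alpha> \<beta> \<gamma> \<delta> where "x - \<alpha> *\<^sub>R H - \<beta> *\<^sub>R e - \<gamma> *\<^sub>R f = \<delta> *\<^sub>R c"
      unfolding span_breakdown_eq span_singleton by blast
    hence "x = \<alpha> *\<^sub>R H + \<beta> *\<^sub>R e + \<gamma> *\<^sub>R f + \<delta> *\<^sub>R c"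
      by (simp add: algebra_simps)
    thus ?thesis by blast
  qed
  have in_S: "\<exists>\<alpha> \<beta> \<gamma>. s = \<alpha> *\<^sub>R H + \<beta> *\<^sub>R e + \<gamma> *\<^sub>R f" if s: "s \<in> S" for s
  proof -
    obtain \<alpha> \<beta> \<gamma> \<delta> where s_eq: "s = \<alpha> *\<^sub>R H + \<beta> *\<^sub>R e + \<gamma> *\<^sub>R f + \<delta> *\<^sub>R c"
      using spans by blast
    have "th s = \<delta>"
      unfolding s_eq by (simp add: linear_add[OF th_linear] linear_scale[OF th_linear] th_S H_S e f c)
    hence "\<delta> = 0" using th_S[OF s] by simp
    thus ?thesis using s_eq by auto
  qed
  have Kff: "K f f \<noteq> 0"
  proof
    assume Kff: "K f f = 0"
    have "K f x = 0" for x
    proof -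
      obtain \<alpha> \<beta> \<gamma> \<delta> where "x = \<alpha> *\<^sub>R H + \<beta> *\<^sub>R e + \<gamma> *\<^sub>R f + \<delta> *\<^sub>R c"
        using spans by blast
      thus ?thesis
        using kz Kff K_A[OF c(1)] by (simp add: Kr)
    qed
    thus False
      using K_radical S_A_zero[OF f(1)] \<open>f \<noteq> 0\<close> by blast
  qed
  obtain \<alpha> q \<gamma> where Hf: "br H f = \<alpha> *\<^sub>R H + q *\<^sub>R e + \<gamma> *\<^sub>R f"
    using in_S br_in_S by blast
  have "K H (br H f) = \<alpha> * K H H" "K f (br H f) = \<gamma> * K f f"
    unfolding Hf using e f kz by (simp_all add: Kr)
  hence "\<alpha> = 0" "\<gamma> = 0"
    using KHH Kff kb(1)[of H f] kb(2)[of f H] by simp_all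
  hence Hf': "br H f = q *\<^sub>R e" using Hf by simp
  have q: "q \<noteq> 0"
    using inj[OF f(1,2)] \<open>f \<noteq> 0\<close> Hf' by auto
  obtain p \<beta> \<gamma>' where ef: "br e f = p *\<^sub>R H + \<beta> *\<^sub>R e + \<gamma>' *\<^sub>R f"
    using in_S br_in_S by blast
  have "K e (br e f) = \<beta> * K e e" "K f (br e f) = \<gamma>' * K f f" "K H (br e f) = p * K H H"
    unfolding ef using e f kz by (simp_all add: Kr)
  moreover have "K H (br e f) = K f f"
    using K_invariant[of H e f] by (simp add: f_def)
  ultimately have "\<beta> = 0" "\<gamma>' = 0" "p \<noteq> 0"
    using e Kff kb(1)[of e f] kb(2)[of f e] by auto
  hence "br e f = p *\<^sub>R H" "p \<noteq> 0" using ef by auto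
  thus ?thesis
    using that[of e f q p] f_def Hf' q spans zero by blast
qed

end

section \<open>Wedge powers\<close>

text \<open>\<open>alternating_form\<close> without the alternation, which
  \<open>wedge_repeated\<close> provides for every wedge product.\<close>

definition multilinear_form :: "nat \<Rightarrow> 'a::real_vector form \<Rightarrow> bool" where
  "multilinear_form k \<omega> \<longleftrightarrow>
     (\<forall>v w. (\<forall>i<k. v i = w i) \<longrightarrow> \<omega> v = \<omega> w) \<and> (\<forall>v. \<forall>i<k. linear (\<lambda>x. \<omega> (v(i := x))))"

lemma linear_mult_const:
  fixes f :: "'a::real_vector \<Rightarrow> real"
  assumes "linear f"
  shows "linear (\<lambda>x. f x * k)" "linear (\<lambda>x. k * f x)"
  by (rule linearI; simp add: linear_add[OF assms] linear_scale[OF assms] distrib_left distrib_right)+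

lemma wedge_multilinear:
  assumes \<alpha>: "multilinear_form p \<alpha>" and \<beta>: "multilinear_form q \<beta>"
  shows "multilinear_form (p + q) (wedge p q \<alpha> \<beta>)"
  unfolding multilinear_form_def
proof (intro conjI allI impI)
  fix v w :: "nat \<Rightarrow> 'a" assume vw: "\<forall>i<p + q. v i = w i"
  show "wedge p q \<alpha> \<beta> v = wedge p q \<alpha> \<beta> w"
    unfolding wedge_def
  proof (intro arg_cong2[where f = "(/)"] sum.cong refl)
    fix \<sigma> assume "\<sigma> \<in> {\<sigma>. \<sigma> permutes {..<p + q}}"
    hence \<sigma>: "\<sigma> i < p + q" if "i < p + q" for i
      using that permutes_in_image[of \<sigma> "{..<p + q}" i] by simp
    have "\<alpha> (\<lambda>i. v (\<sigma> i)) = \<alpha> (\<lambda>i. w (\<sigma> i))"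
      using \<alpha> vw \<sigma> unfolding multilinear_form_def by simp
    moreover have "\<beta> (\<lambda>i. v (\<sigma> (p + i))) = \<beta> (\<lambda>i. w (\<sigma> (p + i)))"
      using \<beta> vw \<sigma> unfolding multilinear_form_def by simp
    ultimately show "of_int (sign \<sigma>) * \<alpha> (\<lambda>i. v (\<sigma> i)) * \<beta> (\<lambda>i. v (\<sigma> (p + i)))
      = of_int (sign \<sigma>) * \<alpha> (\<lambda>i. w (\<sigma> i)) * \<beta> (\<lambda>i. w (\<sigma> (p + i)))"
      by simp
  qed
next
  fix v :: "nat \<Rightarrow> 'a" and m assume m: "m < p + q"
  have "linear (\<lambda>x. \<alpha> (\<lambda>i. (v(m := x)) (\<sigma> i)) * \<beta> (\<lambda>i. (v(m := x)) (\<sigma> (p + i))))"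
    if \<sigma>: "\<sigma> permutes {..<p + q}" for \<sigma>
  proof -
    \<comment> \<open>The variable argument \<open>m\<close> is read in exactly one slot
      \<open>j\<close>, which belongs either to \<open>\<alpha>\<close> or to
      \<open>\<beta>\<close>; the other factor is constant.\<close>
    obtain j where j: "\<sigma> j = m" "j < p + q"
      using permutes_image[OF \<sigma>] m by (metis (no_types, lifting) imageE lessThan_iff)
    have inj: "\<sigma> i = m \<longleftrightarrow> i = j" for i
      using permutes_inj[OF \<sigma>] j by (auto dest: injD)
    show ?thesis
    proof (cases "j < p")
      case True
      have "(\<lambda>i. (v(m := x)) (\<sigma> i)) = (\<lambda>i. v (\<sigma> i))(j := x)" for x
        by (auto simp: inj)
      moreover have "(\<lambda>i. (v(m := x)) (\<sigma> (p + i))) = (\<lambda>i. v (\<sigma> (p + i)))" for x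
        using True by (auto simp: inj)
      moreover have "linear (\<lambda>x. \<alpha> ((\<lambda>i. v (\<sigma> i))(j := x)))"
        using \<alpha> True by (simp add: multilinear_form_def)
      ultimately show ?thesis
        by (simp only: linear_mult_const(1))
    next
      case False
      define l where "l = j - p"
      have l: "l < q" "j = p + l" using False j by (auto simp: l_def)
      have "\<alpha> (\<lambda>i. (v(m := x)) (\<sigma> i)) = \<alpha> (\<lambda>i. v (\<sigma> i))" for x
        using \<alpha> False inj unfolding multilinear_form_def by simp
      moreover have "(\<lambda>i. (v(m := x)) (\<sigma> (p + i))) = (\<lambda>i. v (\<sigma> (p + i)))(l := x)" for x
        by (auto simp: inj l)
      moreover have "linear (\<lambda>x. \<beta> ((\<lambda>i. v (\<sigma> (p + i)))(l := x)))"
        using \<beta> l by (simp add: multilinear_form_def)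
      ultimately show ?thesis
        by (simp only: linear_mult_const(2))
    qed
  qed
  note lin = this
  show "linear (\<lambda>x. wedge p q \<alpha> \<beta> (v(m := x)))"
  proof (rule linearI)
    fix x y
    show "wedge p q \<alpha> \<beta> (v(m := x + y)) = wedge p q \<alpha> \<beta> (v(m := x)) + wedge p q \<alpha> \<beta> (v(m := y))"
      unfolding wedge_def add_divide_distrib[symmetric] sum.distrib[symmetric]
    proof (intro arg_cong2[where f = "(/)"] sum.cong refl)
      fix \<sigma> assume "\<sigma> \<in> {\<sigma>. \<sigma> permutes {..<p + q}}"
      thus "of_int (sign \<sigma>) * \<alpha> (\<lambda>i. (v(m := x + y)) (\<sigma> i)) * \<beta> (\<lambda>i. (v(m := x + y)) (\<sigma> (p + i))) =
        of_int (sign \<sigma>) * \<alpha> (\<lambda>i. (v(m := x)) (\<sigma> i)) * \<beta> (\<lambda>i. (v(m := x)) (\<sigma> (p + i))) +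
        of_int (sign \<sigma>) * \<alpha> (\<lambda>i. (v(m := y)) (\<sigma> i)) * \<beta> (\<lambda>i. (v(m := y)) (\<sigma> (p + i)))"
        using linear_add[OF lin[of \<sigma>], of x y] by (simp only: mult.assoc mem_Collect_eq distrib_left)
    qed
  next
    fix c x
    show "wedge p q \<alpha> \<beta> (v(m := c *\<^sub>R x)) = c *\<^sub>R wedge p q \<alpha> \<beta> (v(m := x))"
      unfolding wedge_def real_scaleR_def times_divide_eq_right sum_distrib_left
    proof (intro arg_cong2[where f = "(/)"] sum.cong refl)
      fix \<sigma> assume "\<sigma> \<in> {\<sigma>. \<sigma> permutes {..<p + q}}"
      thus "of_int (sign \<sigma>) * \<alpha> (\<lambda>i. (v(m := c *\<^sub>R x)) (\<sigma> i)) * \<beta> (\<lambda>i. (v(m := c *\<^sub>R x)) (\<sigma> (p + i))) =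
        c * (of_int (sign \<sigma>) * \<alpha> (\<lambda>i. (v(m := x)) (\<sigma> i)) * \<beta> (\<lambda>i. (v(m := x)) (\<sigma> (p + i))))"
        using linear_scale[OF lin[of \<sigma>], of c x] by (simp only: mult.assoc mem_Collect_eq real_scaleR_def mult.left_commute)
    qed
  qed
qed

lemma wedge_vanishes:
  assumes \<alpha>: "\<And>v i. i < p \<Longrightarrow> v i = u \<Longrightarrow> \<alpha> v = 0" and \<beta>: "\<And>v i. i < q \<Longrightarrow> v i = u \<Longrightarrow> \<beta> v = 0"
    and m: "m < p + q" "v m = u"
  shows "wedge p q \<alpha> \<beta> v = 0"
proof -
  have "\<alpha> (\<lambda>i. v (\<sigma> i)) * \<beta> (\<lambda>i. v (\<sigma> (p + i))) = 0" if \<sigma>: "\<sigma> permutes {..<p + q}" for \<sigma>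
  proof -
    obtain j where j: "\<sigma> j = m" "j < p + q"
      using permutes_image[OF \<sigma>] m(1) by (metis (no_types, lifting) imageE lessThan_iff)
    show ?thesis
    proof (cases "j < p")
      case True
      thus ?thesis using \<alpha>[of j "\<lambda>i. v (\<sigma> i)"] j m by simp
    next
      case False
      thus ?thesis using \<beta>[of "j - p" "\<lambda>i. v (\<sigma> (p + i))"] j m by simp
    qed
  qed
  hence "(\<Sum>\<sigma> | \<sigma> permutes {..<p + q}.
      of_int (sign \<sigma>) * (\<alpha> (\<lambda>i. v (\<sigma> i)) * \<beta> (\<lambda>i. v (\<sigma> (p + i))))) = 0"
    by (intro sum.neutral) simp
  thus ?thesis
    unfolding wedge_def mult.assoc by simp
qed

text \<open>Composing each permutation with the transposition of \<open>i\<close> and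
  \<open>j\<close> keeps the arguments and reverses the sign, so the sum is its own
  negative.\<close>

lemma wedge_repeated:
  assumes ij: "i < p + q" "j < p + q" "i \<noteq> j" "v i = v j"
  shows "wedge p q \<alpha> \<beta> v = 0"
proof -
  let ?S = "{..<p + q}"
  let ?g = "\<lambda>\<sigma>. of_int (sign \<sigma>) * \<alpha> (\<lambda>i. v (\<sigma> i)) * \<beta> (\<lambda>i. v (\<sigma> (p + i)))"
  let ?\<tau> = "Transposition.transpose i j"
  have \<tau>: "?\<tau> permutes ?S"
    using ij by (intro permutes_swap_id) auto
  have v: "v (?\<tau> k) = v k" for k
    using ij by (auto simp: Transposition.transpose_def)
  have "sum ?g {\<sigma>. \<sigma> permutes ?S} = (\<Sum>\<sigma> | \<sigma> permutes ?S. ?g (?\<tau> \<circ> \<sigma>))"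
    by (rule setum_permutations_compose_left[OF \<tau>])
  also have "\<dots> = (\<Sum>\<sigma> | \<sigma> permutes ?S. - ?g \<sigma>)"
  proof (intro sum.cong refl)
    fix \<sigma> assume "\<sigma> \<in> {\<sigma>. \<sigma> permutes ?S}"
    hence "permutation \<sigma>"
      using permutes_imp_permutation[of ?S \<sigma>] by simp
    hence "sign (?\<tau> \<circ> \<sigma>) = - sign \<sigma>"
      using ij by (simp add: sign_compose permutation_swap_id sign_swap_id)
    thus "?g (?\<tau> \<circ> \<sigma>) = - ?g \<sigma>"
      by (simp add: v)
  qed
  also have "\<dots> = - sum ?g {\<sigma>. \<sigma> permutes ?S}"
    by (rule sum_negf)
  finally have "sum ?g {\<sigma>. \<sigma> permutes ?S} = 0"
    by simp
  thus ?thesis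
    by (simp add: wedge_def)
qed

lemma wedge_power_multilinear:
  "multilinear_form p \<omega> \<Longrightarrow> multilinear_form (p * m) (wedge_power p \<omega> m)"
proof (induction m)
  case 0
  then show ?case by (simp add: multilinear_form_def)
next
  case (Suc m)
  then show ?case
    using wedge_multilinear[of p \<omega> "p * m" "wedge_power p \<omega> m"] by simp
qed

lemma wedge_power_vanishes:
  assumes "\<And>v i. i < p \<Longrightarrow> v i = u \<Longrightarrow> \<omega> v = 0" "i < p * m" "v i = u"
  shows "wedge_power p \<omega> m v = 0"
  using assms(2,3)
proof (induction m arbitrary: v i)
  case (Suc m)
  show ?case
    using wedge_vanishes[of p u \<omega> "p * m" "wedge_power p \<omega> m" i v] assms(1) Suc by simp
qed simp

lemma alternating_form_multilinear: "alternating_form k \<omega> \<Longrightarrow> multilinear_form k \<omega>"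
  by (simp add: alternating_form_def multilinear_form_def)

text \<open>If the power were nonzero at \<open>v\<close>, its \<open>p * n\<close> arguments would
  form a basis. Replacing one of them by \<open>u\<close> gives zero, but also a coordinate of
  \<open>u\<close> times the nonzero value; so all coordinates of \<open>u\<close> vanish.\<close>

lemma wedge_power_kernel:
  fixes \<omega> :: "'a::real_vector form"
  assumes \<omega>: "multilinear_form p \<omega>" and dim: "dim (UNIV :: 'a set) = p * n" "p * n > 0"
    and u: "u \<noteq> 0" "\<And>v i. i < p \<Longrightarrow> v i = u \<Longrightarrow> \<omega> v = 0"
  shows "wedge_power p \<omega> n = (\<lambda>v. 0)"
proof
  fix v
  let ?k = "p * n" and ?F = "wedge_power p \<omega> n"
  have F: "multilinear_form ?k ?F"
    by (rule wedge_power_multilinear[OF \<omega>])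
  obtain m where n: "n = Suc m"
    using dim by (cases n) auto
  have repeated: "?F w = 0" if "i < ?k" "j < ?k" "i \<noteq> j" "w i = w j" for w i j
    using wedge_repeated[of i p "p * m" j w \<omega> "wedge_power p \<omega> m"] that by (simp add: n)
  show "?F v = 0"
  proof (rule ccontr)
    assume Fv: "?F v \<noteq> 0"
    \<comment> \<open>Cramer's rule: every term but the \<open>j\<close>-th repeats an
      argument.\<close>
    have coeff: "?F (v(j := \<Sum>i<?k. c i *\<^sub>R v i)) = c j * ?F v" if j: "j < ?k" for c j
    proof -
      have lin: "linear (\<lambda>x. ?F (v(j := x)))"
        using F j by (simp add: multilinear_form_def)
      have "?F (v(j := \<Sum>i<?k. c i *\<^sub>R v i)) = (\<Sum>i<?k. c i * ?F (v(j := v i)))"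
        using linear_sum[OF lin, of "\<lambda>i. c i *\<^sub>R v i" "{..<?k}"] linear_scale[OF lin] by simp
      also have "\<dots> = (\<Sum>i<?k. if i = j then c j * ?F v else 0)"
      proof (intro sum.cong refl)
        fix i assume "i \<in> {..<?k}"
        thus "c i * ?F (v(j := v i)) = (if i = j then c j * ?F v else 0)"
          using repeated[of i j "v(j := v i)"] j by auto
      qed
      also have "\<dots> = c j * ?F v"
        using j by simp
      finally show ?thesis .
    qed
    have inj: "inj_on v {..<?k}"
      using repeated Fv by (auto simp: inj_on_def)
    have ind: "independent (v ` {..<?k})"
    proof (rule independent_if_scalars_zero)
      fix f x assume f: "(\<Sum>x\<in>v ` {..<?k}. f x *\<^sub>R x) = 0" and x: "x \<in> v ` {..<?k}"
      obtain j where j: "j < ?k" "x = v j" using x by auto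
      have 0: "(\<Sum>i<?k. f (v i) *\<^sub>R v i) = 0"
        using f by (simp add: sum.reindex[OF inj])
      have "linear (\<lambda>x. ?F (v(j := x)))"
        using F j by (simp add: multilinear_form_def)
      hence "?F (v(j := 0)) = 0"
        by (rule linear_0)
      hence "f (v j) * ?F v = 0"
        using coeff[OF j(1), of "\<lambda>i. f (v i)"] by (simp add: 0)
      thus "f x = 0" using Fv j by simp
    qed simp
    have card: "card (v ` {..<?k}) = dim (UNIV :: 'a set)"
      using card_image[OF inj] dim by simp
    obtain B where B: "B \<subseteq> (UNIV :: 'a set)" "independent B" "UNIV \<subseteq> span B" "card B = dim (UNIV :: 'a set)"
      using basis_exists[of "UNIV :: 'a set"] by metis
    hence finB: "finite B"
      using dim by (metis card.infinite less_irrefl)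
    have "u \<in> span (v ` {..<?k})"
    proof (rule ccontr)
      assume nu: "u \<notin> span (v ` {..<?k})"
      hence ind': "independent (insert u (v ` {..<?k}))"
        using ind by (simp add: independent_insert)
      have "card (insert u (v ` {..<?k})) \<le> card B"
        using independent_span_bound[OF finB ind'] B(3) by blast
      moreover have "u \<notin> v ` {..<?k}" using nu by (metis span_base)
      hence "card (insert u (v ` {..<?k})) = Suc (card (v ` {..<?k}))"
        by (intro card_insert_disjoint) auto
      ultimately show False using card B(4) by linarith
    qed
    then obtain f where "u = (\<Sum>x\<in>v ` {..<?k}. f x *\<^sub>R x)"
      by (auto simp: span_finite)
    hence u_eq: "u = (\<Sum>i<?k. f (v i) *\<^sub>R v i)"
      by (simp add: sum.reindex[OF inj])
    have "f (v j) = 0" if j: "j < ?k" for j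
    proof -
      have "?F (v(j := u)) = 0"
        using wedge_power_vanishes[of p u \<omega> j n "v(j := u)"] u j by simp
      thus ?thesis
        using coeff[OF j, of "\<lambda>i. f (v i)"] u_eq Fv by simp
    qed
    hence "u = 0" using u_eq by simp
    thus False using u by simp
  qed
qed

section \<open>Low-degree forms\<close>

text \<open>The six permutations agree in pairs by antisymmetry of \<open>b\<close>, which absorbs
  the division by \<open>fact 2\<close>.\<close>

lemma wedge_1_2:
  assumes \<alpha>: "\<And>w. \<alpha> w = a (w 0)" and \<beta>: "\<And>w. \<beta> w = b (w 0) (w 1)" and b: "\<And>x y. b x y = - b y x"
  shows "wedge 1 2 \<alpha> \<beta> v = a (v 0) * b (v 1) (v 2) + a (v 1) * b (v 2) (v 0) + a (v 2) * b (v 0) (v 1)"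
proof -
  have set: "{..<1 + 2} = insert 0 (insert 1 {2 :: nat})"
    by auto
  have f1: "finite {1, 2 :: nat}" "(0 :: nat) \<notin> {1, 2}" and f2: "finite {2 :: nat}" "(1 :: nat) \<notin> {2}"
    by auto
  show ?thesis
    unfolding wedge_def set sum_over_permutations_insert[OF f1]
    unfolding sum_over_permutations_insert[OF f2] permutes_sing
    using b[of "v 0" "v 2"] b[of "v 1" "v 0"] b[of "v 2" "v 1"]
    by (simp add: \<alpha> \<beta> sign_swap_id permutation_swap_id sign_compose sign_id fact_numeral
        numeral_2_eq_2 Transposition.transpose_def algebra_simps)
qed

lemma ce_diff_1:
  assumes "\<And>w. \<alpha> w = a (w 0)"
  shows "ce_diff br 1 \<alpha> v = - a (br (v 0) (v 1))"
proof -
  have "{(i, j). i < j \<and> j \<le> (1 :: nat)} = {(0, 1)}"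
    by auto
  thus ?thesis
    unfolding ce_diff_def by (simp add: assms)
qed

lemma ce_diff_2:
  assumes "\<And>w. \<beta> w = b (w 0) (w 1)"
  shows "ce_diff br 2 \<beta> v = - b (br (v 0) (v 1)) (v 2) + b (br (v 0) (v 2)) (v 1) - b (br (v 1) (v 2)) (v 0)"
proof -
  have "{(i, j). i < j \<and> j \<le> (2 :: nat)} = {(0, 1), (0, 2), (1, 2)}"
    by auto
  moreover have "skip 1 (skip 0 0) = 2" "skip 2 (skip 0 0) = 1" "skip 2 (skip 1 0) = 0"
    by (simp_all add: skip_def)
  ultimately show ?thesis
    unfolding ce_diff_def by (simp add: assms)
qed

section \<open>The four-dimensional Lie algebras\<close>

lemma bilinear_commutator:
  fixes A B C :: "'a::real_algebra_1 ^ 'n ^ 'n"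
  shows "commutator (A + B) C = commutator A C + commutator B C"
    "commutator C (A + B) = commutator C A + commutator C B"
    "commutator (r *\<^sub>R A) C = r *\<^sub>R commutator A C"
    "commutator C (r *\<^sub>R A) = r *\<^sub>R commutator C A"
  by (simp_all add: commutator_def matrix_matrix_mult_def vec_eq_iff scaleR_sum_right sum.distrib algebra_simps)

lemma commutator_anti: "commutator A B = - commutator B A"
  by (simp add: commutator_def)

lemma commutator_self: "commutator A A = 0"
  by (simp add: commutator_def)

text \<open>Both sides have the same bracket table with the same \<open>p\<close> and
  \<open>q\<close>, so sending \<open>H\<close>, \<open>e\<close>, \<open>f\<close> to
  \<open>X\<close>, \<open>Y\<close>, \<open>Z\<close> and \<open>c\<close> to the unit of the
  second factor is an isomorphism.\<close>

lemma (in reductive_lcs) lie_isomorphic_matrices: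
  fixes X Y Z :: "'m::real_algebra_1 ^ 'n ^ 'n"
  assumes rel: "br H e = f" "br H f = q *\<^sub>R e" "br e f = p *\<^sub>R H"
    and spans: "\<And>x. \<exists>\<alpha> \<beta> \<gamma> \<delta>. x = \<alpha> *\<^sub>R H + \<beta> *\<^sub>R e + \<gamma> *\<^sub>R f + \<delta> *\<^sub>R c"
    and zero: "\<And>\<alpha> \<beta> \<gamma> \<delta>. \<alpha> *\<^sub>R H + \<beta> *\<^sub>R e + \<gamma> *\<^sub>R f + \<delta> *\<^sub>R c = 0 \<Longrightarrow> \<alpha> = 0 \<and> \<beta> = 0 \<and> \<gamma> = 0 \<and> \<delta> = 0"
    and mat_rel: "commutator X Y = Z" "commutator X Z = q *\<^sub>R Y" "commutator Y Z = p *\<^sub>R X"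
    and M: "\<And>B. B \<in> M \<longleftrightarrow> (\<exists>\<alpha> \<beta> \<gamma>. B = \<alpha> *\<^sub>R X + \<beta> *\<^sub>R Y + \<gamma> *\<^sub>R Z)"
    and mat_zero: "\<And>\<alpha> \<beta> \<gamma>. \<alpha> *\<^sub>R X + \<beta> *\<^sub>R Y + \<gamma> *\<^sub>R Z = 0 \<Longrightarrow> \<alpha> = 0 \<and> \<beta> = 0 \<and> \<gamma> = 0"
  shows "lie_isomorphic br UNIV (sum_bracket commutator abelian_bracket) (M \<times> (UNIV :: real set))"
proof -
  obtain \<alpha> \<beta> \<gamma> \<delta> :: "'a \<Rightarrow> real"
    where eq: "\<And>x. x = \<alpha> x *\<^sub>R H + \<beta> x *\<^sub>R e + \<gamma> x *\<^sub>R f + \<delta> x *\<^sub>R c"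
    using spans by metis
  have uniq: "\<alpha> x = a \<and> \<beta> x = b \<and> \<gamma> x = g \<and> \<delta> x = d"
    if "x = a *\<^sub>R H + b *\<^sub>R e + g *\<^sub>R f + d *\<^sub>R c" for x a b g d
  proof -
    have "a *\<^sub>R H + b *\<^sub>R e + g *\<^sub>R f + d *\<^sub>R c = \<alpha> x *\<^sub>R H + \<beta> x *\<^sub>R e + \<gamma> x *\<^sub>R f + \<delta> x *\<^sub>R c"
      using that eq[of x] by metis
    hence "(\<alpha> x - a) *\<^sub>R H + (\<beta> x - b) *\<^sub>R e + (\<gamma> x - g) *\<^sub>R f + (\<delta> x - d) *\<^sub>R c = 0"
      by (simp add: algebra_simps)
    from zero[OF this] show ?thesis by simp
  qed
  have add: "\<alpha> (x + y) = \<alpha> x + \<alpha> y \<and> \<beta> (x + y) = \<beta> x + \<beta> y \<and> \<gamma> (x + y) = \<gamma> x + \<gamma> y \<and> \<delta> (x + y) = \<delta> x + \<delta> y" for x y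
  proof (rule uniq)
    show "x + y = (\<alpha> x + \<alpha> y) *\<^sub>R H + (\<beta> x + \<beta> y) *\<^sub>R e + (\<gamma> x + \<gamma> y) *\<^sub>R f + (\<delta> x + \<delta> y) *\<^sub>R c"
      by (subst eq[of x], subst eq[of y]) (simp only: scaleR_add_left ac_simps)
  qed
  have scale: "\<alpha> (r *\<^sub>R x) = r * \<alpha> x \<and> \<beta> (r *\<^sub>R x) = r * \<beta> x \<and> \<gamma> (r *\<^sub>R x) = r * \<gamma> x \<and> \<delta> (r *\<^sub>R x) = r * \<delta> x" for r x
  proof (rule uniq)
    show "r *\<^sub>R x = (r * \<alpha> x) *\<^sub>R H + (r * \<beta> x) *\<^sub>R e + (r * \<gamma> x) *\<^sub>R f + (r * \<delta> x) *\<^sub>R c"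
      by (subst eq[of x]) (simp only: scaleR_add_right scaleR_scaleR)
  qed
  have rel': "br e H = - f" "br f H = - q *\<^sub>R e" "br f e = - p *\<^sub>R H"
    using rel br_anti[of e H] br_anti[of f H] br_anti[of f e] by simp_all
  have mat_rel': "commutator Y X = - Z" "commutator Z X = - q *\<^sub>R Y" "commutator Z Y = - p *\<^sub>R X"
    using mat_rel commutator_anti[of Y X] commutator_anti[of Z X] commutator_anti[of Z Y] by simp_all
  have bracket: "\<alpha> (br x y) = p * (\<beta> x * \<gamma> y - \<gamma> x * \<beta> y) \<and> \<beta> (br x y) = q * (\<alpha> x * \<gamma> y - \<gamma> x * \<alpha> y) \<and>
      \<gamma> (br x y) = \<alpha> x * \<beta> y - \<beta> x * \<alpha> y \<and> \<delta> (br x y) = 0" for x y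
  proof (rule uniq)
    have "br x y = br (\<alpha> x *\<^sub>R H + \<beta> x *\<^sub>R e + \<gamma> x *\<^sub>R f + \<delta> x *\<^sub>R c) (\<alpha> y *\<^sub>R H + \<beta> y *\<^sub>R e + \<gamma> y *\<^sub>R f + \<delta> y *\<^sub>R c)"
      using eq[of x] eq[of y] by simp
    also have "\<dots> = (p * (\<beta> x * \<gamma> y - \<gamma> x * \<beta> y)) *\<^sub>R H + (q * (\<alpha> x * \<gamma> y - \<gamma> x * \<alpha> y)) *\<^sub>R e +
        (\<alpha> x * \<beta> y - \<beta> x * \<alpha> y) *\<^sub>R f + 0 *\<^sub>R c"
      by (simp add: br_add_left br_add_right br_scale_left br_scale_right rel rel' br_self central_A c(1) algebra_simps)
    finally show "br x y = (p * (\<beta> x * \<gamma> y - \<gamma> x * \<beta> y)) *\<^sub>R H + (q * (\<alpha> x * \<gamma> y - \<gamma> x * \<alpha> y)) *\<^sub>R e +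
        (\<alpha> x * \<beta> y - \<beta> x * \<alpha> y) *\<^sub>R f + 0 *\<^sub>R c" .
  qed
  define F where "F x = (\<alpha> x *\<^sub>R X + \<beta> x *\<^sub>R Y + \<gamma> x *\<^sub>R Z, \<delta> x)" for x
  have lin: "linear F"
    by (rule linearI) (simp_all add: F_def add scale scaleR_add_left scaleR_add_right)
  have "inj F"
  proof (rule linear_injective_0[OF lin, THEN iffD2], intro allI impI)
    fix x assume "F x = 0"
    hence "\<alpha> x = 0 \<and> \<beta> x = 0 \<and> \<gamma> x = 0" "\<delta> x = 0"
      using mat_zero[of "\<alpha> x" "\<beta> x" "\<gamma> x"] by (simp_all add: F_def zero_prod_def)
    thus "x = 0" using eq[of x] by simp
  qed
  moreover have "F ` UNIV = M \<times> UNIV"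
  proof
    show "F ` UNIV \<subseteq> M \<times> UNIV"
      unfolding F_def using M by blast
    show "M \<times> UNIV \<subseteq> F ` UNIV"
    proof
      fix v assume "v \<in> M \<times> (UNIV :: real set)"
      then obtain a b g d where v: "v = (a *\<^sub>R X + b *\<^sub>R Y + g *\<^sub>R Z, d)"
        by (auto simp: M)
      have "F (a *\<^sub>R H + b *\<^sub>R e + g *\<^sub>R f + d *\<^sub>R c) = v"
        using uniq[OF refl, of a b g d] by (simp add: F_def v)
      thus "v \<in> F ` UNIV" by blast
    qed
  qed
  ultimately have bij: "bij_betw F UNIV (M \<times> UNIV)"
    by (simp add: bij_betw_def)
  have "F (br x y) = sum_bracket commutator abelian_bracket (F x) (F y)" for x y
    unfolding F_def bracket[of x y, THEN conjunct1] bracket[of x y, THEN conjunct2, THEN conjunct1]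
      bracket[of x y, THEN conjunct2, THEN conjunct2, THEN conjunct1] bracket[of x y, THEN conjunct2, THEN conjunct2, THEN conjunct2]
    by (simp add: sum_bracket_def abelian_bracket_def bilinear_commutator mat_rel mat_rel' commutator_self algebra_simps)
  thus ?thesis
    unfolding lie_isomorphic_def using lin bij by blast
qed

section \<open>Matrix bases with prescribed structure constants\<close>

lemmas mat2_simps = vec_eq_iff forall_2 matrix_matrix_mult_def sum_2 commutator_def

text \<open>For q > 0 the operator ad X must have the eigenvalues r and -r with r = sqrt q, so
  \<open>X\<close> is diagonal. With Y = E12 + t E21 and Z = [X, Y], the condition [Y, Z] = p X
  becomes t = -p/4, for either sign of \<open>p\<close>.\<close>

lemma sl2_real_split:
  assumes "p \<noteq> 0" "q > 0"
  obtains X Y Z :: "real ^ 2 ^ 2" where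
    "commutator X Y = Z" "commutator X Z = q *\<^sub>R Y" "commutator Y Z = p *\<^sub>R X"
    "\<And>B. B \<in> sl2_real \<longleftrightarrow> (\<exists>\<alpha> \<beta> \<gamma>. B = \<alpha> *\<^sub>R X + \<beta> *\<^sub>R Y + \<gamma> *\<^sub>R Z)"
    "\<And>\<alpha> \<beta> \<gamma>. \<alpha> *\<^sub>R X + \<beta> *\<^sub>R Y + \<gamma> *\<^sub>R Z = 0 \<Longrightarrow> \<alpha> = 0 \<and> \<beta> = 0 \<and> \<gamma> = 0"
proof -
  define r where "r = sqrt q"
  have r: "r > 0" "q = r * r" using assms by (simp_all add: r_def)
  define X :: "real ^ 2 ^ 2" where "X = vector [vector [r / 2, 0], vector [0, - r / 2]]"
  define Y :: "real ^ 2 ^ 2" where "Y = vector [vector [0, 1], vector [- p / 4, 0]]"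
  define Z :: "real ^ 2 ^ 2" where "Z = vector [vector [0, r], vector [r * p / 4, 0]]"
  note defs = X_def Y_def Z_def
  show ?thesis
  proof (rule that[of X Y Z])
    show "commutator X Y = Z" "commutator X Z = q *\<^sub>R Y" "commutator Y Z = p *\<^sub>R X"
      by (simp_all add: defs mat2_simps r(2))
  next
    fix B :: "real ^ 2 ^ 2"
    show "B \<in> sl2_real \<longleftrightarrow> (\<exists>\<alpha> \<beta> \<gamma>. B = \<alpha> *\<^sub>R X + \<beta> *\<^sub>R Y + \<gamma> *\<^sub>R Z)"
    proof
      assume "B \<in> sl2_real"
      hence tr: "B $ 2 $ 2 = - B $ 1 $ 1"
        by (simp add: sl2_real_def trace_def sum_2)
      have "B = (2 * B $ 1 $ 1 / r) *\<^sub>R X + ((B $ 1 $ 2 - 4 * B $ 2 $ 1 / p) / 2) *\<^sub>R Y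
        + ((B $ 1 $ 2 + 4 * B $ 2 $ 1 / p) / (2 * r)) *\<^sub>R Z"
        using r assms tr by (simp add: defs vec_eq_iff forall_2 field_simps)
      thus "\<exists>\<alpha> \<beta> \<gamma>. B = \<alpha> *\<^sub>R X + \<beta> *\<^sub>R Y + \<gamma> *\<^sub>R Z"
        by blast
    qed (auto simp: defs sl2_real_def trace_def sum_2)
  next
    fix \<alpha> \<beta> \<gamma> assume "\<alpha> *\<^sub>R X + \<beta> *\<^sub>R Y + \<gamma> *\<^sub>R Z = 0"
    hence "\<alpha> * r = 0" and 1: "\<beta> + \<gamma> * r = 0" and "p * (\<gamma> * r - \<beta>) = 0"
      by (auto simp: defs vec_eq_iff forall_2 algebra_simps)
    hence "\<alpha> = 0" and 2: "\<gamma> * r - \<beta> = 0"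
      using r assms by auto
    have "\<beta> = 0" "\<gamma> * r = 0" using 1 2 by auto
    thus "\<alpha> = 0 \<and> \<beta> = 0 \<and> \<gamma> = 0"
      using \<open>\<alpha> = 0\<close> r by auto
  qed
qed

text \<open>For q < 0 the eigenvalues of ad X are imaginary, so \<open>X\<close> is r/2 times a
  rotation generator. With Y = diag(a, -a) and Z = [X, Y] one finds [Y, Z] = -4 a^2 X, which fixes
  \<open>a\<close>.\<close>

lemma sl2_real_nonsplit:
  assumes "p < 0" "q < 0"
  obtains X Y Z :: "real ^ 2 ^ 2" where
    "commutator X Y = Z" "commutator X Z = q *\<^sub>R Y" "commutator Y Z = p *\<^sub>R X"
    "\<And>B. B \<in> sl2_real \<longleftrightarrow> (\<exists>\<alpha> \<beta> \<gamma>. B = \<alpha> *\<^sub>R X + \<beta> *\<^sub>R Y + \<gamma> *\<^sub>R Z)"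
    "\<And>\<alpha> \<beta> \<gamma>. \<alpha> *\<^sub>R X + \<beta> *\<^sub>R Y + \<gamma> *\<^sub>R Z = 0 \<Longrightarrow> \<alpha> = 0 \<and> \<beta> = 0 \<and> \<gamma> = 0"
proof -
  define r where "r = sqrt (- q)"
  define a where "a = sqrt (- p) / 2"
  have r: "r > 0" "q = - r * r" and a: "a > 0" "p = - 4 * a * a"
    using assms by (simp_all add: r_def a_def)
  define X :: "real ^ 2 ^ 2" where "X = vector [vector [0, r / 2], vector [- r / 2, 0]]"
  define Y :: "real ^ 2 ^ 2" where "Y = vector [vector [a, 0], vector [0, - a]]"
  define Z :: "real ^ 2 ^ 2" where "Z = vector [vector [0, - r * a], vector [- r * a, 0]]"
  note defs = X_def Y_def Z_def
  show ?thesis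
  proof (rule that[of X Y Z])
    show "commutator X Y = Z" "commutator X Z = q *\<^sub>R Y" "commutator Y Z = p *\<^sub>R X"
      by (simp_all add: defs mat2_simps r(2) a(2))
  next
    fix B :: "real ^ 2 ^ 2"
    show "B \<in> sl2_real \<longleftrightarrow> (\<exists>\<alpha> \<beta> \<gamma>. B = \<alpha> *\<^sub>R X + \<beta> *\<^sub>R Y + \<gamma> *\<^sub>R Z)"
    proof
      assume "B \<in> sl2_real"
      hence tr: "B $ 2 $ 2 = - B $ 1 $ 1"
        by (simp add: sl2_real_def trace_def sum_2)
      have "B = ((B $ 1 $ 2 - B $ 2 $ 1) / r) *\<^sub>R X + (B $ 1 $ 1 / a) *\<^sub>R Y
        + (- (B $ 1 $ 2 + B $ 2 $ 1) / (2 * r * a)) *\<^sub>R Z"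
        using r a tr by (simp add: defs vec_eq_iff forall_2 field_simps)
      thus "\<exists>\<alpha> \<beta> \<gamma>. B = \<alpha> *\<^sub>R X + \<beta> *\<^sub>R Y + \<gamma> *\<^sub>R Z"
        by blast
    qed (auto simp: defs sl2_real_def trace_def sum_2)
  next
    fix \<alpha> \<beta> \<gamma> assume "\<alpha> *\<^sub>R X + \<beta> *\<^sub>R Y + \<gamma> *\<^sub>R Z = 0"
    hence "\<beta> * a = 0" and 1: "r * (\<alpha> / 2 - \<gamma> * a) = 0" and 2: "r * (\<alpha> / 2 + \<gamma> * a) = 0"
      by (auto simp: defs vec_eq_iff forall_2 algebra_simps)
    hence "\<beta> = 0" using a by simp
    moreover have "\<alpha> / 2 - \<gamma> * a = 0" "\<alpha> / 2 + \<gamma> * a = 0"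
      using 1 2 r by auto
    hence "\<alpha> = 0" "\<gamma> * a = 0" by auto
    ultimately show "\<alpha> = 0 \<and> \<beta> = 0 \<and> \<gamma> = 0"
      using a by auto
  qed
qed

lemma su2_iff:
  "B \<in> su2 \<longleftrightarrow> Re (B $ 1 $ 1) = 0 \<and> Re (B $ 2 $ 2) = 0 \<and> Im (B $ 2 $ 2) = - Im (B $ 1 $ 1) \<and>
     Re (B $ 2 $ 1) = - Re (B $ 1 $ 2) \<and> Im (B $ 2 $ 1) = Im (B $ 1 $ 2)"
proof -
  have "x = - x \<longleftrightarrow> x = 0" for x :: real by linarith
  thus ?thesis
    unfolding su2_def mem_Collect_eq vec_eq_iff forall_2 complex_eq_iff trace_def sum_2
    by simp linarith
qed

text \<open>\<open>X\<close> is again elliptic, now diagonal with entries i r/2 and -i r/2. The real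
  skew \<open>Y\<close> of size \<open>a\<close> and Z = [X, Y] give [Y, Z] = 4 a^2 X, hence the
  opposite sign of \<open>p\<close>.\<close>

lemma su2_basis:
  assumes "p > 0" "q < 0"
  obtains X Y Z :: "complex ^ 2 ^ 2" where
    "commutator X Y = Z" "commutator X Z = q *\<^sub>R Y" "commutator Y Z = p *\<^sub>R X"
    "\<And>B. B \<in> su2 \<longleftrightarrow> (\<exists>\<alpha> \<beta> \<gamma>. B = \<alpha> *\<^sub>R X + \<beta> *\<^sub>R Y + \<gamma> *\<^sub>R Z)"
    "\<And>\<alpha> \<beta> \<gamma>. \<alpha> *\<^sub>R X + \<beta> *\<^sub>R Y + \<gamma> *\<^sub>R Z = 0 \<Longrightarrow> \<alpha> = 0 \<and> \<beta> = 0 \<and> \<gamma> = 0"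
proof -
  define r where "r = sqrt (- q)"
  define a where "a = sqrt p / 2"
  have r: "r > 0" "q = - r * r" and a: "a > 0" "p = 4 * a * a"
    using assms by (simp_all add: r_def a_def)
  define X :: "complex ^ 2 ^ 2" where "X = vector [vector [Complex 0 (r / 2), 0], vector [0, Complex 0 (- r / 2)]]"
  define Y :: "complex ^ 2 ^ 2" where "Y = vector [vector [0, Complex a 0], vector [Complex (- a) 0, 0]]"
  define Z :: "complex ^ 2 ^ 2" where "Z = vector [vector [0, Complex 0 (r * a)], vector [Complex 0 (r * a), 0]]"
  note defs = X_def Y_def Z_def
  show ?thesis
  proof (rule that[of X Y Z])
    show "commutator X Y = Z" "commutator X Z = q *\<^sub>R Y" "commutator Y Z = p *\<^sub>R X"
      by (simp_all add: defs mat2_simps r(2) a(2) complex_eq_iff)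
  next
    fix B :: "complex ^ 2 ^ 2"
    show "B \<in> su2 \<longleftrightarrow> (\<exists>\<alpha> \<beta> \<gamma>. B = \<alpha> *\<^sub>R X + \<beta> *\<^sub>R Y + \<gamma> *\<^sub>R Z)"
    proof
      assume "B \<in> su2"
      hence tr: "Re (B $ 2 $ 2) = - Re (B $ 1 $ 1)" "Im (B $ 2 $ 2) = - Im (B $ 1 $ 1)"
        "Re (B $ 1 $ 1) = 0" "Re (B $ 2 $ 1) = - Re (B $ 1 $ 2)" "Im (B $ 2 $ 1) = Im (B $ 1 $ 2)"
        by (simp_all add: su2_iff)
      have "B = (2 * Im (B $ 1 $ 1) / r) *\<^sub>R X + (Re (B $ 1 $ 2) / a) *\<^sub>R Y
        + (Im (B $ 1 $ 2) / (r * a)) *\<^sub>R Z"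
        using r a tr by (simp add: defs vec_eq_iff forall_2 complex_eq_iff)
      thus "\<exists>\<alpha> \<beta> \<gamma>. B = \<alpha> *\<^sub>R X + \<beta> *\<^sub>R Y + \<gamma> *\<^sub>R Z"
        by blast
    qed (auto simp: defs su2_iff)
  next
    fix \<alpha> \<beta> \<gamma> assume "\<alpha> *\<^sub>R X + \<beta> *\<^sub>R Y + \<gamma> *\<^sub>R Z = 0"
    thus "\<alpha> = 0 \<and> \<beta> = 0 \<and> \<gamma> = 0"
      using r a by (auto simp: defs vec_eq_iff forall_2 complex_eq_iff)
  qed
qed

text \<open>In the basis \<open>H\<close>, \<open>e\<close>, \<open>f\<close> the Killing form is
  diagonal with entries 2q, -2p, 2pq. It is negative definite, the compact case, exactly when q < 0
  < p.\<close>

theorem (in reductive_lcs) classification: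
  "lie_isomorphic br UNIV (sum_bracket commutator abelian_bracket) (su2 \<times> (UNIV :: real set))
   \<or> lie_isomorphic br UNIV (sum_bracket commutator abelian_bracket) (sl2_real \<times> (UNIV :: real set))"
proof -
  obtain e f p q where rel: "br H e = f" "br H f = q *\<^sub>R e" "br e f = p *\<^sub>R H" and pq: "p \<noteq> 0" "q \<noteq> 0"
    and spans: "\<And>x. \<exists>\<alpha> \<beta> \<gamma> \<delta>. x = \<alpha> *\<^sub>R H + \<beta> *\<^sub>R e + \<gamma> *\<^sub>R f + \<delta> *\<^sub>R c"
    and zero: "\<And>\<alpha> \<beta> \<gamma> \<delta>. \<alpha> *\<^sub>R H + \<beta> *\<^sub>R e + \<gamma> *\<^sub>R f + \<delta> *\<^sub>R c = 0 \<Longrightarrow> \<alpha> = 0 \<and> \<beta> = 0 \<and> \<gamma> = 0 \<and> \<delta> = 0"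
    by (rule standard_basis) (rule that)
  note iso = lie_isomorphic_matrices[OF rel spans zero]
  consider "q > 0" | "q < 0" "p < 0" | "q < 0" "p > 0"
    using pq by linarith
  thus ?thesis
  proof cases
    case 1
    show ?thesis
      by (rule sl2_real_split[OF pq(1) 1], rule disjI2, rule iso)
  next
    case 2
    show ?thesis
      by (rule sl2_real_nonsplit[OF 2(2,1)], rule disjI2, rule iso)
  next
    case 3
    show ?thesis
      by (rule su2_basis[OF 3(2,1)], rule disjI1, rule iso)
  qed
qed

theorem corollary3p2:
  fixes br :: "'a::real_vector \<Rightarrow> 'a \<Rightarrow> 'a"
    and n :: nat
    and \<Omega> \<theta> :: "'a form"
  assumes "lcs_lie_algebra br n \<Omega> \<theta>"
    and "lie_reductive br UNIV"
    and "\<theta> \<noteq> (\<lambda>v. 0)"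
  shows "lie_isomorphic br UNIV (sum_bracket commutator abelian_bracket) (su2 \<times> (UNIV :: real set))
       \<or> lie_isomorphic br UNIV (sum_bracket commutator abelian_bracket) (sl2_real \<times> (UNIV :: real set))"
proof -
  interpret lcs_lie_algebra br n \<Omega> \<theta> by fact
  obtain S A where SA: "lie_ideal br UNIV S" "lie_ideal br UNIV A" "S \<inter> A = {0}"
    "{s + a |s a. s \<in> S \<and> a \<in> A} = UNIV" "lie_semisimple br S" "lie_abelian br A"
    using assms(2) by (auto simp: lie_reductive_def)
  obtain C :: "'a set" where C: "finite C" "span C = UNIV"
    using finite_dim by blast
  obtain R :: "'a set" where R: "independent R" "UNIV \<subseteq> span R"
    using maximal_independent_subset[of "UNIV :: 'a set"] by metis
  have "finite R"
    using independent_span_bound[OF C(1) R(1)] C(2) by simp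
  \<comment> \<open>A 2-form reads the entries 0 and 1 only, so the values of the sequence beyond
    them are arbitrary; likewise for \<open>th\<close> beyond entry 0.\<close>
  define om where "om x y = \<Omega> (\<lambda>i. if i = 0 then x else y)" for x y
  define th where "th x = \<theta> (\<lambda>i. x)" for x
  have \<Omega>: "\<Omega> w = om (w 0) (w 1)" for w
    unfolding om_def
    by (rule form_\<Omega>[unfolded alternating_form_def, THEN conjunct1, rule_format]) (auto simp: less_2_cases_iff)
  have \<theta>: "\<theta> w = th (w 0)" for w
    unfolding th_def
    by (rule form_\<theta>[unfolded alternating_form_def, THEN conjunct1, rule_format]) simp
  have om_self: "om x x = 0" for x
    unfolding om_def
    by (rule form_\<Omega>[unfolded alternating_form_def, THEN conjunct2, THEN conjunct2, rule_format, of 0 1]) simp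
  have om_right: "linear (om x)" for x
  proof -
    have "linear (\<lambda>y. \<Omega> ((\<lambda>i. x)(1 := y)))"
      using form_\<Omega> by (simp add: alternating_form_def)
    thus ?thesis by (simp add: \<Omega>)
  qed
  have om_left: "linear (\<lambda>x. om x y)" for y
  proof -
    have "linear (\<lambda>x. \<Omega> ((\<lambda>i. y)(0 := x)))"
      using form_\<Omega> by (simp add: alternating_form_def)
    thus ?thesis by (simp add: \<Omega>)
  qed
  have om_anti: "om x y = - om y x" for x y
  proof -
    have "om x y + om y x = 0"
      using om_self[of "x + y"] unfolding linear_add[OF om_right] linear_add[OF om_left] by (simp add: om_self)
    thus ?thesis by linarith
  qed
  have th_linear: "linear th"
  proof -
    have "linear (\<lambda>x. \<theta> ((\<lambda>i. 0)(0 := x)))"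
      by (rule form_\<theta>[unfolded alternating_form_def, THEN conjunct2, THEN conjunct1, rule_format]) simp
    thus ?thesis by (simp add: \<theta>)
  qed
  interpret reductive_lcs br R S A om th
  proof (intro reductive_lcs.intro reductive_lie_algebra.intro based_lie_algebra.intro lie_algebra_axioms
      based_lie_algebra_axioms.intro reductive_lie_algebra_axioms.intro reductive_lcs_axioms.intro SA)
    show "finite R" "independent R" "span R = UNIV" by (use \<open>finite R\<close> R in auto)
    show "linear (om x)" "om x y = - om y x" "linear th" for x y
      by (fact om_right om_anti th_linear)+
    show "th (br x y) = 0" for x y
      using fun_cong[OF d_\<theta>, of "\<lambda>i. if i = 0 then x else y"] ce_diff_1[of \<theta> th, OF \<theta>] by simp
    show "- om (br x y) z + om (br x z) y - om (br y z) x = th x * om y z + th y * om z x + th z * om x y" for x y z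
      using fun_cong[OF d_\<Omega>, of "\<lambda>i. if i = 0 then x else if i = 1 then y else z"]
      unfolding ce_diff_2[of \<Omega> om, OF \<Omega>] wedge_1_2[of \<theta> th \<Omega> om, OF \<theta> \<Omega> om_anti] by simp
    show "u = 0" if u: "\<And>y. om u y = 0" for u
    proof (rule ccontr)
      assume "u \<noteq> 0"
      have "om y u = 0" for y
        using om_anti[of y u] u by simp
      \<comment> \<open>By antisymmetry \<open>u\<close> kills \<Omega> in either slot, as
        \<open>wedge_power_kernel\<close> requires; the nonzero top power then forces u = 0.\<close>
      hence "\<Omega> v = 0" if "i < 2" "v i = u" for v i
        using that u by (auto simp: \<Omega> less_2_cases_iff)
      hence "wedge_power 2 \<Omega> n = (\<lambda>v. 0)"
        using wedge_power_kernel[OF alternating_form_multilinear[OF form_\<Omega>] dim_eq] n_ge_2 \<open>u \<noteq> 0\<close> by simp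
      thus False using nondegenerate by simp
    qed
    show "\<exists>x. th x \<noteq> 0"
      using assms(3) \<theta> by auto
    show "dim (UNIV :: 'a set) \<ge> 4"
      using dim_eq n_ge_2 by simp
  qed
  show ?thesis by (rule classification)
qed

end
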